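(* Let $C$ be a $\gamma$-Lipschitz cost function, let $\varepsilon>0$, and let $\phi$ be an entropy function such that (A1) $\phi^*$ is strictly convex (on its domain) and (A2) there exist a sequence $(x_n)_n\subset\mathrm{dom}(\phi^* )$ and $s_n\in\partial\phi^*(x_n)$ such that $s_n$ converges either to $0$ or to $+\infty$. Then $\mathrm{OT}_\varepsilon$ is differentiable on $\mathcal{M}_{++}(X)^2$ in the following sense: for every $(\alpha,\beta)\in\mathcal{M}_{++}(X)^2$ there are functions $\nabla_\alpha\mathrm{OT}_\varepsilon,\nabla_\beta\mathrm{OT}_\varepsilon\in\mathcal{C}(X)$ such that for all signed measures $\delta\alpha,\delta\beta$, and $t$ in a neighborhood of $0$ with $\alpha+t\delta\alpha,\ \beta+t\delta\beta\in\mathcal{M}_+(X)$, $$\mathrm{OT}_\varepsilon(\alpha+t\delta\alpha,\beta+t\delta\beta)=\mathrm{OT}_\varepsilon(\alpha,\beta)+t\langle\delta\alpha,\nabla_\alpha\mathrm{OT}_\varepsilon\rangle+t\langle\delta\beta,\nabla_\beta\mathrm{OT}_\varepsilon\rangle+o(t).$$ Moreover, if $(f,g)$ denotes the unique pair of potentials verifying $f=\mathcal{AS}_\beta(g)$ and $g=\mathcal{AS}_\alpha(f)$ everywhere on $X$, then $$\nabla_\alpha\mathrm{OT}_\varepsilon=-\phi^*(-f)-\varepsilon\langle\beta,e^{(f\oplus g-C)/\varepsilon}-1\rangle,\qquad \nabla_\beta\mathrm{OT}_\varepsilon=-\phi^*(-g)-\varepsilon\langle\alpha,e^{(f\oplus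 g-C)/\varepsilon}-1\rangle,$$ where the first bracket is integrated in $y$ against $\beta$ (giving a function of $x$) and the second in $x$ against $\alpha$ (giving a function of $y$). If furthermore $\phi^*$ is differentiable, then $\nabla\phi^*(-f)=\langle\beta,e^{(f\oplus g-C)/\varepsilon}\rangle$ and $\nabla\phi^*(-g)=\langle\alpha,e^{(f\oplus g-C)/\varepsilon}\rangle$.
   Context: $(X,d_X)$ is a compact metric space; $\mathcal{C}(X)$ is the space of continuous real functions; $\mathcal{M}_+(X)$ is the set of positive (finite) Radon measures, $\mathcal{M}_{++}(X)=\mathcal{M}_+(X)\setminus\{0\}$; $\langle\alpha,f\rangle=\int f\,d\alpha$; $(f\oplus g)(x,y)=f(x)+g(y)$. The cost $C:X^2\to\mathbb{R}$ is symmetric and continuous; $\gamma$-Lipschitz means $\|C(x,\cdot)-C(y,\cdot)\|_\infty\le\gamma d_X(x,y)$. An entropy function is a convex, lower semicontinuous $\phi\ge 0$ on $[0,\infty)$ (values in $[0,+\infty]$; the value at $0$ is the lower semicontinuous extension) with $\phi(1)=0$, extended by $+\infty$ on $(-\infty,0)$. $\phi^*(q)=\sup_{p\ge0}pq-\phi(p)$. $D_\phi(\alpha|\beta)=\int\phi(\frac{d\alpha}{d\beta})d\beta+\phi'_\infty\int d\alpha^\perp$, with Lebesgue decomposition $\alpha=\frac{d\alpha}{d\beta}\beta+\alpha^\perp$ and $\phi'_\infty=\lim_{x\to\infty}\phi(x)/x$. $\mathrm{KL}(\mu|\nu)=\int\log(\frac{d\mu}{d\nu})d\mu-\int d\mu+\int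 d\nu$ ($+\infty$ if $\mu\not\ll\nu$). $\mathrm{OT}_\varepsilon(\alpha,\beta)=\inf_{\pi\in\mathcal{M}_+(X^2)}\int C\,d\pi+D_\phi(\pi_1|\alpha)+D_\phi(\pi_2|\beta)+\varepsilon\mathrm{KL}(\pi|\alpha\otimes\beta)$, with $\pi_1,\pi_2$ the marginals of $\pi$; dually it is the supremum over $(f,g)\in\mathcal{C}(X)^2$ of $-\langle\alpha,\phi^*(-f)\rangle-\langle\beta,\phi^*(-g)\rangle-\varepsilon\langle\alpha\otimes\beta,e^{(f\oplus g-C)/\varepsilon}-1\rangle$. $\mathrm{Aprox}^\varepsilon_{\phi^*}(p)=\arg\min_{q\in\mathbb{R}}\varepsilon e^{(p-q)/\varepsilon}+\phi^*(q)$. $\mathcal{S}_\alpha(f)(y)=-\varepsilon\log\int e^{(f(x)-C(x,y))/\varepsilon}d\alpha(x)$, $\mathcal{S}_\beta(g)(x)=-\varepsilon\log\int e^{(g(y)-C(x,y))/\varepsilon}d\beta(y)$; $\mathcal{AS}_\alpha(f)=-\mathrm{Aprox}^\varepsilon_{\phi^*}(-\mathcal{S}_\alpha(f))$ and $\mathcal{AS}_\beta(g)=-\mathrm{Aprox}^\varepsilon_{\phi^*}(-\mathcal{S}_\beta(g))$, pointwise. *)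

theory Defs
  imports "HOL-Analysis.Analysis" "HOL-Library.Landau_Symbols"
begin

section \<open>Entropy functions and convex analysis on the line\<close>

text \<open>
  An entropy function has values in the extended nonnegative reals. For a convex function with
  value \<open>0\<close> at \<open>1\<close>, lower semicontinuity on the closed half-line forces the value at \<open>0\<close> to be
  the limit from the right, so the convention on that value needs no separate clause.
\<close>

definition entropy_function :: "(real \<Rightarrow> ennreal) \<Rightarrow> bool" where
  "entropy_function \<phi> \<longleftrightarrow>
     (\<forall>x\<ge>0. \<forall>y\<ge>0. \<forall>u\<in>{0..1}.
        \<phi> ((1 - u) * x + u * y) \<le> ennreal (1 - u) * \<phi> x + ennreal u * \<phi> y) \<and>
     (\<forall>x\<ge>0. \<phi> x \<le> Liminf (at x within {0..}) \<phi>) \<and>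
     \<phi> 1 = 0 \<and>
     (\<forall>x<0. \<phi> x = \<infinity>)"

definition recession :: "(real \<Rightarrow> ennreal) \<Rightarrow> ennreal" where
  "recession \<phi> = Lim at_top (\<lambda>x. \<phi> x / ennreal x)"

definition legendre :: "(real \<Rightarrow> ennreal) \<Rightarrow> real \<Rightarrow> ereal" where
  "legendre \<phi> q = (SUP p\<in>{0..}. ereal (p * q) - enn2ereal (\<phi> p))"

text \<open>The next notions are only used for functions that never take the value \<open>-\<infinity>\<close>.\<close>

definition effective_domain :: "(real \<Rightarrow> ereal) \<Rightarrow> real set" where
  "effective_domain F = {q. F q < \<infinity>}"

definition strictly_convex_on_domain :: "(real \<Rightarrow> ereal) \<Rightarrow> bool" where
  "strictly_convex_on_domain F \<longleftrightarrow>
     (\<forall>x\<in>effective_domain F. \<forall>y\<in>effective_domain F. \<forall>u\<in>{0<..<1}. x \<noteq> y \<longrightarrow>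
        F ((1 - u) * x + u * y) < ereal (1 - u) * F x + ereal u * F y)"

definition subdifferential :: "(real \<Rightarrow> ereal) \<Rightarrow> real \<Rightarrow> real set" where
  "subdifferential F x = {s. \<forall>y. F x + ereal (s * (y - x)) \<le> F y}"

text \<open>
  The interior condition is needed because \<^const>\<open>real_of_ereal\<close> maps \<open>\<infinity>\<close> to \<open>0\<close>.
\<close>

definition has_finite_derivative :: "(real \<Rightarrow> ereal) \<Rightarrow> real \<Rightarrow> real \<Rightarrow> bool" where
  "has_finite_derivative F D q \<longleftrightarrow>
     q \<in> interior (effective_domain F) \<and>
     ((\<lambda>x. real_of_ereal (F x)) has_real_derivative D) (at q)"

definition differentiable_on_domain :: "(real \<Rightarrow> ereal) \<Rightarrow> bool" where
  "differentiable_on_domain F \<longleftrightarrow>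
     (\<forall>q\<in>effective_domain F. \<exists>D. has_finite_derivative F D q)"


section \<open>Measures\<close>

text \<open>On a compact metric space every finite Borel measure is a Radon measure.\<close>

definition pos_measures :: "'a::topological_space measure set" where
  "pos_measures = {\<mu>. sets \<mu> = sets borel \<and> finite_measure \<mu>}"

definition nonzero_pos_measures :: "'a::topological_space measure set" where
  "nonzero_pos_measures = pos_measures - {null_measure borel}"

definition signed_measure :: "('a::topological_space set \<Rightarrow> real) \<Rightarrow> bool" where
  "signed_measure \<sigma> \<longleftrightarrow>
     \<sigma> {} = 0 \<and>
     (\<forall>A. range A \<subseteq> sets borel \<longrightarrow> disjoint_family A \<longrightarrow>
        (\<lambda>n::nat. \<sigma> (A n)) sums \<sigma> (\<Union>n. A n))"

text \<open>
  The upper variation, i.e. the positive part in the Jordan decomposition; the negative part of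
  \<open>\<sigma>\<close> is the upper variation of \<open>-\<sigma>\<close>. The empty set makes the supremum nonnegative, so
  truncating negative values by \<^const>\<open>ennreal\<close> does not change it.
\<close>

definition upper_variation :: "('a::topological_space set \<Rightarrow> real) \<Rightarrow> 'a measure" where
  "upper_variation \<sigma> = measure_of UNIV (sets borel)
     (\<lambda>A. SUP B\<in>{B \<in> sets borel. B \<subseteq> A}. ennreal (\<sigma> B))"

definition signed_integral :: "('a::topological_space set \<Rightarrow> real) \<Rightarrow> ('a \<Rightarrow> real) \<Rightarrow> real" where
  "signed_integral \<sigma> f =
     (LINT x|upper_variation \<sigma>. f x) - (LINT x|upper_variation (\<lambda>A. - \<sigma> A). f x)"

text \<open>
  The measure \<open>\<alpha> + t \<sigma>\<close>, meaningful for \<open>t\<close> in the set \<open>perturb_times\<close> of those \<open>t\<close> for which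
  this signed measure is nonnegative.
\<close>

definition perturb ::
  "'a::topological_space measure \<Rightarrow> real \<Rightarrow> ('a set \<Rightarrow> real) \<Rightarrow> 'a measure" where
  "perturb \<alpha> t \<sigma> = measure_of UNIV (sets borel) (\<lambda>A. ennreal (measure \<alpha> A + t * \<sigma> A))"

definition perturb_times ::
  "'a::topological_space measure \<Rightarrow> ('a set \<Rightarrow> real) \<Rightarrow> real set" where
  "perturb_times \<alpha> \<sigma> = {t. \<forall>A\<in>sets borel. 0 \<le> measure \<alpha> A + t * \<sigma> A}"


section \<open>Divergences\<close>

text \<open>
  \<open>\<alpha> = r \<beta> + \<sigma>\<close> with \<open>\<sigma>\<close> singular to \<open>\<beta>\<close>. (The library's \<^const>\<open>RN_deriv\<close> only covers the
  absolutely continuous case.)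
\<close>

definition lebesgue_decomposition ::
  "'a::topological_space measure \<Rightarrow> 'a measure \<Rightarrow> ('a \<Rightarrow> real) \<Rightarrow> 'a measure \<Rightarrow> bool" where
  "lebesgue_decomposition \<alpha> \<beta> r \<sigma> \<longleftrightarrow>
     r \<in> borel_measurable borel \<and> (\<forall>x. 0 \<le> r x) \<and>
     \<sigma> \<in> pos_measures \<and>
     (\<exists>N\<in>sets borel. emeasure \<beta> N = 0 \<and> emeasure \<sigma> (UNIV - N) = 0) \<and>
     (\<forall>A\<in>sets borel. emeasure \<alpha> A = emeasure (density \<beta> (\<lambda>x. ennreal (r x))) A + emeasure \<sigma> A)"

text \<open>
  The value does not depend on the version of the density, hence the definite description.
  In \<^typ>\<open>ennreal\<close>, \<open>\<infinity> * 0 = 0\<close>, which is the convention when the singular part vanishes.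
\<close>

definition phi_divergence ::
  "(real \<Rightarrow> ennreal) \<Rightarrow> 'a::topological_space measure \<Rightarrow> 'a measure \<Rightarrow> ennreal" where
  "phi_divergence \<phi> \<alpha> \<beta> =
     (THE d. \<exists>r \<sigma>. lebesgue_decomposition \<alpha> \<beta> r \<sigma> \<and>
        d = (\<integral>\<^sup>+ x. \<phi> (r x) \<partial>\<beta>) + recession \<phi> * emeasure \<sigma> UNIV)"

text \<open>
  For finite measures \<open>\<mu> \<lless> \<nu>\<close> the negative part of \<open>log (d\<mu>/d\<nu>)\<close> is always \<open>\<mu>\<close>-integrable, so
  failure of integrability means that the integral is \<open>+\<infinity>\<close> (whereas the Bochner integral would
  default to \<open>0\<close>).
\<close>

definition KL :: "'a measure \<Rightarrow> 'a measure \<Rightarrow> ereal" where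
  "KL \<mu> \<nu> =
     (if absolutely_continuous \<nu> \<mu> \<and> integrable \<mu> (\<lambda>x. ln (enn2real (RN_deriv \<nu> \<mu> x)))
      then ereal ((LINT x|\<mu>. ln (enn2real (RN_deriv \<nu> \<mu> x)))
             - measure \<mu> (space \<mu>) + measure \<nu> (space \<nu>))
      else \<infinity>)"


section \<open>Entropic unbalanced optimal transport\<close>

definition OT ::
  "real \<Rightarrow> (real \<Rightarrow> ennreal) \<Rightarrow> ('a::topological_space \<Rightarrow> 'a \<Rightarrow> real) \<Rightarrow>
     'a measure \<Rightarrow> 'a measure \<Rightarrow> ereal" where
  "OT \<epsilon> \<phi> C \<alpha> \<beta> =
     (INF \<pi>\<in>pos_measures.
        ereal (LINT z|\<pi>. C (fst z) (snd z))
        + enn2ereal (phi_divergence \<phi> (distr \<pi> borel fst) \<alpha>)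
        + enn2ereal (phi_divergence \<phi> (distr \<pi> borel snd) \<beta>)
        + ereal \<epsilon> * KL \<pi> (\<alpha> \<Otimes>\<^sub>M \<beta>))"

text \<open>The first argument of \<open>aprox\<close> is \<open>\<epsilon>\<close>, the second one is the conjugate of the entropy.\<close>

definition aprox :: "real \<Rightarrow> (real \<Rightarrow> ereal) \<Rightarrow> real \<Rightarrow> real" where
  "aprox \<epsilon> F p = arg_min (\<lambda>q. ereal (\<epsilon> * exp ((p - q) / \<epsilon>)) + F q) (\<lambda>_. True)"

text \<open>
  The cost is symmetric, so the same operator serves for both measures: the integration variable
  may be put in either argument of \<open>C\<close>.
\<close>

definition softmin ::
  "real \<Rightarrow> ('a \<Rightarrow> 'a \<Rightarrow> real) \<Rightarrow> 'a measure \<Rightarrow> ('a \<Rightarrow> real) \<Rightarrow> 'a \<Rightarrow> real" where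
  "softmin \<epsilon> C \<alpha> f y = - \<epsilon> * ln (LINT x|\<alpha>. exp ((f x - C x y) / \<epsilon>))"

definition aprox_softmin ::
  "real \<Rightarrow> (real \<Rightarrow> ennreal) \<Rightarrow> ('a \<Rightarrow> 'a \<Rightarrow> real) \<Rightarrow> 'a measure \<Rightarrow> ('a \<Rightarrow> real) \<Rightarrow> 'a \<Rightarrow> real" where
  "aprox_softmin \<epsilon> \<phi> C \<alpha> f y = - aprox \<epsilon> (legendre \<phi>) (- softmin \<epsilon> C \<alpha> f y)"

definition potentials ::
  "real \<Rightarrow> (real \<Rightarrow> ennreal) \<Rightarrow> ('a::topological_space \<Rightarrow> 'a \<Rightarrow> real) \<Rightarrow>
     'a measure \<Rightarrow> 'a measure \<Rightarrow> (('a \<Rightarrow> real) \<times> ('a \<Rightarrow> real)) set" where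
  "potentials \<epsilon> \<phi> C \<alpha> \<beta> =
     {(f, g). continuous_on UNIV f \<and> continuous_on UNIV g \<and>
        f = aprox_softmin \<epsilon> \<phi> C \<beta> g \<and> g = aprox_softmin \<epsilon> \<phi> C \<alpha> f}"

text \<open>
  First-order expansion of \<^const>\<open>OT\<close> at \<open>(\<alpha>, \<beta>)\<close> with gradients \<open>a\<close> and \<open>b\<close>. Here \<open>t\<close> tends to
  \<open>0\<close> within the set of admissible \<open>t\<close>, which may lie on one side of \<open>0\<close> only. The expansion is
  an equality of extended reals, so it includes finiteness of the perturbed values.
\<close>

definition has_OT_gradient ::
  "real \<Rightarrow> (real \<Rightarrow> ennreal) \<Rightarrow> ('a::topological_space \<Rightarrow> 'a \<Rightarrow> real) \<Rightarrow>
     'a measure \<Rightarrow> 'a measure \<Rightarrow> ('a \<Rightarrow> real) \<Rightarrow> ('a \<Rightarrow> real) \<Rightarrow> bool" where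
  "has_OT_gradient \<epsilon> \<phi> C \<alpha> \<beta> a b \<longleftrightarrow>
     \<bar>OT \<epsilon> \<phi> C \<alpha> \<beta>\<bar> \<noteq> \<infinity> \<and>
     (\<forall>\<sigma> \<tau>. signed_measure \<sigma> \<longrightarrow> signed_measure \<tau> \<longrightarrow>
        (\<exists>R \<in> o[at 0 within (perturb_times \<alpha> \<sigma> \<inter> perturb_times \<beta> \<tau>)](\<lambda>t. t).
           \<forall>\<^sub>F t in at 0 within (perturb_times \<alpha> \<sigma> \<inter> perturb_times \<beta> \<tau>).
             OT \<epsilon> \<phi> C (perturb \<alpha> t \<sigma>) (perturb \<beta> t \<tau>) =
               OT \<epsilon> \<phi> C \<alpha> \<beta>
               + ereal (t * signed_integral \<sigma> a + t * signed_integral \<tau> b + R t)))"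

end

theory Submission
  imports Defs
begin

text \<open>
  Write \<open>F = \<phi>\<^sup>*\<close>. A function \<open>g\<close> is the best response to \<open>f\<close> iff the marginal density
  \<open>\<langle>\<alpha>, exp ((f \<oplus> g - C) / \<epsilon>)\<rangle>\<close> is pointwise a subgradient of \<open>F\<close> at \<open>- g\<close>. Monotonicity of
  subgradients makes best responses \<open>\<gamma>\<close>-Lipschitz and nonexpansive, strict monotonicity makes
  mutual best responses unique, and (A2) bounds them a priori, uniformly for masses in a compact
  subset of \<open>(0, \<infinity>)\<close>. Existence follows by damping the nonexpansive map to a contraction and
  passing to the limit. Mutual best responses are dual optimal because the Gibbs measure
  \<open>exp ((f \<oplus> g - C) / \<epsilon>) \<alpha> \<otimes> \<beta>\<close> attains equality in the (pointwise) Fenchel--Young inequalities.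
  The expansion of \<open>OT\<close> is an envelope argument: inserting the potentials of one problem into the
  dual of the other bounds the increment from both sides.
\<close>

section \<open>Conjugates of entropy functions\<close>

text \<open>The Gibbs density depends on the potentials only through \<open>f x + g y\<close>, so it
  is unchanged by \<open>(f + c, g - c)\<close>. This shift is the noncompact direction of the dual
  problem: the size of the density controls only the sum of the potentials, and each of them is
  bounded by playing the two marginal densities against subgradients at \<open>- f\<close> and
  \<open>- g\<close>. It is also a direction in which uniqueness could fail, and strict monotonicity
  closes it.

  \<open>F\<close> may be nonsmooth or infinite, and the measures may have small support. Hence the
  optimality condition is an inclusion imposed at every point of the space: it passes to limits
  because the graph of the subdifferential is closed, and a pair known only almost everywhere is
  recovered everywhere by responding once more.

  For fixed potentials the dual objective is affine in each measure, so a perturbation changes it by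
  a polynomial of degree two in \<open>t\<close>. The lower bound of the expansion thus has an error
  of order \<open>t\<^sup>2\<close>. The upper bound involves potentials of perturbed problems,
  whose convergence comes from compactness without a rate; this is where the error becomes
  o(t).\<close>

locale entropy_fun =
  fixes \<phi> :: "real \<Rightarrow> ennreal"
  assumes entropy: "entropy_function \<phi>"
begin

abbreviation conjugate :: "real \<Rightarrow> ereal" where "conjugate \<equiv> legendre \<phi>"
abbreviation cdom :: "real set" where "cdom \<equiv> effective_domain (legendre \<phi>)"
text \<open>Meaningful on \<open>cdom\<close> only: elsewhere the infinite value is sent to 0, so
  estimates have to carry domain membership along.\<close>

definition cval :: "real \<Rightarrow> real" where "cval q = real_of_ereal (legendre \<phi> q)"
abbreviation subd :: "real \<Rightarrow> real set" where "subd \<equiv> subdifferential (legendre \<phi>)"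

section \<open>Finiteness, convexity and lower semicontinuity of the conjugate\<close>

lemma entropy_at_1: "\<phi> 1 = 0"
  using entropy by (simp add: entropy_function_def)

lemma conjugate_ge_affine: "0 \<le> p \<Longrightarrow> ereal (p * q) - enn2ereal (\<phi> p) \<le> conjugate q"
  unfolding legendre_def by (rule SUP_upper) auto

lemma conjugate_ge_arg: "ereal q \<le> conjugate q"
  using conjugate_ge_affine[of 1 q] by (simp add: entropy_at_1 zero_ennreal.rep_eq)

lemma conjugate_not_MInf [simp]: "conjugate q \<noteq> - \<infinity>"
  using conjugate_ge_arg[of q] by auto

lemma conjugate_eq_cval: "q \<in> cdom \<Longrightarrow> conjugate q = ereal (cval q)"
  using conjugate_not_MInf[of q] by (cases "conjugate q") (auto simp: cval_def effective_domain_def)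

lemma conjugate_le_ereal_iff: "conjugate q \<le> ereal c \<longleftrightarrow> q \<in> cdom \<and> cval q \<le> c"
  using conjugate_not_MInf[of q] by (cases "conjugate q") (auto simp: cval_def effective_domain_def)

lemma fenchel_young:
  assumes "0 \<le> p" "\<phi> p \<noteq> \<infinity>" "q \<in> cdom"
  shows "p * q - enn2real (\<phi> p) \<le> cval q"
proof -
  obtain r where "0 \<le> r" "\<phi> p = ennreal r" using assms(2) by (cases "\<phi> p") auto
  with conjugate_ge_affine[OF assms(1), of q] show ?thesis
    by (simp add: conjugate_eq_cval[OF assms(3)] enn2ereal_ennreal)
qed

text \<open>Only points where \<phi> is finite contribute relevant affine minorants. Bounding these
  real-valued minorants gives finiteness and a bound together; convexity and lower semicontinuity
  below are obtained in this way.\<close>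

lemma conjugate_leI:
  assumes "\<And>p. 0 \<le> p \<Longrightarrow> \<phi> p \<noteq> \<infinity> \<Longrightarrow> p * q - enn2real (\<phi> p) \<le> c"
  shows "q \<in> cdom" "cval q \<le> c"
proof -
  have "conjugate q \<le> ereal c"
    unfolding legendre_def
  proof (rule SUP_least)
    fix p :: real assume p: "p \<in> {0..}"
    show "ereal (p * q) - enn2ereal (\<phi> p) \<le> ereal c"
    proof (cases "\<phi> p")
      case (real r)
      then show ?thesis using assms[of p] p by (simp add: enn2ereal_ennreal)
    next
      case top
      then show ?thesis by (simp add: top_ereal_def top_ennreal.rep_eq)
    qed
  qed
  then show "q \<in> cdom" "cval q \<le> c" by (auto simp: conjugate_le_ereal_iff)
qed

lemma cval_ge_arg: "q \<in> cdom \<Longrightarrow> q \<le> cval q"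
  using conjugate_ge_arg[of q] by (simp add: conjugate_eq_cval)

lemma zero_in_cdom: "0 \<in> cdom" and cval_0: "cval 0 = 0"
proof -
  show 0: "0 \<in> cdom" by (rule conjugate_leI(1)[of 0 0]) auto
  have "cval 0 \<le> 0" by (rule conjugate_leI(2)) auto
  with cval_ge_arg[OF 0] show "cval 0 = 0" by simp
qed

section \<open>Subgradients of the conjugate\<close>

lemma subd_iff: "s \<in> subd x \<longleftrightarrow> x \<in> cdom \<and> (\<forall>y\<in>cdom. cval x + s * (y - x) \<le> cval y)"
proof
  assume s: "s \<in> subd x"
  \<comment> \<open>Testing at 0, where the conjugate is finite, excludes an infinite value at
    \<open>x\<close>.\<close>
  then have "conjugate x + ereal (s * (0 - x)) \<le> conjugate 0" unfolding subdifferential_def by blast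
  then have "conjugate x \<noteq> \<infinity>" by (auto simp: conjugate_eq_cval[OF zero_in_cdom])
  then have x: "x \<in> cdom" by (simp add: effective_domain_def)
  moreover have "cval x + s * (y - x) \<le> cval y" if "y \<in> cdom" for y
  proof -
    have "conjugate x + ereal (s * (y - x)) \<le> conjugate y" using s by (simp add: subdifferential_def)
    then show ?thesis by (simp add: conjugate_eq_cval x that)
  qed
  ultimately show "x \<in> cdom \<and> (\<forall>y\<in>cdom. cval x + s * (y - x) \<le> cval y)" by blast
next
  assume x: "x \<in> cdom \<and> (\<forall>y\<in>cdom. cval x + s * (y - x) \<le> cval y)"
  show "s \<in> subd x"
    unfolding subdifferential_def
  proof (intro CollectI allI)
    fix y
    show "conjugate x + ereal (s * (y - x)) \<le> conjugate y"
    proof (cases "y \<in> cdom")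
      case True
      with x show ?thesis by (simp add: conjugate_eq_cval)
    next
      case False
      then show ?thesis by (simp add: effective_domain_def)
    qed
  qed
qed

lemma subd_cdom: "s \<in> subd x \<Longrightarrow> x \<in> cdom"
  by (simp add: subd_iff)

lemma subd_ineq: "s \<in> subd x \<Longrightarrow> y \<in> cdom \<Longrightarrow> cval x + s * (y - x) \<le> cval y"
  by (simp add: subd_iff)

lemma cval_convex:
  assumes x: "x \<in> cdom" and y: "y \<in> cdom" and u: "0 \<le> u" "u \<le> 1"
  shows "(1 - u) * x + u * y \<in> cdom"
    and "cval ((1 - u) * x + u * y) \<le> (1 - u) * cval x + u * cval y"
proof -
  have *: "p * ((1 - u) * x + u * y) - enn2real (\<phi> p) \<le> (1 - u) * cval x + u * cval y"
    if "0 \<le> p" "\<phi> p \<noteq> \<infinity>" for p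
  proof -
    have "(1 - u) * (p * x - enn2real (\<phi> p)) + u * (p * y - enn2real (\<phi> p))
        \<le> (1 - u) * cval x + u * cval y"
      using u that x y by (intro add_mono mult_left_mono fenchel_young) auto
    then show ?thesis by (simp add: algebra_simps)
  qed
  from conjugate_leI[OF *] show "(1 - u) * x + u * y \<in> cdom"
    and "cval ((1 - u) * x + u * y) \<le> (1 - u) * cval x + u * cval y" by auto
qed

text \<open>A supremum of affine functions is lower semicontinuous. The varying bound
  \<open>c n\<close> makes this applicable to rearranged inequalities, coming from subgradients or
  from a minimizing sequence.\<close>

lemma cval_lsc:
  assumes q: "q \<longlonglongrightarrow> l" and c: "c \<longlonglongrightarrow> d"
    and dom: "\<And>n::nat. q n \<in> cdom" and le: "\<And>n. cval (q n) \<le> c n"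
  shows "l \<in> cdom" and "cval l \<le> d"
proof -
  have *: "p * l - enn2real (\<phi> p) \<le> d" if "0 \<le> p" "\<phi> p \<noteq> \<infinity>" for p
  proof (rule LIMSEQ_le)
    show "(\<lambda>n. p * q n - enn2real (\<phi> p)) \<longlonglongrightarrow> p * l - enn2real (\<phi> p)"
      by (intro tendsto_intros q)
    show "\<exists>N. \<forall>n\<ge>N. p * q n - enn2real (\<phi> p) \<le> c n"
      using fenchel_young[OF that dom] le by (meson order_trans)
  qed (rule c)
  from conjugate_leI[OF *] show "l \<in> cdom" "cval l \<le> d" by auto
qed

text \<open>The values \<open>cval (q n)\<close> are not known to converge. The subgradient
  inequality is therefore solved for \<open>cval (q n)\<close>, where lower semicontinuity alone
  permits passing to the limit.\<close>

lemma subd_closed: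
  assumes q: "q \<longlonglongrightarrow> l" and s: "s \<longlonglongrightarrow> r" and sub: "\<And>n::nat. s n \<in> subd (q n)"
  shows "r \<in> subd l"
proof -
  have *: "l \<in> cdom" "cval l \<le> cval y - r * (y - l)" if "y \<in> cdom" for y
  proof -
    have "(\<lambda>n. cval y - s n * (y - q n)) \<longlonglongrightarrow> cval y - r * (y - l)"
      by (intro tendsto_intros q s)
    from cval_lsc[OF q this] subd_cdom[OF sub] subd_ineq[OF sub that]
    show "l \<in> cdom" "cval l \<le> cval y - r * (y - l)" by (auto simp: algebra_simps)
  qed
  then show ?thesis using zero_in_cdom by (force simp: subd_iff)
qed

lemma subd_mono:
  assumes "s \<in> subd x" "r \<in> subd y" "x < y"
  shows "s \<le> r"
proof -
  have "cval x + s * (y - x) \<le> cval y" "cval y + r * (x - y) \<le> cval x"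
    using assms by (auto simp: subd_iff)
  then have "s * (y - x) \<le> r * (y - x)" by (simp add: algebra_simps)
  then show ?thesis using assms(3) by simp
qed

text \<open>If the two slopes agreed, the supporting lines at the end points would bound the
  midpoint value below by the average of the end values, against strict convexity.\<close>

lemma subd_strict_mono:
  assumes A1: "strictly_convex_on_domain conjugate"
    and s: "s \<in> subd x" and r: "r \<in> subd y" and xy: "x < y"
  shows "s < r"
proof (rule ccontr)
  assume "\<not> s < r"
  with subd_mono[OF s r xy] have rs: "r = s" by simp
  have dom: "x \<in> cdom" "y \<in> cdom" using s r by (auto intro: subd_cdom)
  let ?m = "(1 - 1/2) * x + (1/2) * y"
  have m: "?m \<in> cdom" using cval_convex(1)[OF dom, of "1/2"] by simp
  have "conjugate ?m < ereal (1 - 1/2) * conjugate x + ereal (1/2) * conjugate y"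
    by (intro A1[unfolded strictly_convex_on_domain_def, rule_format]) (use dom xy in auto)
  then have "cval ?m < (1 - 1/2) * cval x + (1/2) * cval y"
    using conjugate_eq_cval[OF m] by (simp add: conjugate_eq_cval dom)
  moreover have "cval x + s * (?m - x) \<le> cval ?m" by (rule subd_ineq[OF s m])
  moreover have "cval y + s * (?m - y) \<le> cval ?m" using subd_ineq[OF r m] rs by simp
  ultimately show False by (simp add: algebra_simps)
qed

text \<open>The dual form of \<open>\<phi> 1 = 0\<close>. It anchors the subdifferential: slopes
  left of 0 are at most 1 and slopes right of 0 at least 1, which normalizes the marginal densities
  in the a priori bounds.\<close>

lemma one_in_subd_0: "1 \<in> subd 0"
  by (simp add: subd_iff zero_in_cdom cval_0 cval_ge_arg)

lemma subd_le_1: "s \<in> subd q \<Longrightarrow> q < 0 \<Longrightarrow> s \<le> 1"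
  using subd_mono[OF _ one_in_subd_0] by blast

lemma subd_ge_1: "s \<in> subd q \<Longrightarrow> 0 < q \<Longrightarrow> 1 \<le> s"
  using subd_mono[OF one_in_subd_0] by blast

lemma cval_bounds:
  assumes "s \<in> subd q"
  shows "q \<le> cval q" "cval q \<le> s * q"
  using cval_ge_arg[OF subd_cdom[OF assms]] subd_ineq[OF assms zero_in_cdom] cval_0
  by (auto simp: algebra_simps)

text \<open>Bounds on subgradients at the two points take the place of a distance to the boundary of
  \<open>cdom\<close>, where potentials may well take values.\<close>

lemma cval_lipschitz:
  assumes "s \<in> subd q" "s' \<in> subd q'" "\<bar>s\<bar> \<le> S" "\<bar>s'\<bar> \<le> S"
  shows "\<bar>cval q - cval q'\<bar> \<le> S * \<bar>q - q'\<bar>"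
proof -
  have "cval q + s * (q' - q) \<le> cval q'" "cval q' + s' * (q - q') \<le> cval q"
    using assms by (auto simp: subd_iff)
  moreover have "\<bar>s * (q' - q)\<bar> \<le> S * \<bar>q - q'\<bar>" "\<bar>s' * (q - q')\<bar> \<le> S * \<bar>q - q'\<bar>"
    using assms(3,4) by (auto simp: abs_mult abs_minus_commute intro!: mult_right_mono)
  ultimately show ?thesis by linarith
qed

text \<open>Subtracting the supporting line turns \<open>q\<close> into a local minimum, where the
  derivative vanishes.\<close>

lemma subd_eq_derivative:
  assumes D: "has_finite_derivative conjugate D q" and s: "s \<in> subd q"
  shows "D = s"
proof -
  have q: "q \<in> interior cdom" and d: "(cval has_real_derivative D) (at q)"
    using D by (auto simp: has_finite_derivative_def cval_def[abs_def])
  obtain e where e: "0 < e" "ball q e \<subseteq> cdom" using q mem_interior by blast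
  have "((\<lambda>y. cval y - s * (y - q)) has_real_derivative (D - s)) (at q)"
    by (rule derivative_eq_intros d | simp)+
  moreover have "\<forall>y. \<bar>q - y\<bar> < e \<longrightarrow> cval q - s * (q - q) \<le> cval y - s * (y - q)"
  proof (intro allI impI)
    fix y assume "\<bar>q - y\<bar> < e"
    then have "y \<in> cdom" using e by (auto simp: dist_real_def)
    from subd_ineq[OF s this] show "cval q - s * (q - q) \<le> cval y - s * (y - q)" by simp
  qed
  ultimately have "D - s = 0" using e(1) DERIV_local_min[of _ "D - s" q e] by blast
  then show ?thesis by simp
qed

text \<open>Condition (A2) is used only here.\<close>

lemma subd_gap:
  assumes A2: "\<exists>x s :: nat \<Rightarrow> real.
       (\<forall>n. x n \<in> cdom \<and> s n \<in> subd (x n)) \<and>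
       (s \<longlonglongrightarrow> 0 \<or> filterlim s at_top sequentially)"
    and K: "0 < K"
  obtains B where "0 \<le> B"
    "\<And>q1 q2 s1 s2. s1 \<in> subd q1 \<Longrightarrow> s2 \<in> subd q2 \<Longrightarrow> q1 < - B \<Longrightarrow> B < q2 \<Longrightarrow> K * s1 < s2"
proof -
  obtain x s :: "nat \<Rightarrow> real" where sub: "\<And>n. s n \<in> subd (x n)"
    and lim: "s \<longlonglongrightarrow> 0 \<or> filterlim s at_top sequentially" using A2 by blast
  \<comment> \<open>Since slopes left of 0 are at most 1 and slopes right of 0 at least 1, their
    ratio exceeds \<open>K\<close> as soon as an intermediate slope \<open>s n\<close> lies below
    \<open>1 / K\<close> or above \<open>K\<close>. The bound \<open>\<bar>x n\<bar>\<close> puts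
    \<open>x n\<close> between \<open>q1\<close> and \<open>q2\<close>.\<close>
  from lim have "\<exists>n. s n < 1 / K \<or> K < s n"
  proof
    assume "s \<longlonglongrightarrow> 0"
    then have "eventually (\<lambda>n. s n < 1 / K) sequentially" using K by (intro order_tendstoD) auto
    then show ?thesis by (auto simp: eventually_sequentially)
  next
    assume "filterlim s at_top sequentially"
    then have "eventually (\<lambda>n. K < s n) sequentially" by (simp add: filterlim_at_top_dense)
    then show ?thesis by (auto simp: eventually_sequentially)
  qed
  then obtain n where n: "s n < 1 / K \<or> K < s n" by blast
  show thesis
  proof
    fix q1 q2 s1 s2 assume *: "s1 \<in> subd q1" "s2 \<in> subd q2" "q1 < - \<bar>x n\<bar>" "\<bar>x n\<bar> < q2"
    have 1: "s1 \<le> 1" "1 \<le> s2" using * by (auto intro: subd_le_1 subd_ge_1)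
    have 2: "s1 \<le> s n" "s n \<le> s2" using * subd_mono[OF *(1) sub[of n]] subd_mono[OF sub[of n] *(2)] by auto
    from n show "K * s1 < s2"
    proof
      assume "s n < 1 / K"
      then have "s1 < 1 / K" using 2 by simp
      then have "K * s1 < 1" using K by (simp add: field_simps)
      with 1 show ?thesis by simp
    next
      assume "K < s n"
      moreover have "K * s1 \<le> K" using 1 K by simp
      ultimately show ?thesis using 2 by simp
    qed
  qed simp
qed

section \<open>The proximal problem and its first-order condition\<close>

text \<open>The direct method. To the left the conjugate is bounded below by a linear function, by
  \<open>cval_ge_arg\<close>, and the exponential beats it; to the right \<open>cval_ge_arg\<close>
  itself gives coercivity. Lower semicontinuity handles the limit of a minimizing sequence.\<close>

lemma aprox_minimizer_exists:
  assumes eps: "0 < \<epsilon>"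
  shows "\<exists>q\<in>cdom. \<forall>y\<in>cdom. \<epsilon> * exp ((p - q) / \<epsilon>) + cval q \<le> \<epsilon> * exp ((p - y) / \<epsilon>) + cval y"
proof -
  define G where "G y = \<epsilon> * exp ((p - y) / \<epsilon>) + cval y" for y
  \<comment> \<open>The linear Taylor term of the exponential cancels against
    \<open>y \<le> cval y\<close>. The quadratic term is kept for \<open>y \<le> p\<close>, where it
    confines minimizing sequences.\<close>
  have lower: "\<epsilon> + p + (if y \<le> p then (p - y)\<^sup>2 / (2 * \<epsilon>) else 0) \<le> G y" if "y \<in> cdom" for y
  proof -
    have "1 + (p - y) / \<epsilon> + (if y \<le> p then ((p - y) / \<epsilon>)\<^sup>2 / 2 else 0) \<le> exp ((p - y) / \<epsilon>)"
      using exp_lower_Taylor_quadratic[of "(p - y) / \<epsilon>"] exp_ge_add_one_self[of "(p - y) / \<epsilon>"] eps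
      by auto
    then have "\<epsilon> * (1 + (p - y) / \<epsilon> + (if y \<le> p then ((p - y) / \<epsilon>)\<^sup>2 / 2 else 0)) \<le> \<epsilon> * exp ((p - y) / \<epsilon>)"
      using eps by (intro mult_left_mono) auto
    moreover have "\<epsilon> * (1 + (p - y) / \<epsilon> + (if y \<le> p then ((p - y) / \<epsilon>)\<^sup>2 / 2 else 0)) =
        \<epsilon> + (p - y) + (if y \<le> p then (p - y)\<^sup>2 / (2 * \<epsilon>) else 0)"
      using eps by (simp add: field_simps power2_eq_square)
    ultimately show ?thesis unfolding G_def using cval_ge_arg[OF that] by linarith
  qed
  have bdd: "bdd_below (G ` cdom)"
  proof (rule bdd_belowI2)
    fix y assume "y \<in> cdom"
    have "0 \<le> (if y \<le> p then (p - y)\<^sup>2 / (2 * \<epsilon>) else 0)" using eps by simp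
    with lower[OF \<open>y \<in> cdom\<close>] show "\<epsilon> + p \<le> G y" by linarith
  qed
  have ne: "cdom \<noteq> {}" using zero_in_cdom by auto
  define m where "m = (INF y\<in>cdom. G y)"
  have "\<exists>y\<in>cdom. G y < m + 1 / Suc n" for n
    using cInf_less_iff[of "G ` cdom" "m + 1 / Suc n"] bdd ne by (auto simp: m_def)
  then obtain Q where Q: "\<And>n. Q n \<in> cdom" "\<And>n. G (Q n) < m + 1 / Suc n" by metis
  have Gb: "G (Q n) \<le> m + 1" for n
    using Q(2)[of n] by (rule order_trans[OF less_imp_le]) (auto simp: field_simps)
  have up: "Q n \<le> m + 1" for n
  proof -
    have "Q n \<le> G (Q n)" unfolding G_def using cval_ge_arg[OF Q(1)[of n]] eps by (simp add: add_increasing)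
    with Gb[of n] show ?thesis by linarith
  qed
  \<comment> \<open>Apart from the summand 1 this is the bound on \<open>(p - Q n)\<^sup>2\<close>
    forced by \<open>G (Q n) \<le> m + 1\<close>; the summand makes the contradiction strict and
    gives \<open>1 \<le> L\<close>, hence \<open>L \<le> L\<^sup>2\<close>.\<close>
  define L where "L = 2 * \<epsilon> * \<bar>m + 1 - \<epsilon> - p\<bar> + 1"
  have lo: "p - L \<le> Q n" for n
  proof (rule ccontr)
    assume c: "\<not> p - L \<le> Q n"
    have L1: "1 \<le> L" using eps by (simp add: L_def)
    with c have "L < p - Q n" by simp
    with L1 have "L * 1 \<le> (p - Q n) * (p - Q n)" by (intro mult_mono) auto
    moreover have "\<epsilon> + p + (p - Q n)\<^sup>2 / (2 * \<epsilon>) \<le> m + 1"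
      using lower[OF Q(1)[of n]] Gb[of n] c L1 by auto
    then have "(p - Q n)\<^sup>2 / (2 * \<epsilon>) \<le> \<bar>m + 1 - \<epsilon> - p\<bar>" by linarith
    then have "(p - Q n)\<^sup>2 \<le> 2 * \<epsilon> * \<bar>m + 1 - \<epsilon> - p\<bar>"
      using eps by (simp add: divide_le_eq mult_ac)
    ultimately show False by (simp add: L_def power2_eq_square)
  qed
  have "\<forall>n. Q n \<in> {p - L .. m + 1}" using up lo by auto
  then obtain l r where l: "strict_mono r" "(Q \<circ> r) \<longlonglongrightarrow> l"
    using compact_Icc[of "p - L" "m + 1"] unfolding compact_def by metis
  have cl: "cval (Q (r n)) \<le> m + 1 / Suc (r n) - \<epsilon> * exp ((p - Q (r n)) / \<epsilon>)" for n
    using Q(2)[of "r n"] by (simp add: G_def)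
  have "(\<lambda>n. 1 / real (Suc n)) \<longlonglongrightarrow> 0" by (rule LIMSEQ_Suc[OF lim_inverse_n'])
  from LIMSEQ_subseq_LIMSEQ[OF this l(1)]
  have "(\<lambda>n. m + 1 / Suc (r n) - \<epsilon> * exp ((p - Q (r n)) / \<epsilon>)) \<longlonglongrightarrow> m + 0 - \<epsilon> * exp ((p - l) / \<epsilon>)"
    using l(2) eps by (intro tendsto_intros) (auto simp: o_def)
  from cval_lsc[OF l(2) this] Q(1) cl have "l \<in> cdom" "G l \<le> m" by (auto simp: G_def)
  moreover have "m \<le> G y" if "y \<in> cdom" for y
    unfolding m_def using that bdd by (intro cINF_lower)
  ultimately show ?thesis unfolding G_def by (meson order_trans)
qed

text \<open>Fermat's rule for a smooth convex function plus the conjugate: only the exponential is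
  differentiated, and convexity takes care of the conjugate.\<close>

lemma minimizer_iff_subd:
  assumes eps: "0 < \<epsilon>" and q: "q \<in> cdom"
  shows "(\<forall>y\<in>cdom. \<epsilon> * exp ((p - q) / \<epsilon>) + cval q \<le> \<epsilon> * exp ((p - y) / \<epsilon>) + cval y)
    \<longleftrightarrow> exp ((p - q) / \<epsilon>) \<in> subd q" (is "?min \<longleftrightarrow> ?s \<in> subd q")
proof
  assume m: ?min
  have "cval q + ?s * (y - q) \<le> cval y" if y: "y \<in> cdom" for y
  proof -
    \<comment> \<open>The smooth part along the segment from \<open>q\<close> to \<open>y\<close>.
      Convexity bounds the other part linearly in \<open>h\<close>, so dividing by \<open>h\<close>
      and letting it decrease to 0 gives the subgradient inequality.\<close>
    let ?E = "\<lambda>h. \<epsilon> * exp ((p - (q + h * (y - q))) / \<epsilon>)"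
    have "((\<lambda>h. (p - (q + h * (y - q))) / \<epsilon>) has_real_derivative (0 - (0 + (y - q))) / \<epsilon>) (at 0)"
      by (intro DERIV_cdivide DERIV_diff DERIV_add DERIV_const DERIV_cmult_right[OF DERIV_ident, simplified])
    from DERIV_cmult[OF DERIV_fun_exp[OF this], of \<epsilon>]
    have D: "(?E has_real_derivative - (?s * (y - q))) (at 0)"
      using eps by (simp add: minus_divide_left[symmetric] del: minus_diff_eq)
    then have "((\<lambda>h. (?E h - ?E 0) / (h - 0)) \<longlongrightarrow> - (?s * (y - q))) (at 0)"
      unfolding has_field_derivative_iff by simp
    then have lim: "((\<lambda>h. (?E h - ?E 0) / h) \<longlongrightarrow> - (?s * (y - q))) (at_right 0)"
      by (auto intro: filterlim_mono[OF _ order_refl at_within_le_at] simp: at_within_le_at)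
    have "eventually (\<lambda>h. - (cval y - cval q) \<le> (?E h - ?E 0) / h) (at_right 0)"
      unfolding eventually_at_right_field
    proof (intro exI[of _ 1] conjI allI impI)
      fix h :: real assume h: "0 < h" "h < 1"
      have eq: "q + h * (y - q) = (1 - h) * q + h * y" by (simp add: algebra_simps)
      have c: "q + h * (y - q) \<in> cdom" "cval (q + h * (y - q)) \<le> (1 - h) * cval q + h * cval y"
        unfolding eq using cval_convex[OF q y, of h] h by auto
      have "?E 0 + cval q \<le> ?E h + cval (q + h * (y - q))"
        using m c(1) by simp
      with c(2) have "- (h * (cval y - cval q)) \<le> ?E h - ?E 0" by (simp add: algebra_simps)
      then show "- (cval y - cval q) \<le> (?E h - ?E 0) / h"
        using h by (simp add: pos_le_divide_eq mult.commute right_diff_distrib)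
    qed simp
    from tendsto_lowerbound[OF lim this] show ?thesis by simp
  qed
  with q show "?s \<in> subd q" by (simp add: subd_iff)
next
  assume s: "?s \<in> subd q"
  show ?min
  proof
    fix y assume "y \<in> cdom"
    from subd_ineq[OF s this] have 1: "cval q + ?s * (y - q) \<le> cval y" .
    \<comment> \<open>The exponential lies above its tangent at
      \<open>(p - q) / \<epsilon>\<close>.\<close>
    have "?s * (1 + (q - y) / \<epsilon>) \<le> ?s * exp ((q - y) / \<epsilon>)"
      by (intro mult_left_mono exp_ge_add_one_self) auto
    also have "\<dots> = exp ((p - y) / \<epsilon>)" by (simp add: exp_add[symmetric] add_divide_distrib[symmetric])
    finally have "\<epsilon> * (?s * (1 + (q - y) / \<epsilon>)) \<le> \<epsilon> * exp ((p - y) / \<epsilon>)"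
      using eps by (intro mult_left_mono) auto
    moreover have "\<epsilon> * (?s * (1 + (q - y) / \<epsilon>)) = \<epsilon> * ?s + ?s * (q - y)"
      using eps by (simp add: distrib_left)
    ultimately have "\<epsilon> * ?s + ?s * (q - y) \<le> \<epsilon> * exp ((p - y) / \<epsilon>)" by simp
    with 1 show "\<epsilon> * exp ((p - q) / \<epsilon>) + cval q \<le> \<epsilon> * exp ((p - y) / \<epsilon>) + cval y" by (simp add: algebra_simps)
  qed
qed

text \<open>\<open>aprox\<close> selects a minimizer by choice, so the equivalence rests on
  uniqueness: the exponential is strictly decreasing in \<open>q\<close>, whereas subgradients do
  not decrease.\<close>

lemma aprox_eq_iff:
  assumes eps: "0 < \<epsilon>"
  shows "aprox \<epsilon> conjugate p = q \<longleftrightarrow> exp ((p - q) / \<epsilon>) \<in> subd q"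
proof -
  let ?G = "\<lambda>q. ereal (\<epsilon> * exp ((p - q) / \<epsilon>)) + conjugate q"
  have min_iff: "is_arg_min ?G (\<lambda>_. True) q \<longleftrightarrow> exp ((p - q) / \<epsilon>) \<in> subd q" for q
  proof (cases "q \<in> cdom")
    case True
    have "(\<not> (\<exists>y. ?G y < ?G q)) \<longleftrightarrow>
      (\<forall>y\<in>cdom. \<epsilon> * exp ((p - q) / \<epsilon>) + cval q \<le> \<epsilon> * exp ((p - y) / \<epsilon>) + cval y)"
    proof (intro iffI ballI notI)
      fix y assume n: "\<not> (\<exists>y. ?G y < ?G q)" "y \<in> cdom"
      then have "\<not> ?G y < ?G q" by blast
      then show "\<epsilon> * exp ((p - q) / \<epsilon>) + cval q \<le> \<epsilon> * exp ((p - y) / \<epsilon>) + cval y"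
        using n(2) True by (simp add: conjugate_eq_cval)
    next
      assume m: "\<forall>y\<in>cdom. \<epsilon> * exp ((p - q) / \<epsilon>) + cval q \<le> \<epsilon> * exp ((p - y) / \<epsilon>) + cval y"
        and "\<exists>y. ?G y < ?G q"
      then obtain y where y: "?G y < ?G q" by blast
      then have "conjugate y \<noteq> \<infinity>" by auto
      then have "y \<in> cdom" by (simp add: effective_domain_def)
      with m y True show False by (fastforce simp: conjugate_eq_cval)
    qed
    then show ?thesis
      using minimizer_iff_subd[OF eps True] by (simp add: is_arg_min_def)
  next
    case False
    then have "conjugate q = \<infinity>" by (simp add: effective_domain_def)
    then have "?G 0 < ?G q" by (simp add: conjugate_eq_cval[OF zero_in_cdom])
    then have "\<not> is_arg_min ?G (\<lambda>_. True) q" unfolding is_arg_min_def by blast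
    with False show ?thesis by (auto dest: subd_cdom)
  qed
  have unique: "q1 = q2"
    if "exp ((p - q1) / \<epsilon>) \<in> subd q1" "exp ((p - q2) / \<epsilon>) \<in> subd q2" for q1 q2
  proof (rule ccontr)
    have *: False if "exp ((p - a) / \<epsilon>) \<in> subd a" "exp ((p - b) / \<epsilon>) \<in> subd b" "a < b" for a b
      using subd_mono[OF that] that(3) eps by (simp add: divide_right_mono field_simps)
    assume "q1 \<noteq> q2"
    then show False using *[OF that] *[OF that(2,1)] by linarith
  qed
  obtain q0 where q0: "exp ((p - q0) / \<epsilon>) \<in> subd q0"
    using aprox_minimizer_exists[OF eps, of p] minimizer_iff_subd[OF eps] by metis
  have "exp ((p - aprox \<epsilon> conjugate p) / \<epsilon>) \<in> subd (aprox \<epsilon> conjugate p)"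
    unfolding aprox_def arg_min_def min_iff by (rule someI[of "\<lambda>q. exp ((p - q) / \<epsilon>) \<in> subd q", OF q0])
  with unique show ?thesis by blast
qed

section \<open>Equality in the Fenchel inequality at subgradients\<close>

lemma closed_epigraph: "closed {(p, v). 0 \<le> p \<and> 0 \<le> v \<and> \<phi> p \<le> ennreal v}"
  unfolding closed_sequential_limits
proof (intro allI impI, elim conjE)
  fix x :: "nat \<Rightarrow> real \<times> real" and l
  assume x: "\<forall>n. x n \<in> {(p, v). 0 \<le> p \<and> 0 \<le> v \<and> \<phi> p \<le> ennreal v}" and lim: "x \<longlonglongrightarrow> l"
  obtain p v where l: "l = (p, v)" by (cases l)
  have P: "0 \<le> fst (x n)" and V: "0 \<le> snd (x n)" and le: "\<phi> (fst (x n)) \<le> ennreal (snd (x n))" for n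
    using x by (auto simp: split_beta)
  have limp: "(\<lambda>n. fst (x n)) \<longlonglongrightarrow> p" and limv: "(\<lambda>n. snd (x n)) \<longlonglongrightarrow> v"
    using tendsto_fst[OF lim] tendsto_snd[OF lim] by (auto simp: l)
  have p0: "0 \<le> p" using LIMSEQ_le_const[OF limp] P by blast
  have v0: "0 \<le> v" using LIMSEQ_le_const[OF limv] V by blast
  have "\<phi> p \<le> ennreal v"
  proof (rule ccontr)
    assume "\<not> \<phi> p \<le> ennreal v"
    then obtain c where c: "ennreal v < c" "c < \<phi> p" using dense by (metis not_le)
    have "c < Liminf (at p within {0..}) \<phi>"
      using c(2) entropy p0 by (auto simp: entropy_function_def intro: less_le_trans)
    then have "eventually (\<lambda>y. c < \<phi> y) (at p within {0..})"
      by (rule less_LiminfD)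
    \<comment> \<open>\<open>Liminf\<close> ignores the point \<open>p\<close> itself, which the
      approximating sequence may hit; \<open>c < \<phi> p\<close> fills the puncture.\<close>
    then have "eventually (\<lambda>y. y \<in> {0..} \<longrightarrow> c < \<phi> y) (nhds p)"
      unfolding eventually_at_filter by eventually_elim (use c(2) in auto)
    then have "eventually (\<lambda>n. fst (x n) \<in> {0..} \<longrightarrow> c < \<phi> (fst (x n))) sequentially"
      using limp unfolding filterlim_iff by blast
    moreover have "eventually (\<lambda>n. ennreal (snd (x n)) < c) sequentially"
      using limv c(1) by (intro order_tendstoD(2)[OF tendsto_ennrealI])
    ultimately have "eventually (\<lambda>n. False) sequentially"
    proof eventually_elim
      case (elim n)
      with P[of n] le[of n] show False by auto
    qed
    then show False by simp
  qed
  with p0 v0 show "l \<in> {(p, v). 0 \<le> p \<and> 0 \<le> v \<and> \<phi> p \<le> ennreal v}" by (simp add: l)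
qed

lemma convex_epigraph: "convex {(p, v). 0 \<le> p \<and> 0 \<le> v \<and> \<phi> p \<le> ennreal v}"
proof (rule convexI)
  fix x y :: "real \<times> real" and a b :: real
  assume x: "x \<in> {(p, v). 0 \<le> p \<and> 0 \<le> v \<and> \<phi> p \<le> ennreal v}"
    and y: "y \<in> {(p, v). 0 \<le> p \<and> 0 \<le> v \<and> \<phi> p \<le> ennreal v}"
    and ab: "0 \<le> a" "0 \<le> b" "a + b = 1"
  obtain p v q w where xy: "x = (p, v)" "y = (q, w)" by (cases x, cases y)
  have *: "0 \<le> p" "0 \<le> v" "\<phi> p \<le> ennreal v" "0 \<le> q" "0 \<le> w" "\<phi> q \<le> ennreal w"
    using x y xy by auto
  have a: "a = 1 - b" using ab by simp
  have "\<phi> (a * p + b * q) \<le> ennreal a * \<phi> p + ennreal b * \<phi> q"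
    using entropy * ab unfolding entropy_function_def a by auto
  also have "\<dots> \<le> ennreal a * ennreal v + ennreal b * ennreal w"
    using * by (intro add_mono mult_left_mono) auto
  also have "\<dots> = ennreal (a * v + b * w)"
    using * ab by (simp add: ennreal_mult'' ennreal_plus)
  finally show "a *\<^sub>R x + b *\<^sub>R y \<in> {(p, v). 0 \<le> p \<and> 0 \<le> v \<and> \<phi> p \<le> ennreal v}"
    using * ab by (simp add: xy)
qed

text \<open>
  This is the part of \<open>\<phi>\<^sup>*\<^sup>* = \<phi>\<close> that is needed: a point below the graph of \<open>\<phi>\<close> is separated from the epigraph by a line, and the case of a
  vertical line is excluded by the subgradient inequality along a ray.
\<close>

lemma fenchel_equality:
  assumes s: "s \<in> subd q" and s0: "0 \<le> s"
  shows "0 \<le> s * q - cval q" and "\<phi> s = ennreal (s * q - cval q)"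
proof -
  define c where "c = s * q - cval q"
  show c0: "0 \<le> s * q - cval q" using cval_bounds(2)[OF s] by simp
  have sub: "s * y - c \<le> cval y" if "y \<in> cdom" for y
    using subd_ineq[OF s that] by (simp add: c_def algebra_simps)
  have "\<phi> s \<le> ennreal c"
  proof (rule ccontr)
    assume "\<not> \<phi> s \<le> ennreal c"
    then have "(s, c) \<notin> {(p, v). 0 \<le> p \<and> 0 \<le> v \<and> \<phi> p \<le> ennreal v}" by simp
    from separating_hyperplane_closed_point[OF convex_epigraph closed_epigraph this]
    obtain ab d where ab: "inner ab (s, c) < d"
      "\<forall>x\<in>{(p, v). 0 \<le> p \<and> 0 \<le> v \<and> \<phi> p \<le> ennreal v}. d < inner ab x" by blast
    obtain a b where abeq: "ab = (a, b)" by (cases ab)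
    have sc: "a * s + b * c < d" using ab(1) by (simp add: abeq inner_prod_def)
    have epi: "d < a * p + b * v" if "0 \<le> p" "0 \<le> v" "\<phi> p \<le> ennreal v" for p v
      using ab(2) that by (auto simp: abeq inner_prod_def)
    have epi': "d < a * p + b * enn2real (\<phi> p)" if "0 \<le> p" "\<phi> p \<noteq> \<infinity>" for p
      using that by (intro epi) (auto simp: less_top)
    have b0: "0 \<le> b"
    proof (rule ccontr)
      assume "\<not> 0 \<le> b"
      \<comment> \<open>The vertical ray above \<open>(1, 0)\<close> lies in the epigraph; for
        \<open>b < 0\<close> this height brings the linear form down to at most
        \<open>d\<close>.\<close>
      moreover have "d < a * 1 + b * (\<bar>d - a\<bar> / \<bar>b\<bar>)"
        by (rule epi) (auto simp: entropy_at_1)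
      ultimately show False by (auto simp: abs_if split: if_splits)
    qed
    show False
    proof (cases "b = 0")
      case False
      with b0 have b: "0 < b" by simp
      \<comment> \<open>A line that is not vertical is an affine minorant of \<phi> with slope
        \<open>- a / b\<close>, hence bounds the conjugate there; the subgradient inequality at this
        slope then contradicts \<open>sc\<close>.\<close>
      have "p * (- a / b) - enn2real (\<phi> p) \<le> - d / b" if "0 \<le> p" "\<phi> p \<noteq> \<infinity>" for p
      proof -
        have "(d - a * p) / b \<le> enn2real (\<phi> p)"
          using epi'[OF that] b by (simp add: divide_le_eq mult_ac)
        then show ?thesis by (simp add: diff_divide_distrib mult_ac)
      qed
      from conjugate_leI[OF this] sub[of "- a / b"] have "s * (- a / b) - c \<le> - d / b" by auto
      from mult_left_mono[OF this, of b] b have "- (a * s) - b * c \<le> - d"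
        by (simp add: right_diff_distrib mult_ac)
      with sc show False by simp
    next
      case True
      \<comment> \<open>A vertical line keeps the domain of \<phi> inside \<open>d < a * p\<close>,
        so the conjugate is at most \<open>- k * d\<close> at \<open>- k * a\<close>. The supporting
        line of slope \<open>s\<close> exceeds this by an amount that grows linearly in
        \<open>k\<close>, because \<open>s * a < d\<close>.\<close>
      have ray: "k * (d - s * a) \<le> c" if k: "0 \<le> k" for k
      proof -
        have "p * (- k * a) - enn2real (\<phi> p) \<le> - k * d" if "0 \<le> p" "\<phi> p \<noteq> \<infinity>" for p
        proof -
          have "k * d \<le> k * (a * p)" using epi'[OF that] True k by (intro mult_left_mono) auto
          moreover have "p * (- k * a) = - (k * (a * p))" by simp
          moreover have "0 \<le> enn2real (\<phi> p)" by simp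
          ultimately show ?thesis by linarith
        qed
        from conjugate_leI[OF this] sub[of "- k * a"] have "s * (- k * a) - c \<le> - k * d" by auto
        then show ?thesis by (simp add: algebra_simps)
      qed
      have pos: "0 < d - s * a" using sc True by (simp add: mult_ac)
      have "(c + 1) / (d - s * a) * (d - s * a) \<le> c"
        using c0 pos by (intro ray divide_nonneg_pos) (auto simp: c_def)
      with pos show False by simp
    qed
  qed
  moreover have "ennreal c \<le> \<phi> s"
  proof (cases "\<phi> s = \<infinity>")
    case False
    from fenchel_young[OF s0 this subd_cdom[OF s]] have "c \<le> enn2real (\<phi> s)" by (simp add: c_def)
    with False show ?thesis using ennreal_leI[of c "enn2real (\<phi> s)"] by (simp add: less_top)
  qed simp
  ultimately show "\<phi> s = ennreal (s * q - cval q)" by (simp add: c_def)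
qed

lemma fenchel_young_ennreal:
  assumes "0 \<le> p" "q \<in> cdom"
  shows "ennreal (p * q - cval q) \<le> \<phi> p"
proof (cases "\<phi> p = \<infinity>")
  case False
  from fenchel_young[OF assms(1) this assms(2)] have "p * q - cval q \<le> enn2real (\<phi> p)" by simp
  from ennreal_leI[OF this] False show ?thesis by (cases "\<phi> p") auto
qed simp

end

section \<open>Compact metric spaces and finite measures\<close>

text \<open>Separability comes from total boundedness at the scales \<open>1 / Suc n\<close>. It
  serves both the Borel sets of the product and the extraction of uniform limits.\<close>

lemma compact_metric_countable_dense:
  assumes "compact (UNIV :: 'a::metric_space set)"
  obtains D :: "'a::metric_space set" where "countable D" "\<And>x e. 0 < e \<Longrightarrow> \<exists>d\<in>D. dist d x < e"
proof -
  have "\<forall>n. \<exists>k :: 'a set. finite k \<and> UNIV \<subseteq> (\<Union>x\<in>k. ball x (1 / real (Suc n)))"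
    using assms unfolding compact_eq_totally_bounded by auto
  then obtain k :: "nat \<Rightarrow> 'a set" where k: "\<And>n. finite (k n)"
    "\<And>n. UNIV \<subseteq> (\<Union>x\<in>k n. ball x (1 / real (Suc n)))" by metis
  show thesis
  proof
    show "countable (\<Union>n. k n)" using k(1) by (auto intro: countable_finite)
    fix x :: 'a and e :: real assume "0 < e"
    then obtain n where n: "1 / real (Suc n) < e" using nat_approx_posE by blast
    have "x \<in> (\<Union>x\<in>k n. ball x (1 / real (Suc n)))" using k(2)[of n] by blast
    then obtain d where "d \<in> k n" "dist d x < 1 / real (Suc n)" by (auto simp: mem_ball)
    with n show "\<exists>d\<in>\<Union>n. k n. dist d x < e" by (intro bexI[of _ d]) auto
  qed
qed

text \<open>Plans are Borel measures on the product, while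
  \<open>\<alpha> \<Otimes>\<^sub>M \<beta>\<close> carries the product sigma-algebra. These agree
  because every open set is a countable union of boxes with centres in a countable dense set and
  radii \<open>1 / Suc n\<close>.\<close>

lemma borel_prod_compact_metric:
  assumes "compact (UNIV :: 'a::metric_space set)"
  shows "sets (borel \<Otimes>\<^sub>M borel) = sets (borel :: ('a \<times> 'a) measure)"
proof
  show "sets (borel \<Otimes>\<^sub>M borel) \<subseteq> sets (borel :: ('a \<times> 'a) measure)"
    by (intro sets_pair_in_sets borel_Times)
  obtain D :: "'a set" where D: "countable D" "\<And>x e. 0 < e \<Longrightarrow> \<exists>d\<in>D. dist d x < e"
    using compact_metric_countable_dense[OF assms] by blast
  define I where "I = D \<times> D \<times> (UNIV :: nat set)"
  define box where "box = (\<lambda>(d, d', n :: nat). ball (d :: 'a) (1 / real (Suc n)) \<times> ball (d' :: 'a) (1 / real (Suc n)))"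
  have I: "countable I" unfolding I_def using D(1) by (intro countable_SIGMA) auto
  have "W \<in> sets (borel \<Otimes>\<^sub>M borel)" if W: "open W" for W :: "('a \<times> 'a) set"
  proof -
    have "W = (\<Union>i\<in>{i \<in> I. box i \<subseteq> W}. box i)"
    proof (intro equalityI subsetI)
      fix z assume z: "z \<in> W"
      obtain x y where xy: "z = (x, y)" by (cases z)
      obtain A B where AB0: "open A" "open B" "z \<in> A \<times> B" "A \<times> B \<subseteq> W"
        by (rule open_prod_elim[OF W z])
      then have AB: "open A" "open B" "x \<in> A" "y \<in> B" "A \<times> B \<subseteq> W"
        by (simp_all add: xy)
      obtain e1 where e1: "0 < e1" "ball x e1 \<subseteq> A" using AB by (meson open_contains_ball)
      obtain e2 where e2: "0 < e2" "ball y e2 \<subseteq> B" using AB by (meson open_contains_ball)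
      \<comment> \<open>The half is due to centring the box at nearby points of \<open>D\<close>:
        its points are within two radii of \<open>x\<close> and \<open>y\<close>.\<close>
      obtain n where n: "1 / real (Suc n) < min e1 e2 / 2"
        using nat_approx_posE[of "min e1 e2 / 2"] e1 e2 by auto
      have p: "0 < 1 / real (Suc n)" by simp
      obtain d where d: "d \<in> D" "dist d x < 1 / real (Suc n)" using D(2)[OF p] by blast
      obtain d' where d': "d' \<in> D" "dist d' y < 1 / real (Suc n)" using D(2)[OF p] by blast
      have "ball d (1 / real (Suc n)) \<subseteq> ball x e1"
      proof
        fix w assume "w \<in> ball d (1 / real (Suc n))"
        then have "dist x w < 1 / real (Suc n) + 1 / real (Suc n)"
          using dist_triangle[of x w d] d(2) by (simp add: dist_commute)
        with n show "w \<in> ball x e1" by simp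
      qed
      moreover have "ball d' (1 / real (Suc n)) \<subseteq> ball y e2"
      proof
        fix w assume "w \<in> ball d' (1 / real (Suc n))"
        then have "dist y w < 1 / real (Suc n) + 1 / real (Suc n)"
          using dist_triangle[of y w d'] d'(2) by (simp add: dist_commute)
        with n show "w \<in> ball y e2" by simp
      qed
      ultimately have "box (d, d', n) \<subseteq> W" using e1 e2 AB(5) unfolding box_def by fast
      moreover have "z \<in> box (d, d', n)" using d d' by (simp add: box_def xy)
      ultimately show "z \<in> (\<Union>i\<in>{i \<in> I. box i \<subseteq> W}. box i)" using d d' by (auto simp: I_def)
    qed auto
    moreover have "(\<Union>i\<in>{i \<in> I. box i \<subseteq> W}. box i) \<in> sets (borel \<Otimes>\<^sub>M borel)"
    proof -
      have "countable {i \<in> I. box i \<subseteq> W}" using I by simp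
      moreover have "box i \<in> sets (borel \<Otimes>\<^sub>M borel)" for i by (auto simp: box_def split: prod.split)
      ultimately show ?thesis by (intro sets.countable_UN'') auto
    qed
    ultimately show ?thesis by simp
  qed
  then have "sigma_sets UNIV {W :: ('a \<times> 'a) set. open W} \<subseteq> sets (borel \<Otimes>\<^sub>M (borel :: 'a measure))"
    by (intro sets.sigma_sets_subset') (auto simp: space_pair_measure)
  then show "sets (borel :: ('a \<times> 'a) measure) \<subseteq> sets (borel \<Otimes>\<^sub>M borel)"
    by (simp add: sets_borel)
qed

text \<open>An Arzela-Ascoli theorem. Compactness of a countable product of intervals replaces the
  diagonal argument: the values on a dense sequence form one point of the product.\<close>

lemma lipschitz_convergent_subsequence:
  fixes f :: "nat \<Rightarrow> 'a::metric_space \<Rightarrow> real"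
  assumes comp: "compact (UNIV :: 'a set)"
    and bd: "\<And>n x. \<bar>f n x\<bar> \<le> B"
    and lip: "\<And>n x y. \<bar>f n x - f n y\<bar> \<le> L * dist x y"
  obtains l r where "strict_mono (r :: nat \<Rightarrow> nat)" "uniform_limit UNIV (\<lambda>n. f (r n)) l sequentially"
proof -
  obtain D :: "'a set" where D: "countable D" "\<And>x e. 0 < e \<Longrightarrow> \<exists>d\<in>D. dist d x < e"
    using compact_metric_countable_dense[OF comp] by blast
  have Dne: "D \<noteq> {}" using D(2)[of 1] by auto
  define h where "h n i = f n (from_nat_into D i)" for n i :: nat
  have "compact (PiE UNIV (\<lambda>_ :: nat. {- B .. B}))"
    using compactin_PiE[of "\<lambda>_. euclidean" UNIV "\<lambda>_ :: nat. {- B .. B}"]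
    by (simp add: euclidean_product_topology)
  moreover have "\<forall>n. h n \<in> PiE UNIV (\<lambda>_. {- B .. B})" using bd by (auto simp: h_def abs_le_iff minus_le_iff)
  ultimately obtain hl r where r: "strict_mono r" and hl: "(h \<circ> r) \<longlonglongrightarrow> hl"
    unfolding compact_def by metis
  have conv: "\<exists>l. (\<lambda>n. f (r n) d) \<longlonglongrightarrow> l" if d: "d \<in> D" for d
  proof -
    obtain i where i: "d = from_nat_into D i" using from_nat_into_surj[OF D(1) d] by auto
    have "continuous_on UNIV (\<lambda>x :: nat \<Rightarrow> real. x i)" by simp
    from this[unfolded continuous_on_eq_continuous_at[OF open_UNIV]]
    have "isCont (\<lambda>x :: nat \<Rightarrow> real. x i) hl" by blast
    from isCont_tendsto_compose[OF this hl] show ?thesis by (auto simp: h_def i o_def)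
  qed
  have "uniformly_Cauchy_on UNIV (\<lambda>n. f (r n))"
    unfolding uniformly_Cauchy_on_def
  proof (intro allI impI)
    fix e :: real assume e: "0 < e"
    \<comment> \<open>Moving to a centre and back costs at most \<open>e / 4\<close> each, and the
      difference at the centre is below \<open>e / 4\<close>. The denominator is positive whatever
      the sign of \<open>L\<close>.\<close>
    define \<delta> where "\<delta> = e / (4 * (\<bar>L\<bar> + 1))"
    have \<delta>: "0 < \<delta>" using e by (simp add: \<delta>_def)
    have "UNIV \<subseteq> (\<Union>d\<in>D. ball d \<delta>)" using D(2)[OF \<delta>] by fastforce
    from compactE_image[OF comp _ this] obtain k where k: "k \<subseteq> D" "finite k" "UNIV \<subseteq> (\<Union>d\<in>k. ball d \<delta>)"
      by auto
    have "\<forall>d\<in>k. \<exists>M. \<forall>m\<ge>M. \<forall>n\<ge>M. dist (f (r m) d) (f (r n) d) < e / 4"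
    proof
      fix d assume "d \<in> k"
      then have "Cauchy (\<lambda>n. f (r n) d)" using conv k(1) LIMSEQ_imp_Cauchy by blast
      then show "\<exists>M. \<forall>m\<ge>M. \<forall>n\<ge>M. dist (f (r m) d) (f (r n) d) < e / 4"
        using metric_CauchyD[of _ "e / 4"] e by auto
    qed
    then obtain M where M: "\<And>d m n. d \<in> k \<Longrightarrow> M d \<le> m \<Longrightarrow> M d \<le> n \<Longrightarrow> dist (f (r m) d) (f (r n) d) < e / 4"
      by metis
    show "\<exists>M. \<forall>x\<in>UNIV. \<forall>m\<ge>M. \<forall>n\<ge>M. dist (f (r m) x) (f (r n) x) < e"
    proof (intro exI ballI allI impI)
      fix x m n assume mn: "Max (insert 0 (M ` k)) \<le> m" "Max (insert 0 (M ` k)) \<le> n"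
      have "x \<in> (\<Union>d\<in>k. ball d \<delta>)" using k(3) by blast
      then obtain d where d: "d \<in> k" "dist d x < \<delta>" by (auto simp: mem_ball)
      have "M d \<le> m" "M d \<le> n" using mn d(1) k(2) by auto
      from M[OF d(1) this] have 1: "\<bar>f (r m) d - f (r n) d\<bar> < e / 4" by (simp add: dist_real_def)
      have "\<bar>f j d - f j x\<bar> \<le> e / 4" for j
      proof -
        have "\<bar>f j d - f j x\<bar> \<le> \<bar>L\<bar> * \<delta>"
        proof -
          have "L * dist d x \<le> \<bar>L\<bar> * \<delta>" using d(2) by (intro mult_mono) auto
          with lip[of j d x] show ?thesis by linarith
        qed
        also have "\<dots> \<le> e / 4" using e by (simp add: \<delta>_def field_simps)
        finally show ?thesis .
      qed
      from this[of "r m"] this[of "r n"] 1 e show "dist (f (r m) x) (f (r n) x) < e"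
        unfolding dist_real_def by linarith
    qed
  qed
  then have "uniformly_convergent_on UNIV (\<lambda>n. f (r n))" by (rule Cauchy_uniformly_convergent)
  then obtain l where "uniform_limit UNIV (\<lambda>n. f (r n)) l sequentially"
    unfolding uniformly_convergent_on_def by blast
  with r show thesis by (rule that)
qed

section \<open>Finite Borel measures and weak convergence\<close>

lemma pos_measuresD:
  assumes "\<mu> \<in> pos_measures"
  shows "finite_measure \<mu>" "sets \<mu> = sets borel" "space \<mu> = UNIV"
proof -
  show f: "finite_measure \<mu>" "sets \<mu> = sets borel" using assms by (auto simp: pos_measures_def)
  show "space \<mu> = UNIV" using sets_eq_imp_space_eq[OF f(2)] by simp
qed

lemma nonzero_pos_measures_pos:
  "\<mu> \<in> nonzero_pos_measures \<longleftrightarrow> \<mu> \<in> pos_measures \<and> 0 < measure \<mu> UNIV"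
proof (cases "\<mu> \<in> pos_measures")
  case True
  note m = pos_measuresD[OF True]
  interpret finite_measure \<mu> by (rule m(1))
  have "\<mu> = null_measure borel \<longleftrightarrow> measure \<mu> UNIV = 0"
  proof
    assume 0: "measure \<mu> UNIV = 0"
    show "\<mu> = null_measure borel"
    proof (rule measure_eqI)
      fix A assume "A \<in> sets \<mu>"
      then have "measure \<mu> A \<le> measure \<mu> UNIV" using m by (intro finite_measure_mono) auto
      with 0 have "measure \<mu> A = 0" using measure_nonneg[of \<mu> A] by linarith
      then show "emeasure \<mu> A = emeasure (null_measure borel) A" by (simp add: emeasure_eq_measure)
    qed (simp add: m)
  qed (simp add: measure_def)
  with True show ?thesis using measure_nonneg[of \<mu> UNIV] by (auto simp: nonzero_pos_measures_def less_le)
qed (simp add: nonzero_pos_measures_def)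

lemma integrable_continuous:
  fixes f :: "'a::topological_space \<Rightarrow> real"
  assumes comp: "compact (UNIV :: 'a set)" and \<mu>: "\<mu> \<in> pos_measures" and f: "continuous_on UNIV f"
  shows "integrable \<mu> f"
proof -
  note m = pos_measuresD[OF \<mu>]
  interpret finite_measure \<mu> by (rule m(1))
  have "bounded (f ` UNIV)" using compact_continuous_image[OF f comp] by (rule compact_imp_bounded)
  then obtain B where "\<And>x. norm (f x) \<le> B" by (auto simp: bounded_iff)
  moreover have "f \<in> borel_measurable \<mu>"
    using borel_measurable_continuous_onI[OF f] measurable_cong_sets[OF m(2) refl] by blast
  ultimately show ?thesis by (intro integrable_const_bound[of _ B]) auto
qed

lemma integral_strict_mono:
  assumes "\<mu> \<in> nonzero_pos_measures" "integrable \<mu> f" "integrable \<mu> g" "\<And>x. f x < g x"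
  shows "(LINT x|\<mu>. f x) < (LINT x|\<mu>. g x :: real)"
proof -
  have \<mu>: "\<mu> \<in> pos_measures" "0 < measure \<mu> UNIV" using assms(1) by (auto simp: nonzero_pos_measures_pos)
  interpret finite_measure \<mu> by (rule pos_measuresD(1)[OF \<mu>(1)])
  show ?thesis
    using assms \<mu>(2) by (intro integral_less_AE_space) (auto simp: pos_measuresD[OF \<mu>(1)] emeasure_eq_measure)
qed

lemma integral_ge_const:
  assumes \<mu>: "\<mu> \<in> pos_measures" and f: "integrable \<mu> f" and b: "\<And>x. (a :: real) \<le> f x"
  shows "a * measure \<mu> UNIV \<le> (LINT x|\<mu>. f x)"
proof -
  interpret finite_measure \<mu> by (rule pos_measuresD(1)[OF \<mu>])
  have "(LINT x|\<mu>. a) \<le> (LINT x|\<mu>. f x)" by (rule integral_mono) (simp_all add: f b)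
  then show ?thesis by (simp add: pos_measuresD[OF \<mu>] mult.commute)
qed

lemma integral_le_const:
  assumes \<mu>: "\<mu> \<in> pos_measures" and f: "integrable \<mu> f" and b: "\<And>x. f x \<le> (b :: real)"
  shows "(LINT x|\<mu>. f x) \<le> b * measure \<mu> UNIV"
proof -
  interpret finite_measure \<mu> by (rule pos_measuresD(1)[OF \<mu>])
  have "(LINT x|\<mu>. f x) \<le> (LINT x|\<mu>. b)" by (rule integral_mono) (simp_all add: f b)
  then show ?thesis by (simp add: pos_measuresD[OF \<mu>] mult.commute)
qed

lemma abs_integral_le_const:
  assumes \<mu>: "\<mu> \<in> pos_measures" and f: "integrable \<mu> f" and b: "\<And>x. \<bar>f x\<bar> \<le> (b :: real)"
  shows "\<bar>LINT x|\<mu>. f x\<bar> \<le> b * measure \<mu> UNIV"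
  using integral_le_const[OF \<mu> f, of b] integral_ge_const[OF \<mu> f, of "- b"] b
  by (simp add: abs_le_iff minus_le_iff)

definition weakly_converges :: "(nat \<Rightarrow> 'a::topological_space measure) \<Rightarrow> 'a measure \<Rightarrow> bool" where
  "weakly_converges \<mu> \<nu> \<longleftrightarrow>
     (\<forall>h :: 'a \<Rightarrow> real. continuous_on UNIV h \<longrightarrow> (\<lambda>n. LINT x|\<mu> n. h x) \<longlonglongrightarrow> (LINT x|\<nu>. h x))"

lemma weakly_converges_const: "weakly_converges (\<lambda>_. \<mu>) \<mu>"
  by (simp add: weakly_converges_def)

lemma weakly_converges_subseq:
  "weakly_converges \<mu> \<nu> \<Longrightarrow> strict_mono r \<Longrightarrow> weakly_converges (\<lambda>n. \<mu> (r n)) \<nu>"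
  unfolding weakly_converges_def using LIMSEQ_subseq_LIMSEQ[of _ _ r] by (fastforce simp: o_def)

text \<open>A uniformly convergent integrand is admissible because masses stay bounded: testing with
  the constant 1 shows that they converge. The integrands in view are Gibbs densities of varying
  potentials.\<close>

lemma weakly_converges_uniform:
  fixes h :: "nat \<Rightarrow> 'a::topological_space \<Rightarrow> real"
  assumes comp: "compact (UNIV :: 'a set)"
    and \<mu>: "\<And>n. \<mu> n \<in> pos_measures" and \<nu>: "\<nu> \<in> pos_measures" and w: "weakly_converges \<mu> \<nu>"
    and h: "\<And>n. continuous_on UNIV (h n)" and lim: "uniform_limit UNIV h l sequentially"
  shows "(\<lambda>n. LINT x|\<mu> n. h n x) \<longlonglongrightarrow> (LINT x|\<nu>. l x)"
proof -
  have l: "continuous_on UNIV l" by (rule uniform_limit_theorem[OF _ lim]) (use h in auto)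
  have int: "integrable (\<mu> n) (h m)" "integrable (\<mu> n) l" for n m
    using integrable_continuous[OF comp \<mu>] h l by auto
  have "(\<lambda>n. LINT x|\<mu> n. 1 :: real) \<longlonglongrightarrow> (LINT x|\<nu>. 1)"
    using w unfolding weakly_converges_def by (simp only: continuous_on_const)
  then have mass: "(\<lambda>n. measure (\<mu> n) UNIV) \<longlonglongrightarrow> measure \<nu> UNIV"
    by (simp add: pos_measuresD(3)[OF \<mu>] pos_measuresD(3)[OF \<nu>])
  have "(\<lambda>n. (LINT x|\<mu> n. h n x) - (LINT x|\<mu> n. l x)) \<longlonglongrightarrow> 0"
  proof (rule LIMSEQ_I)
    fix e :: real assume e: "0 < e"
    define M where "M = measure \<nu> UNIV + 1"
    have M: "0 < M" by (simp add: M_def add_nonneg_pos)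
    have "eventually (\<lambda>n. measure (\<mu> n) UNIV < M) sequentially"
      using mass by (rule order_tendstoD) (simp add: M_def)
    moreover have "eventually (\<lambda>n. \<forall>x\<in>UNIV. dist (h n x) (l x) < e / M) sequentially"
      using lim e M by (intro uniform_limitD) auto
    ultimately have "eventually (\<lambda>n. norm ((LINT x|\<mu> n. h n x) - (LINT x|\<mu> n. l x) - 0) < e) sequentially"
    proof eventually_elim
      case (elim n)
      have "\<bar>h n x - l x\<bar> \<le> e / M" for x
        using elim(2)[rule_format, of x] unfolding dist_real_def by simp
      from abs_integral_le_const[OF \<mu> Bochner_Integration.integrable_diff[OF int(1)[of n n] int(2)[of n]] this]
      have "\<bar>(LINT x|\<mu> n. h n x) - (LINT x|\<mu> n. l x)\<bar> \<le> e / M * measure (\<mu> n) UNIV"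
        using int by simp
      also have "\<dots> < e / M * M" using elim(1) e M by (intro mult_strict_left_mono) auto
      finally show ?case using M by simp
    qed
    then show "\<exists>no. \<forall>n\<ge>no. norm ((LINT x|\<mu> n. h n x) - (LINT x|\<mu> n. l x) - 0) < e"
      by (simp add: eventually_sequentially)
  qed
  moreover have "(\<lambda>n. LINT x|\<mu> n. l x) \<longlonglongrightarrow> (LINT x|\<nu>. l x)"
    using w l by (simp add: weakly_converges_def)
  ultimately show ?thesis using tendsto_add by fastforce
qed

lemma continuous_on_comp_fst: "continuous_on UNIV f \<Longrightarrow> continuous_on UNIV (\<lambda>z. f (fst z))"
  by (rule continuous_on_compose2[of UNIV f]) (auto intro: continuous_intros)

lemma continuous_on_comp_snd: "continuous_on UNIV f \<Longrightarrow> continuous_on UNIV (\<lambda>z. f (snd z))"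
  by (rule continuous_on_compose2[of UNIV f]) (auto intro: continuous_intros)

lemma compact_UNIV_prod:
  assumes "compact (UNIV :: 'a::topological_space set)"
  shows "compact (UNIV :: ('a \<times> 'a) set)"
  using compact_Times[OF assms assms] by simp

lemma pair_measure_in_pos_measures:
  fixes \<alpha> \<beta> :: "'a::metric_space measure"
  assumes comp: "compact (UNIV :: 'a set)" and \<alpha>: "\<alpha> \<in> pos_measures" and \<beta>: "\<beta> \<in> pos_measures"
  shows "\<alpha> \<Otimes>\<^sub>M \<beta> \<in> pos_measures"
proof -
  interpret a: finite_measure \<alpha> by (rule pos_measuresD(1)[OF \<alpha>])
  interpret b: finite_measure \<beta> by (rule pos_measuresD(1)[OF \<beta>])
  have "sets (\<alpha> \<Otimes>\<^sub>M \<beta>) = sets (borel \<Otimes>\<^sub>M borel)"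
    using pos_measuresD(2)[OF \<alpha>] pos_measuresD(2)[OF \<beta>] by (rule sets_pair_measure_cong)
  moreover have "finite_measure (\<alpha> \<Otimes>\<^sub>M \<beta>)" by (rule finite_measure_pair_measure) unfold_locales
  ultimately show ?thesis by (simp add: pos_measures_def borel_prod_compact_metric[OF comp])
qed

lemma
  fixes \<alpha> \<beta> :: "'a::metric_space measure" and h :: "'a \<Rightarrow> 'a \<Rightarrow> real"
  assumes comp: "compact (UNIV :: 'a set)" and \<alpha>: "\<alpha> \<in> pos_measures" and \<beta>: "\<beta> \<in> pos_measures"
    and h: "continuous_on UNIV (\<lambda>(x, y). h x y)"
  shows integrable_pair_continuous: "integrable (\<alpha> \<Otimes>\<^sub>M \<beta>) (\<lambda>z. h (fst z) (snd z))"
    and integrable_partial_integral: "integrable \<alpha> (\<lambda>x. LINT y|\<beta>. h x y)"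
    and integral_pair_continuous: "(LINT z|(\<alpha> \<Otimes>\<^sub>M \<beta>). h (fst z) (snd z)) = (LINT x|\<alpha>. LINT y|\<beta>. h x y)"
    and integral_swap: "(LINT x|\<alpha>. LINT y|\<beta>. h x y) = (LINT y|\<beta>. LINT x|\<alpha>. h x y)"
proof -
  interpret a: finite_measure \<alpha> by (rule pos_measuresD(1)[OF \<alpha>])
  interpret b: finite_measure \<beta> by (rule pos_measuresD(1)[OF \<beta>])
  interpret P: pair_sigma_finite \<alpha> \<beta> ..
  show i: "integrable (\<alpha> \<Otimes>\<^sub>M \<beta>) (\<lambda>z. h (fst z) (snd z))"
    using integrable_continuous[OF compact_UNIV_prod[OF comp] pair_measure_in_pos_measures[OF comp \<alpha> \<beta>] h]
    by (simp add: case_prod_beta')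
  show "integrable \<alpha> (\<lambda>x. LINT y|\<beta>. h x y)" using P.integrable_fst'[OF i] by simp
  show "(LINT z|(\<alpha> \<Otimes>\<^sub>M \<beta>). h (fst z) (snd z)) = (LINT x|\<alpha>. LINT y|\<beta>. h x y)"
    using P.integral_fst'[OF i] by simp
  show "(LINT x|\<alpha>. LINT y|\<beta>. h x y) = (LINT y|\<beta>. LINT x|\<alpha>. h x y)"
    using P.Fubini_integral[of h] i by (simp add: case_prod_beta')
qed

section \<open>Potentials\<close>

locale entropic_ot = entropy_fun \<phi> for \<phi> +
  fixes C :: "'a::metric_space \<Rightarrow> 'a \<Rightarrow> real" and \<gamma> \<epsilon> :: real
  assumes compact_X: "compact (UNIV :: 'a set)"
    and C_continuous: "continuous_on UNIV (\<lambda>(x, y). C x y)"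
    and C_symmetric: "\<And>x y. C x y = C y x"
    and C_Lipschitz: "\<And>z. \<gamma>-lipschitz_on UNIV (\<lambda>x. C x z)"
    and eps_pos: "0 < \<epsilon>"
    and A1: "strictly_convex_on_domain (legendre \<phi>)"
    and A2: "\<exists>x s :: nat \<Rightarrow> real.
       (\<forall>n. x n \<in> effective_domain (legendre \<phi>) \<and> s n \<in> subdifferential (legendre \<phi>) (x n)) \<and>
       (s \<longlonglongrightarrow> 0 \<or> filterlim s at_top sequentially)"
begin

section \<open>Best responses: optimality condition and regularity\<close>

definition gibbs :: "('a \<Rightarrow> real) \<Rightarrow> ('a \<Rightarrow> real) \<Rightarrow> 'a \<Rightarrow> 'a \<Rightarrow> real" where
  "gibbs f g x y = exp ((f x + g y - C x y) / \<epsilon>)"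

text \<open>
  The optimality condition for \<open>g\<close> at fixed \<open>f\<close>; it is equivalent to \<open>g = aprox_softmin \<epsilon> \<phi> C \<alpha> f\<close>,
  but, unlike the latter, visibly stable under limits.
\<close>

definition best_response :: "'a measure \<Rightarrow> ('a \<Rightarrow> real) \<Rightarrow> ('a \<Rightarrow> real) \<Rightarrow> bool" where
  "best_response \<alpha> f g \<longleftrightarrow> (\<forall>y. (LINT x|\<alpha>. gibbs f g x y) \<in> subd (- g y))"

lemma gibbs_pos: "0 < gibbs f g x y"
  by (simp add: gibbs_def)

lemma gibbs_swap: "gibbs f g x y = gibbs g f y x"
  by (simp add: gibbs_def C_symmetric add.commute)

lemma C_lip2: "\<bar>C x y - C x y'\<bar> \<le> \<gamma> * dist y y'"
  using lipschitz_onD[OF C_Lipschitz, of y y' x] by (simp add: C_symmetric[of x] dist_real_def)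

lemma \<gamma>_nonneg: "0 \<le> \<gamma>"
  using lipschitz_on_nonneg[OF C_Lipschitz] .

lemma C_continuous_left [continuous_intros]: "continuous_on A (\<lambda>x. C x y)"
  using lipschitz_on_continuous_on[OF C_Lipschitz] continuous_on_subset by blast

lemma lipschitz_imp_continuous:
  assumes "\<And>x y. \<bar>g x - g y\<bar> \<le> \<gamma> * dist x (y :: 'a)"
  shows "continuous_on UNIV g"
  by (rule lipschitz_on_continuous_on[of \<gamma>], rule lipschitz_onI)
    (simp_all add: assms dist_real_def \<gamma>_nonneg)

lemma continuous_gibbs_left:
  "continuous_on UNIV f \<Longrightarrow> continuous_on UNIV (\<lambda>x. gibbs f g x y)"
  unfolding gibbs_def using eps_pos by (intro continuous_intros) auto

lemma continuous_gibbs: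
  assumes "continuous_on UNIV f" "continuous_on UNIV g"
  shows "continuous_on UNIV (\<lambda>(x, y). gibbs f g x y)"
proof -
  have "continuous_on UNIV (\<lambda>z :: 'a \<times> 'a. f (fst z))" "continuous_on UNIV (\<lambda>z :: 'a \<times> 'a. g (snd z))"
    by (intro continuous_on_comp_fst continuous_on_comp_snd assms)+
  with C_continuous show ?thesis
    unfolding gibbs_def case_prod_beta' using eps_pos by (intro continuous_intros) auto
qed

lemma integrable_gibbs:
  "\<alpha> \<in> pos_measures \<Longrightarrow> continuous_on UNIV f \<Longrightarrow> integrable \<alpha> (\<lambda>x. gibbs f g x y)"
  by (intro integrable_continuous compact_X continuous_gibbs_left)

lemma best_response_swap:
  "best_response \<beta> g f \<longleftrightarrow> (\<forall>x. (LINT y|\<beta>. gibbs f g x y) \<in> subd (- f x))"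
  unfolding best_response_def by (simp add: gibbs_swap[of g f])

text \<open>The factor \<open>exp (g y / \<epsilon>)\<close> leaves the integral, so the marginal
  density is \<open>exp ((p - q) / \<epsilon>)\<close> with \<open>p = \<epsilon> * ln I\<close> and
  \<open>q = - g y\<close>, the quantity in \<open>aprox_eq_iff\<close>. A nonzero measure makes
  \<open>I\<close> positive, so the logarithm is genuine.\<close>

lemma best_response_iff:
  assumes \<alpha>: "\<alpha> \<in> nonzero_pos_measures" and f: "continuous_on UNIV f"
  shows "best_response \<alpha> f g \<longleftrightarrow> g = aprox_softmin \<epsilon> \<phi> C \<alpha> f"
proof -
  have \<alpha>': "\<alpha> \<in> pos_measures" using \<alpha> by (simp add: nonzero_pos_measures_pos)
  have "(LINT x|\<alpha>. gibbs f g x y) \<in> subd (- g y) \<longleftrightarrow> g y = aprox_softmin \<epsilon> \<phi> C \<alpha> f y" for y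
  proof -
    define I where "I = (LINT x|\<alpha>. exp ((f x - C x y) / \<epsilon>))"
    have "(LINT x|\<alpha>. 0) < I"
      unfolding I_def using integrable_gibbs[OF \<alpha>' f, of "\<lambda>_. 0" y]
      by (intro integral_strict_mono[OF \<alpha>]) (auto simp: gibbs_def)
    then have I: "0 < I" by simp
    have "(LINT x|\<alpha>. gibbs f g x y) = (LINT x|\<alpha>. exp ((f x - C x y) / \<epsilon>) * exp (g y / \<epsilon>))"
      by (intro Bochner_Integration.integral_cong refl)
        (simp add: gibbs_def exp_add[symmetric] add_divide_distrib[symmetric] algebra_simps)
    also have "\<dots> = I * exp (g y / \<epsilon>)" by (simp add: I_def)
    also have "\<dots> = exp ((\<epsilon> * ln I - (- g y)) / \<epsilon>)" using I eps_pos by (simp add: add_divide_distrib exp_add)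
    finally have "(LINT x|\<alpha>. gibbs f g x y) \<in> subd (- g y) \<longleftrightarrow> aprox \<epsilon> conjugate (\<epsilon> * ln I) = - g y"
      by (simp add: aprox_eq_iff[OF eps_pos])
    also have "\<dots> \<longleftrightarrow> g y = aprox_softmin \<epsilon> \<phi> C \<alpha> f y"
      by (auto simp: aprox_softmin_def softmin_def I_def)
    finally show ?thesis .
  qed
  then show ?thesis by (auto simp: best_response_def fun_eq_iff)
qed

text \<open>The common source of the Lipschitz and nonexpansiveness estimates: \<open>c\<close> is
  either the change of the cost between \<open>y\<close> and \<open>y'\<close> or the distance of
  \<open>f\<close> and \<open>f'\<close>. A too large \<open>g y\<close> would make its Gibbs
  density strictly larger pointwise, whereas a subgradient at the smaller point \<open>- g y\<close>
  cannot exceed one at \<open>- g' y'\<close>.\<close>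

lemma best_response_compare:
  assumes \<alpha>: "\<alpha> \<in> nonzero_pos_measures" and f: "continuous_on UNIV f" "continuous_on UNIV f'"
    and g: "best_response \<alpha> f g" and g': "best_response \<alpha> f' g'"
    and c: "0 \<le> c" and le: "\<And>x. f' x - C x y' \<le> f x - C x y + c"
  shows "g y \<le> g' y' + c"
proof (rule ccontr)
  assume n: "\<not> g y \<le> g' y' + c"
  have \<alpha>': "\<alpha> \<in> pos_measures" using \<alpha> by (simp add: nonzero_pos_measures_pos)
  have "(LINT x|\<alpha>. gibbs f' g' x y') < (LINT x|\<alpha>. gibbs f g x y)"
  proof (rule integral_strict_mono[OF \<alpha>])
    show "gibbs f' g' x y' < gibbs f g x y" for x
      using le[of x] n eps_pos by (simp add: gibbs_def divide_strict_right_mono)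
  qed (auto intro: integrable_gibbs \<alpha>' f)
  moreover have "(LINT x|\<alpha>. gibbs f g x y) \<le> (LINT x|\<alpha>. gibbs f' g' x y')"
    using g g' n c unfolding best_response_def by (intro subd_mono[of _ "- g y" _ "- g' y'"]) auto
  ultimately show False by simp
qed

lemma best_response_lipschitz:
  assumes "\<alpha> \<in> nonzero_pos_measures" "continuous_on UNIV f" "best_response \<alpha> f g"
  shows "\<bar>g y - g y'\<bar> \<le> \<gamma> * dist y y'"
proof -
  have "g y \<le> g y' + \<gamma> * dist y y'" for y y'
  proof (rule best_response_compare[OF assms(1,2,2,3,3)])
    show "f x - C x y' \<le> f x - C x y + \<gamma> * dist y y'" for x
      using C_lip2[of x y y'] by linarith
  qed (simp add: \<gamma>_nonneg)
  from this[of y y'] this[of y' y] show ?thesis by (simp add: dist_commute)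
qed

lemma best_response_continuous:
  assumes "\<alpha> \<in> nonzero_pos_measures" "continuous_on UNIV f" "best_response \<alpha> f g"
  shows "continuous_on UNIV g"
  using best_response_lipschitz[OF assms] by (rule lipschitz_imp_continuous)

lemma best_response_nonexpansive:
  assumes "\<alpha> \<in> nonzero_pos_measures" "continuous_on UNIV f" "continuous_on UNIV f'"
    "best_response \<alpha> f g" "best_response \<alpha> f' g'" and d: "\<And>x. \<bar>f x - f' x\<bar> \<le> d"
  shows "\<bar>g y - g' y\<bar> \<le> d"
proof -
  have d0: "0 \<le> d" using d[of undefined] by linarith
  have "g y \<le> g' y + d"
    by (rule best_response_compare[OF assms(1-5) d0]) (use d in \<open>smt (verit)\<close>)
  moreover have "g' y \<le> g y + d"
    by (rule best_response_compare[OF assms(1,3,2,5,4) d0]) (use d in \<open>smt (verit)\<close>)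
  ultimately show ?thesis by linarith
qed

section \<open>A priori bounds on potentials\<close>

lemma C_bounded: obtains c where "0 \<le> c" "\<And>x y. \<bar>C x y\<bar> \<le> c"
proof -
  have "bounded ((\<lambda>(x, y). C x y) ` UNIV)"
    using compact_continuous_image[OF C_continuous compact_UNIV_prod[OF compact_X]] by (rule compact_imp_bounded)
  then obtain c where c: "\<And>x y. \<bar>C x y\<bar> \<le> c" by (auto simp: bounded_iff)
  moreover have "0 \<le> c" using c[of undefined undefined] by linarith
  ultimately show thesis using that by blast
qed

lemma scaled_dist_bounded: obtains d where "0 \<le> d" "\<And>x y :: 'a. \<gamma> * dist x y \<le> d"
proof
  have b: "bounded (UNIV :: 'a set)" using compact_X by (rule compact_imp_bounded)
  show "0 \<le> \<gamma> * diameter (UNIV :: 'a set)" by (simp add: \<gamma>_nonneg diameter_ge_0[OF b])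
  show "\<gamma> * dist x y \<le> \<gamma> * diameter (UNIV :: 'a set)" for x y :: 'a
    by (intro mult_left_mono diameter_bounded_bound b \<gamma>_nonneg) auto
qed

lemma integral_gibbs_ge:
  assumes \<alpha>: "\<alpha> \<in> pos_measures" "m \<le> measure \<alpha> UNIV" and f: "continuous_on UNIV f"
    and a: "\<And>x. a \<le> f x" and c: "\<And>x y. \<bar>C x y\<bar> \<le> c"
  shows "exp ((a + g y - c) / \<epsilon>) * m \<le> (LINT x|\<alpha>. gibbs f g x y)"
proof -
  have "exp ((a + g y - c) / \<epsilon>) * m \<le> exp ((a + g y - c) / \<epsilon>) * measure \<alpha> UNIV"
    using \<alpha>(2) by (intro mult_left_mono) auto
  also have "\<dots> \<le> (LINT x|\<alpha>. gibbs f g x y)"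
  proof (rule integral_ge_const[OF \<alpha>(1) integrable_gibbs[OF \<alpha>(1) f]])
    show "exp ((a + g y - c) / \<epsilon>) \<le> gibbs f g x y" for x
      using a[of x] c[of x y] eps_pos by (auto simp: gibbs_def intro!: divide_right_mono)
  qed
  finally show ?thesis .
qed

lemma integral_gibbs_le:
  assumes \<alpha>: "\<alpha> \<in> pos_measures" "measure \<alpha> UNIV \<le> M" and f: "continuous_on UNIV f"
    and b: "\<And>x. f x \<le> b" and c: "\<And>x y. \<bar>C x y\<bar> \<le> c"
  shows "(LINT x|\<alpha>. gibbs f g x y) \<le> exp ((b + g y + c) / \<epsilon>) * M"
proof -
  have "(LINT x|\<alpha>. gibbs f g x y) \<le> exp ((b + g y + c) / \<epsilon>) * measure \<alpha> UNIV"
  proof (rule integral_le_const[OF \<alpha>(1) integrable_gibbs[OF \<alpha>(1) f]])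
    show "gibbs f g x y \<le> exp ((b + g y + c) / \<epsilon>)" for x
      using b[of x] c[of x y] eps_pos by (auto simp: gibbs_def intro!: divide_right_mono)
  qed
  also have "\<dots> \<le> exp ((b + g y + c) / \<epsilon>) * M"
    using \<alpha>(2) by (intro mult_left_mono) auto
  finally show ?thesis .
qed

lemma exp_mult_le_1: "exp (t / \<epsilon>) * m \<le> 1 \<Longrightarrow> 0 < m \<Longrightarrow> t \<le> - \<epsilon> * ln m"
proof -
  assume m: "exp (t / \<epsilon>) * m \<le> 1" "0 < m"
  then have "exp (t / \<epsilon> + ln m) \<le> 1" by (simp add: exp_add)
  then have "t / \<epsilon> + ln m \<le> 0" by simp
  then have "\<epsilon> * (t / \<epsilon> + ln m) \<le> 0" using eps_pos by (simp add: mult_le_0_iff)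
  then show ?thesis using eps_pos by (simp add: distrib_left)
qed

lemma exp_mult_ge_1: "1 \<le> exp (t / \<epsilon>) * m \<Longrightarrow> 0 < m \<Longrightarrow> - \<epsilon> * ln m \<le> t"
proof -
  assume m: "1 \<le> exp (t / \<epsilon>) * m" "0 < m"
  then have "1 \<le> exp (t / \<epsilon> + ln m)" by (simp add: exp_add)
  then have "0 \<le> t / \<epsilon> + ln m" by simp
  then have "0 \<le> \<epsilon> * (t / \<epsilon> + ln m)" using eps_pos by simp
  then show ?thesis using eps_pos by (simp add: distrib_left)
qed

text \<open>The a priori constants see a measure only through these two bounds, so one constant
  covers a measure and all its small perturbations.\<close>

definition mass_bounded :: "real \<Rightarrow> real \<Rightarrow> 'a measure \<Rightarrow> bool" where
  "mass_bounded m M \<alpha> \<longleftrightarrow> \<alpha> \<in> pos_measures \<and> m \<le> measure \<alpha> UNIV \<and> measure \<alpha> UNIV \<le> M"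

lemma mass_bounded_nonzero: "0 < m \<Longrightarrow> mass_bounded m M \<alpha> \<Longrightarrow> \<alpha> \<in> nonzero_pos_measures"
  by (auto simp: mass_bounded_def nonzero_pos_measures_pos)

text \<open>One round of responses \<open>f\<close>, \<open>g\<close>, \<open>f'\<close>, closed up
  by damping. With \<open>l < 1\<close> it describes the fixed points of the contraction used for
  existence, with \<open>l = 1\<close> mutual best responses; a single bound then serves
  both.\<close>

definition damped_pair ::
  "real \<Rightarrow> real \<Rightarrow> real \<Rightarrow> 'a measure \<Rightarrow> 'a measure \<Rightarrow> ('a \<Rightarrow> real) \<Rightarrow> ('a \<Rightarrow> real) \<Rightarrow> ('a \<Rightarrow> real) \<Rightarrow> bool" where
  "damped_pair m M l \<alpha> \<beta> f g f' \<longleftrightarrow>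
     mass_bounded m M \<alpha> \<and> mass_bounded m M \<beta> \<and> continuous_on UNIV f \<and>
     best_response \<alpha> f g \<and> best_response \<beta> g f' \<and> 0 \<le> l \<and> l \<le> 1 \<and> (\<forall>x. f x = l * f' x)"

text \<open>
  If \<open>f'\<close> were very large, \<open>g\<close> would be very negative, so the two marginal densities, which are
  comparable, would be subgradients of \<open>\<phi>\<^sup>*\<close> at points far apart; this is what (A2) excludes.
\<close>

lemma a_priori_bound:
  assumes m: "0 < m"
  obtains B where "0 \<le> B"
    "\<And>l \<alpha> \<beta> f g f' x. damped_pair m M l \<alpha> \<beta> f g f' \<Longrightarrow> \<bar>f' x\<bar> \<le> B \<and> \<bar>g x\<bar> \<le> B"
proof -
  obtain c where c: "0 \<le> c" "\<And>x y. \<bar>C x y\<bar> \<le> c" by (rule C_bounded) blast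
  obtain R where R: "0 \<le> R" "\<And>x y :: 'a. \<gamma> * dist x y \<le> R" by (rule scaled_dist_bounded) blast
  \<comment> \<open>Nothing here relates \<open>M\<close> to \<open>m\<close>; the maximum is
    positive, as required for taking its logarithm.\<close>
  define M' where "M' = max m M"
  have M': "0 < M'" "m \<le> M'" "M \<le> M'" using m by (auto simp: M'_def)
  \<comment> \<open>The quotient of the upper bound on one marginal density and the lower bound on
    the other at the same point: the ratio of masses, with the oscillation bound \<open>R\<close>
    and the cost bound \<open>c\<close> entering once from each side.\<close>
  define K where "K = M' / m * exp ((2 * R + 2 * c) / \<epsilon>)"
  have K: "0 < K" using m M' by (simp add: K_def)
  obtain B0 where B0: "0 \<le> B0"
    "\<And>q1 q2 s1 s2. s1 \<in> subd q1 \<Longrightarrow> s2 \<in> subd q2 \<Longrightarrow> q1 < - B0 \<Longrightarrow> B0 < q2 \<Longrightarrow> K * s1 < s2"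
    using subd_gap[OF A2 K] by blast
  \<comment> \<open>If \<open>sf x\<close> is at most 1, then \<open>f' x + g x\<close> is at most
    \<open>c0\<close>; if it is at least 1, the sum is at least \<open>- c0\<close>.\<close>
  define c0 where "c0 = c + R + \<epsilon> * (\<bar>ln m\<bar> + \<bar>ln M'\<bar>)"
  have eln: "- \<epsilon> * ln m \<le> c0 - c - R" "- (c0 - c - R) \<le> - \<epsilon> * ln M'"
    using eps_pos mult_left_mono[of "- ln m" "\<bar>ln m\<bar> + \<bar>ln M'\<bar>" \<epsilon>]
      mult_left_mono[of "ln M'" "\<bar>ln m\<bar> + \<bar>ln M'\<bar>" \<epsilon>] by (auto simp: c0_def)
  have c0: "0 \<le> c0" using c R eps_pos by (simp add: c0_def)
  \<comment> \<open>When \<open>\<bar>f' x\<bar>\<close> exceeds \<open>L\<close>, the part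
    \<open>B0 + c0\<close> pushes \<open>g x\<close> beyond \<open>B0\<close> on the other side, and
    \<open>R\<close> keeps the sign of \<open>f'\<close> constant on the whole space, so that
    damping moves \<open>f\<close> towards 0.\<close>
  define L where "L = B0 + c0 + R"
  have L: "B0 \<le> L" "R \<le> L" "B0 + c0 \<le> L" "0 \<le> L" using B0 c0 R by (auto simp: L_def)
  show thesis
  proof
    show "0 \<le> L + c0" using L c0 by simp
    fix l \<alpha> \<beta> f g f' assume "damped_pair m M l \<alpha> \<beta> f g f'"
    then have \<alpha>b: "mass_bounded m M \<alpha>" and \<beta>b: "mass_bounded m M \<beta>" and f: "continuous_on UNIV f"
      and g: "best_response \<alpha> f g" and f': "best_response \<beta> g f'" and l: "0 \<le> l" "l \<le> 1"
      and ff': "\<And>x. f x = l * f' x" by (auto simp: damped_pair_def)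
    have \<alpha>: "\<alpha> \<in> pos_measures" "\<alpha> \<in> nonzero_pos_measures" "m \<le> measure \<alpha> UNIV" "measure \<alpha> UNIV \<le> M'"
      using \<alpha>b mass_bounded_nonzero[OF m \<alpha>b] M' by (auto simp: mass_bounded_def)
    have \<beta>: "\<beta> \<in> pos_measures" "\<beta> \<in> nonzero_pos_measures" "m \<le> measure \<beta> UNIV" "measure \<beta> UNIV \<le> M'"
      using \<beta>b mass_bounded_nonzero[OF m \<beta>b] M' by (auto simp: mass_bounded_def)
    have gc: "continuous_on UNIV g" by (rule best_response_continuous[OF \<alpha>(2) f g])
    have osc_f': "\<bar>f' x - f' y\<bar> \<le> R" for x y
      using best_response_lipschitz[OF \<beta>(2) gc f', of x y] R(2)[of x y] by linarith
    have osc_g: "\<bar>g x - g y\<bar> \<le> R" for x y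
      using best_response_lipschitz[OF \<alpha>(2) f g, of x y] R(2)[of x y] by linarith
    define sf where "sf x = (LINT y|\<beta>. gibbs g f' y x)" for x
    define sg where "sg y = (LINT x|\<alpha>. gibbs f g x y)" for y
    have sf: "sf x \<in> subd (- f' x)" for x using f' by (simp add: best_response_def sf_def)
    have sg: "sg y \<in> subd (- g y)" for y using g by (simp add: best_response_def sg_def)
    have sf_lo: "exp ((g y - R + f' x - c) / \<epsilon>) * m \<le> sf x" for x y
      unfolding sf_def
      by (rule integral_gibbs_ge[OF \<beta>(1,3) gc _ c(2)]) (use osc_g[of _ y] in \<open>smt (verit)\<close>)
    have sf_up: "sf x \<le> exp ((g y + R + f' x + c) / \<epsilon>) * M'" for x y
      unfolding sf_def
      by (rule integral_gibbs_le[OF \<beta>(1,4) gc _ c(2)]) (use osc_g[of _ y] in \<open>smt (verit)\<close>)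
    have sg_lo: "exp ((a + g y - c) / \<epsilon>) * m \<le> sg y" if "\<And>x. a \<le> f x" for a y
      unfolding sg_def by (rule integral_gibbs_ge[OF \<alpha>(1,3) f that c(2)])
    have sg_up: "sg y \<le> exp ((a + g y + c) / \<epsilon>) * M'" if "\<And>x. f x \<le> a" for a y
      unfolding sg_def by (rule integral_gibbs_le[OF \<alpha>(1,4) f that c(2)])
    have Kexp: "K * (exp (t / \<epsilon>) * m) = exp ((t + (2 * R + 2 * c)) / \<epsilon>) * M'" for t
      using m by (simp add: K_def add_divide_distrib exp_add)
    have f'_up: "f' x \<le> L" for x
    proof (rule ccontr)
      assume "\<not> f' x \<le> L"
      then have x: "L < f' x" by simp
      have fle: "f z \<le> f' x + R" for z
      proof -
        have "0 \<le> f' z" using osc_f'[of z x] x L by linarith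
        then have "f z \<le> f' z" using l ff' by (simp add: mult_left_le_one_le)
        then show ?thesis using osc_f'[of z x] by linarith
      qed
      have "sf x \<le> 1" using subd_le_1[OF sf] x L by simp
      then have "exp ((g x - R + f' x - c) / \<epsilon>) * m \<le> 1" using sf_lo[of x x] by linarith
      then have "g x - R + f' x - c \<le> - \<epsilon> * ln m" using m by (rule exp_mult_le_1)
      then have "B0 < - g x" using eln(1) x L(3) by linarith
      \<comment> \<open>\<open>- f' x\<close> and \<open>- g x\<close> now lie on opposite sides of
        the gap, while the chain below bounds the ratio of the same two densities by
        \<open>K\<close>.\<close>
      then have "K * sf x < sg x" using x L by (intro B0(2)[OF sf sg]) auto
      also have "sg x \<le> exp ((f' x + R + g x + c) / \<epsilon>) * M'" by (rule sg_up) (rule fle)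
      also have "\<dots> = K * (exp ((g x - R + f' x - c) / \<epsilon>) * m)"
        unfolding Kexp by (simp add: algebra_simps)
      also have "\<dots> \<le> K * sf x" using K sf_lo by (intro mult_left_mono) auto
      finally show False by simp
    qed
    have f'_lo: "- L \<le> f' x" for x
    proof (rule ccontr)
      assume "\<not> - L \<le> f' x"
      then have x: "f' x < - L" by simp
      have fge: "f' x - R \<le> f z" for z
      proof -
        have "f' z \<le> 0" using osc_f'[of z x] x L by linarith
        then have "f' z \<le> f z" using l ff' mult_right_mono_neg[of l 1 "f' z"] by simp
        then show ?thesis using osc_f'[of z x] by linarith
      qed
      have "1 \<le> sf x" using subd_ge_1[OF sf] x L by simp
      then have "1 \<le> exp ((g x + R + f' x + c) / \<epsilon>) * M'" using sf_up[of x x] by linarith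
      then have "- \<epsilon> * ln M' \<le> g x + R + f' x + c" using M'(1) by (rule exp_mult_ge_1)
      then have "B0 < g x" using eln(2) x L(3) by linarith
      then have "K * sg x < sf x" using x L by (intro B0(2)[OF sg sf]) auto
      also have "sf x \<le> exp ((g x + R + f' x + c) / \<epsilon>) * M'" by (rule sf_up)
      also have "\<dots> = K * (exp ((f' x - R + g x - c) / \<epsilon>) * m)"
        unfolding Kexp by (simp add: algebra_simps)
      also have "\<dots> \<le> K * sg x" using K sg_lo[OF fge] by (intro mult_left_mono) auto
      finally show False by simp
    qed
    have f_bd: "- L \<le> f z" "f z \<le> L" for z
    proof -
      have "\<bar>f z\<bar> \<le> \<bar>f' z\<bar>" using l by (simp add: ff' abs_mult mult_left_le_one_le)
      with f'_lo[of z] f'_up[of z] show "- L \<le> f z" "f z \<le> L" by linarith+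
    qed
    \<comment> \<open>With \<open>f\<close> bounded by \<open>L\<close>, comparing \<open>sg\<close>
      with 1 suffices to bound \<open>g\<close>.\<close>
    have g_up: "g y \<le> L + c0" for y
    proof (rule ccontr)
      assume n: "\<not> g y \<le> L + c0"
      then have "sg y \<le> 1" using L c0 by (intro subd_le_1[OF sg]) auto
      then have "exp ((- L + g y - c) / \<epsilon>) * m \<le> 1" using sg_lo[OF f_bd(1), of y] by linarith
      then have "- L + g y - c \<le> - \<epsilon> * ln m" using m by (rule exp_mult_le_1)
      then show False using n eln R by linarith
    qed
    have g_lo: "- (L + c0) \<le> g y" for y
    proof (rule ccontr)
      assume n: "\<not> - (L + c0) \<le> g y"
      then have "1 \<le> sg y" using L c0 by (intro subd_ge_1[OF sg]) auto
      then have "1 \<le> exp ((L + g y + c) / \<epsilon>) * M'" using sg_up[OF f_bd(2), of y] by linarith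
      then have "- \<epsilon> * ln M' \<le> L + g y + c" using M'(1) by (rule exp_mult_ge_1)
      then show False using n eln R by linarith
    qed
    show "\<bar>f' x\<bar> \<le> L + c0 \<and> \<bar>g x\<bar> \<le> L + c0" for x
      using f'_up[of x] f'_lo[of x] g_up[of x] g_lo[of x] c0 by (auto simp: abs_le_iff)
  qed
qed

section \<open>Limits of responses and existence of potentials\<close>

text \<open>The closed graph of the subdifferential is used at each \<open>y\<close> separately,
  where \<open>g\<close> enters as a sequence of numbers; this explains why its convergence is
  pointwise and that of \<open>f\<close> uniform.\<close>

lemma best_response_limit:
  assumes \<alpha>n: "\<And>n. \<alpha>n n \<in> pos_measures" and \<alpha>: "\<alpha> \<in> pos_measures" and w: "weakly_converges \<alpha>n \<alpha>"
    and fc: "\<And>n. continuous_on UNIV (fn n)" and f: "uniform_limit UNIV fn f sequentially"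
    and fb: "\<And>n x. \<bar>fn n x\<bar> \<le> B"
    and g: "\<And>y. (\<lambda>n. gn n y) \<longlonglongrightarrow> g y" and gb: "\<And>n x. \<bar>gn n x\<bar> \<le> B"
    and br: "\<And>n. best_response (\<alpha>n n) (fn n) (gn n)"
  shows "best_response \<alpha> f g"
  unfolding best_response_def
proof
  fix y
  obtain c where c: "0 \<le> c" "\<And>x y. \<bar>C x y\<bar> \<le> c" by (rule C_bounded) blast
  have *: "uniform_limit UNIV (\<lambda>n x. gn n y - C x y) (\<lambda>x. g y - C x y) sequentially"
    using tendstoD[OF g[of y]] by (auto simp: uniform_limit_iff dist_real_def)
  have "uniform_limit UNIV (\<lambda>n x. fn n x + (gn n y - C x y)) (\<lambda>x. f x + (g y - C x y)) sequentially"
    by (rule uniform_limit_add[OF f *])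
  \<comment> \<open>The exponential is uniformly continuous on bounded intervals only;
    \<open>2 * B + c\<close> bounds the exponents through the two potentials and the cost.\<close>
  moreover have "uniformly_continuous_on {- (2 * B + c) .. 2 * B + c} (\<lambda>t. exp (t / \<epsilon>))"
    using eps_pos by (intro compact_uniformly_continuous continuous_intros) auto
  moreover have "fn n x + (gn n y - C x y) \<in> {- (2 * B + c) .. 2 * B + c}" for n x
    using fb[of n x] gb[of n y] c(2)[of x y] by (auto simp: abs_le_iff)
  ultimately have "uniform_limit UNIV (\<lambda>n x. exp ((fn n x + (gn n y - C x y)) / \<epsilon>))
      (\<lambda>x. exp ((f x + (g y - C x y)) / \<epsilon>)) sequentially"
    by (intro uniform_limit_compose_uniformly_continuous_on[where f = "\<lambda>t. exp (t / \<epsilon>)"]) auto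
  then have "uniform_limit UNIV (\<lambda>n x. gibbs (fn n) (gn n) x y) (\<lambda>x. gibbs f g x y) sequentially"
    by (simp add: gibbs_def add_diff_eq)
  from weakly_converges_uniform[OF compact_X \<alpha>n \<alpha> w continuous_gibbs_left[OF fc] this]
  have "(\<lambda>n. LINT x|\<alpha>n n. gibbs (fn n) (gn n) x y) \<longlonglongrightarrow> (LINT x|\<alpha>. gibbs f g x y)" .
  moreover have "(\<lambda>n. - gn n y) \<longlonglongrightarrow> - g y" by (intro tendsto_minus g)
  ultimately show "(LINT x|\<alpha>. gibbs f g x y) \<in> subd (- g y)"
    using br by (intro subd_closed[of "\<lambda>n. - gn n y" "- g y"]) (auto simp: best_response_def)
qed

text \<open>Applied twice: with constant measures and damping factors tending to 1 it yields
  existence, and without damping along perturbed measures it yields convergence of their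
  potentials.\<close>

lemma response_pairs_compact:
  assumes m: "0 < m" and dp: "\<And>n. damped_pair m M (l n) (\<alpha>n n) (\<beta>n n) (fn n) (gn n) (fn' n)"
    and \<alpha>: "\<alpha> \<in> nonzero_pos_measures" and \<beta>: "\<beta> \<in> nonzero_pos_measures"
    and w\<alpha>: "weakly_converges \<alpha>n \<alpha>" and w\<beta>: "weakly_converges \<beta>n \<beta>" and llim: "l \<longlonglongrightarrow> 1"
  obtains r f g where "strict_mono (r :: nat \<Rightarrow> nat)"
    "uniform_limit UNIV (\<lambda>n. fn' (r n)) f sequentially" "uniform_limit UNIV (\<lambda>n. gn (r n)) g sequentially"
    "continuous_on UNIV f" "continuous_on UNIV g" "best_response \<alpha> f g" "best_response \<beta> g f"
proof -
  from dp have \<alpha>n: "\<And>n. mass_bounded m M (\<alpha>n n)" and \<beta>n: "\<And>n. mass_bounded m M (\<beta>n n)"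
    and fc: "\<And>n. continuous_on UNIV (fn n)" and l: "\<And>n. 0 \<le> l n" "\<And>n. l n \<le> 1"
    and br1: "\<And>n. best_response (\<alpha>n n) (fn n) (gn n)" and br2: "\<And>n. best_response (\<beta>n n) (gn n) (fn' n)"
    and ff': "\<And>n x. fn n x = l n * fn' n x" unfolding damped_pair_def by blast+
  have \<alpha>n0: "\<alpha>n n \<in> nonzero_pos_measures" and \<beta>n0: "\<beta>n n \<in> nonzero_pos_measures" for n
    using mass_bounded_nonzero[OF m] \<alpha>n \<beta>n by auto
  have \<alpha>p: "\<alpha>n n \<in> pos_measures" "\<alpha> \<in> pos_measures" and \<beta>p: "\<beta>n n \<in> pos_measures" "\<beta> \<in> pos_measures" for n
    using \<alpha>n0 \<alpha> \<beta>n0 \<beta> by (auto simp: nonzero_pos_measures_pos)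
  obtain B where B: "0 \<le> B"
    "\<And>l \<alpha> \<beta> f g f' x. damped_pair m M l \<alpha> \<beta> f g f' \<Longrightarrow> \<bar>f' x\<bar> \<le> B \<and> \<bar>g x\<bar> \<le> B"
    using a_priori_bound[OF m, of M] by blast
  have bd: "\<bar>fn' n x\<bar> \<le> B" "\<bar>gn n x\<bar> \<le> B" for n x
    using B(2)[OF dp] by auto
  have gc: "continuous_on UNIV (gn n)" for n by (rule best_response_continuous[OF \<alpha>n0 fc br1])
  have f'c: "continuous_on UNIV (fn' n)" for n by (rule best_response_continuous[OF \<beta>n0 gc br2])
  have lip: "\<bar>gn n x - gn n y\<bar> \<le> \<gamma> * dist x y" "\<bar>fn' n x - fn' n y\<bar> \<le> \<gamma> * dist x y" for n x y
    using best_response_lipschitz[OF \<alpha>n0 fc br1] best_response_lipschitz[OF \<beta>n0 gc br2] by auto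
  obtain f r1 where r1: "strict_mono (r1 :: nat \<Rightarrow> nat)" and f1: "uniform_limit UNIV (\<lambda>n. fn' (r1 n)) f sequentially"
    by (rule lipschitz_convergent_subsequence[OF compact_X bd(1) lip(2)])
  obtain g r2 where r2: "strict_mono (r2 :: nat \<Rightarrow> nat)"
    and g: "uniform_limit UNIV (\<lambda>n. gn (r1 (r2 n))) g sequentially"
    by (rule lipschitz_convergent_subsequence[of "\<lambda>n. gn (r1 n)", OF compact_X bd(2) lip(1)])
  define r where "r n = r1 (r2 n)" for n
  have r: "strict_mono r" using r1 r2 by (simp add: r_def strict_mono_def)
  have f: "uniform_limit UNIV (\<lambda>n. fn' (r n)) f sequentially"
    unfolding r_def by (rule filterlim_compose[OF f1 filterlim_subseq[OF r2]])
  have g: "uniform_limit UNIV (\<lambda>n. gn (r n)) g sequentially" using g by (simp add: r_def)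
  \<comment> \<open>\<open>fn\<close> and \<open>fn'\<close> differ by a factor tending to 1, so
    they share their limit; boundedness of \<open>f\<close> makes the product converge
    uniformly.\<close>
  have fl: "uniform_limit UNIV (\<lambda>n. fn (r n)) f sequentially"
  proof -
    have "(\<lambda>n. l (r n)) \<longlonglongrightarrow> 1" using LIMSEQ_subseq_LIMSEQ[OF llim r] by (simp add: o_def)
    then have "uniform_limit UNIV (\<lambda>n x. l (r n)) (\<lambda>x :: 'a. 1) sequentially"
      unfolding uniform_limit_iff using tendstoD by auto
    moreover have "bounded ((\<lambda>x :: 'a. 1 :: real) ` UNIV)" by (auto simp: bounded_iff)
    moreover have "\<bar>f x\<bar> \<le> B" for x
      using LIMSEQ_le_const2[OF tendsto_rabs[OF tendsto_uniform_limitI[OF f UNIV_I, of x]]] bd(1) by blast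
    then have "bounded (f ` UNIV)" by (auto simp: bounded_iff)
    ultimately have "uniform_limit UNIV (\<lambda>n x. l (r n) * fn' (r n) x) (\<lambda>x. 1 * f x) sequentially"
      using f by (intro uniform_lim_mult)
    moreover have "fn n = (\<lambda>x. l n * fn' n x)" for n by (simp add: ff' fun_eq_iff)
    ultimately show ?thesis by simp
  qed
  have "\<bar>fn n x\<bar> \<le> B" for n x
  proof -
    have "\<bar>fn n x\<bar> \<le> \<bar>fn' n x\<bar>" using l by (simp add: ff' abs_mult mult_left_le_one_le)
    with bd(1)[of n x] show ?thesis by simp
  qed
  then have brf: "best_response \<alpha> f g"
    using best_response_limit[OF \<alpha>p weakly_converges_subseq[OF w\<alpha> r] fc fl _ tendsto_uniform_limitI[OF g UNIV_I] bd(2) br1]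
    by blast
  have brg: "best_response \<beta> g f"
    using best_response_limit[OF \<beta>p weakly_converges_subseq[OF w\<beta> r] gc g bd(2) tendsto_uniform_limitI[OF f UNIV_I] bd(1) br2]
    by blast
  have "continuous_on UNIV f" "continuous_on UNIV g"
    by (rule uniform_limit_theorem[OF _ f]; simp add: f'c) (rule uniform_limit_theorem[OF _ g]; simp add: gc)
  with r f g brf brg show thesis by (intro that)
qed

text \<open>Two responses in succession are nonexpansive in the supremum norm, so the factor
  \<open>l\<close> gives a contraction. Banach's theorem applies in the complete space of bounded
  continuous functions, which by compactness contains all continuous ones.\<close>

lemma damped_response_pair_exists:
  assumes \<alpha>: "\<alpha> \<in> nonzero_pos_measures" and \<beta>: "\<beta> \<in> nonzero_pos_measures" and l: "0 \<le> l" "l < 1"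
  shows "\<exists>f g f'. continuous_on UNIV f \<and> best_response \<alpha> f g \<and> best_response \<beta> g f' \<and> (\<forall>x. f x = l * f' x)"
proof -
  define G where "G f = aprox_softmin \<epsilon> \<phi> C \<alpha> f" for f
  define F where "F g = aprox_softmin \<epsilon> \<phi> C \<beta> g" for g
  have G: "best_response \<alpha> f (G f)" "continuous_on UNIV (G f)" if "continuous_on UNIV f" for f
    using best_response_iff[OF \<alpha> that, of "G f"] best_response_continuous[OF \<alpha> that, of "G f"] by (auto simp: G_def)
  have F: "best_response \<beta> g (F g)" "continuous_on UNIV (F g)" if "continuous_on UNIV g" for g
    using best_response_iff[OF \<beta> that, of "F g"] best_response_continuous[OF \<beta> that, of "F g"] by (auto simp: F_def)
  define T where "T u = Bcontfun (\<lambda>x. l * F (G (apply_bcontfun u)) x)" for u :: "'a \<Rightarrow>\<^sub>C real"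
  have cT: "continuous_on UNIV (\<lambda>x. l * F (G (apply_bcontfun u)) x)" for u
    by (intro continuous_intros F(2) G(2)) simp
  have T: "apply_bcontfun (T u) x = l * F (G (apply_bcontfun u)) x" for u x
  proof -
    have "bounded ((\<lambda>x. l * F (G (apply_bcontfun u)) x) ` UNIV)"
      using compact_continuous_image[OF cT compact_X] by (rule compact_imp_bounded)
    then have "(\<lambda>x. l * F (G (apply_bcontfun u)) x) \<in> bcontfun"
      using cT by (simp add: bcontfun_def)
    then show ?thesis by (simp add: T_def Bcontfun_inverse)
  qed
  have "dist (T u) (T v) \<le> l * dist u v" for u v
  proof (rule dist_bound)
    fix x
    have "\<bar>G (apply_bcontfun u) y - G (apply_bcontfun v) y\<bar> \<le> dist u v" for y
      by (rule best_response_nonexpansive[OF \<alpha> _ _ G(1) G(1)])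
        (auto simp: dist_real_def[symmetric] intro: dist_bounded)
    then have "\<bar>F (G (apply_bcontfun u)) x - F (G (apply_bcontfun v)) x\<bar> \<le> dist u v"
      by (intro best_response_nonexpansive[OF \<beta> _ _ F(1) F(1)] G(2)) auto
    then have "l * \<bar>F (G (apply_bcontfun u)) x - F (G (apply_bcontfun v)) x\<bar> \<le> l * dist u v"
      using l by (intro mult_left_mono) auto
    then show "dist (apply_bcontfun (T u) x) (apply_bcontfun (T v) x) \<le> l * dist u v"
      using l by (simp add: T dist_real_def right_diff_distrib[symmetric] abs_mult)
  qed
  with banach_fix_type[OF l, of T] obtain u where u: "T u = u" by blast
  show ?thesis
  proof (intro exI conjI allI)
    show "apply_bcontfun u x = l * F (G (apply_bcontfun u)) x" for x using T[of u x] u by simp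
  qed (auto intro: F G)
qed

text \<open>
  The map \<open>AS\<^sub>\<beta> \<circ> AS\<^sub>\<alpha>\<close> is only nonexpansive; damping it by a factor below 1 makes it a
  contraction, and the damped fixed points converge along a subsequence.
\<close>

lemma response_pair_exists:
  assumes \<alpha>: "\<alpha> \<in> nonzero_pos_measures" and \<beta>: "\<beta> \<in> nonzero_pos_measures"
  shows "\<exists>f g. continuous_on UNIV f \<and> continuous_on UNIV g \<and> best_response \<alpha> f g \<and> best_response \<beta> g f"
proof -
  define l where "l n = 1 - 1 / real (Suc n)" for n
  have l: "0 \<le> l n" "l n < 1" "l n \<le> 1" for n by (auto simp: l_def field_simps)
  have "(\<lambda>n. 1 - 1 / real (Suc n)) \<longlonglongrightarrow> 1 - 0"
    by (intro tendsto_intros LIMSEQ_Suc[OF lim_inverse_n'])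
  then have llim: "l \<longlonglongrightarrow> 1" by (simp add: l_def[abs_def])
  obtain f g f' where fg: "\<And>n. continuous_on UNIV (f n)" "\<And>n. best_response \<alpha> (f n) (g n)"
    "\<And>n. best_response \<beta> (g n) (f' n)" "\<And>n x. f n x = l n * f' n x"
    using damped_response_pair_exists[OF \<alpha> \<beta> l(1,2)] by metis
  define m where "m = min (measure \<alpha> UNIV) (measure \<beta> UNIV)"
  define M where "M = max (measure \<alpha> UNIV) (measure \<beta> UNIV)"
  have m: "0 < m" "mass_bounded m M \<alpha>" "mass_bounded m M \<beta>"
    using \<alpha> \<beta> by (auto simp: m_def M_def mass_bounded_def nonzero_pos_measures_pos)
  have "damped_pair m M (l n) \<alpha> \<beta> (f n) (g n) (f' n)" for n
    using m(2,3) fg l by (simp add: damped_pair_def)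
  from response_pairs_compact[OF m(1) this \<alpha> \<beta> weakly_converges_const weakly_converges_const llim]
  show ?thesis by metis
qed

section \<open>Uniqueness of potentials\<close>

text \<open>A response sees \<open>f\<close> only under the integral, yet is determined at every
  point. So almost-everywhere equality of one potential becomes equality everywhere of the
  other.\<close>

lemma best_response_cong_AE:
  assumes \<alpha>: "\<alpha> \<in> nonzero_pos_measures" and f: "continuous_on UNIV f" "continuous_on UNIV f1"
    and ae: "AE x in \<alpha>. f x = f1 x" and g: "best_response \<alpha> f g" "best_response \<alpha> f1 g1"
  shows "g = g1"
proof -
  have "(LINT x|\<alpha>. gibbs f1 g1 x y) = (LINT x|\<alpha>. gibbs f g1 x y)" for y
  proof (rule integral_cong_AE)
    show "AE x in \<alpha>. gibbs f1 g1 x y = gibbs f g1 x y"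
      using ae by eventually_elim (simp add: gibbs_def)
  qed (use \<alpha> f in \<open>auto intro!: borel_measurable_integrable integrable_gibbs simp: nonzero_pos_measures_pos\<close>)
  with g(2) have "best_response \<alpha> f g1" by (simp add: best_response_def)
  with g(1) best_response_iff[OF \<alpha> f(1)] show ?thesis by simp
qed

text \<open>The increment of the potentials paired with the decrement \<open>E\<close> of the Gibbs
  density has nonpositive double integral, because the exponential increases. By Fubini this is the
  sum of the integrals of \<open>U\<close> and \<open>V\<close>, both nonnegative by monotonicity of
  subgradients. Hence all vanish, and strict monotonicity gives equality almost everywhere.\<close>

lemma response_pair_unique:
  assumes \<alpha>: "\<alpha> \<in> nonzero_pos_measures" and \<beta>: "\<beta> \<in> nonzero_pos_measures"
    and c: "continuous_on UNIV f" "continuous_on UNIV g" "continuous_on UNIV f1" "continuous_on UNIV g1"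
    and br: "best_response \<alpha> f g" "best_response \<beta> g f" "best_response \<alpha> f1 g1" "best_response \<beta> g1 f1"
  shows "f = f1 \<and> g = g1"
proof -
  have \<alpha>p: "\<alpha> \<in> pos_measures" and \<beta>p: "\<beta> \<in> pos_measures"
    using \<alpha> \<beta> by (auto simp: nonzero_pos_measures_pos)
  define E where "E x y = gibbs f g x y - gibbs f1 g1 x y" for x y
  have Ec: "continuous_on UNIV (\<lambda>(x, y). E x y)"
    using continuous_on_diff[OF continuous_gibbs[OF c(1,2)] continuous_gibbs[OF c(3,4)]]
    by (simp add: E_def case_prod_beta')
  have ufE: "continuous_on UNIV (\<lambda>(x, y). (f1 x - f x) * E x y)"
    using Ec continuous_on_comp_fst[OF c(1)] continuous_on_comp_fst[OF c(3)] by (auto simp: case_prod_beta' intro!: continuous_intros)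
  have ugE: "continuous_on UNIV (\<lambda>(x, y). (g1 y - g y) * E x y)"
    using Ec continuous_on_comp_snd[OF c(2)] continuous_on_comp_snd[OF c(4)] by (auto simp: case_prod_beta' intro!: continuous_intros)
  define U where "U x = (f1 x - f x) * (LINT y|\<beta>. E x y)" for x
  define V where "V y = (g1 y - g y) * (LINT x|\<alpha>. E x y)" for y
  have int1: "(LINT x|\<alpha>. E x y) = (LINT x|\<alpha>. gibbs f g x y) - (LINT x|\<alpha>. gibbs f1 g1 x y)" for y
    unfolding E_def by (intro Bochner_Integration.integral_diff integrable_gibbs \<alpha>p c)
  have int2: "(LINT y|\<beta>. E x y) = (LINT y|\<beta>. gibbs f g x y) - (LINT y|\<beta>. gibbs f1 g1 x y)" for x
    unfolding E_def gibbs_swap[of f] gibbs_swap[of f1]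
    by (intro Bochner_Integration.integral_diff integrable_gibbs \<beta>p c)
  \<comment> \<open>Monotonicity appears reversed because the subgradients are taken at minus the
    potentials. (A1) acts in the strict part.\<close>
  have pos: "0 \<le> (q' - q) * (s - s') \<and> (q \<noteq> q' \<longrightarrow> 0 < (q' - q) * (s - s'))"
    if "s \<in> subd (- q)" "s' \<in> subd (- q')" for q q' s s'
  proof (cases q q' rule: linorder_cases)
    case less
    then show ?thesis using subd_strict_mono[OF A1 that(2,1)] by simp
  next
    case greater
    then have "0 < (q' - q) * (s - s')"
      using subd_strict_mono[OF A1 that(1,2)] by (intro mult_neg_neg) auto
    then show ?thesis by simp
  qed simp
  have U: "0 \<le> U x" "f x \<noteq> f1 x \<Longrightarrow> U x \<noteq> 0" for x
    using pos[of "LINT y|\<beta>. gibbs f g x y" "f x" "LINT y|\<beta>. gibbs f1 g1 x y" "f1 x"] br(2,4)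
    unfolding best_response_swap U_def int2 by auto
  have V: "0 \<le> V y" "g y \<noteq> g1 y \<Longrightarrow> V y \<noteq> 0" for y
    using pos[of "LINT x|\<alpha>. gibbs f g x y" "g y" "LINT x|\<alpha>. gibbs f1 g1 x y" "g1 y"] br(1,3)
    unfolding best_response_def V_def int1 by auto
  have Uint: "integrable \<alpha> U" and Ueq: "(LINT x|\<alpha>. U x) = (LINT z|(\<alpha> \<Otimes>\<^sub>M \<beta>). (f1 (fst z) - f (fst z)) * E (fst z) (snd z))"
    using integrable_partial_integral[OF compact_X \<alpha>p \<beta>p ufE] integral_pair_continuous[OF compact_X \<alpha>p \<beta>p ufE]
    by (simp_all add: U_def[abs_def])
  have Vint: "integrable \<beta> V"
    using integrable_partial_integral[OF compact_X \<beta>p \<alpha>p, of "\<lambda>y x. (g1 y - g y) * E x y"]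
      continuous_on_compose2[OF ugE continuous_on_swap[of UNIV]]
    by (simp add: V_def[abs_def] case_prod_beta' prod.swap_def)
  have Veq: "(LINT y|\<beta>. V y) = (LINT z|(\<alpha> \<Otimes>\<^sub>M \<beta>). (g1 (snd z) - g (snd z)) * E (fst z) (snd z))"
    using integral_pair_continuous[OF compact_X \<alpha>p \<beta>p ugE] integral_swap[OF compact_X \<alpha>p \<beta>p ugE]
    by (simp add: V_def[abs_def])
  have "(LINT x|\<alpha>. U x) + (LINT y|\<beta>. V y) =
      (LINT z|(\<alpha> \<Otimes>\<^sub>M \<beta>). (f1 (fst z) - f (fst z)) * E (fst z) (snd z) + (g1 (snd z) - g (snd z)) * E (fst z) (snd z))"
    unfolding Ueq Veq
    by (rule Bochner_Integration.integral_add[symmetric])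
      (intro integrable_pair_continuous[OF compact_X \<alpha>p \<beta>p] ufE ugE)+
  also have "\<dots> \<le> 0"
  proof -
    let ?H = "\<lambda>z. (f1 (fst z) - f (fst z)) * E (fst z) (snd z) + (g1 (snd z) - g (snd z)) * E (fst z) (snd z)"
    have "?H z \<le> 0" for z
    proof -
    have "((f1 (fst z) + g1 (snd z)) - (f (fst z) + g (snd z))) * E (fst z) (snd z) \<le> 0"
    proof (cases "f (fst z) + g (snd z) \<le> f1 (fst z) + g1 (snd z)")
      case True
      then have "E (fst z) (snd z) \<le> 0" using eps_pos by (auto simp: E_def gibbs_def intro!: divide_right_mono)
      with True show ?thesis by (simp add: mult_nonneg_nonpos)
    next
      case False
      then have "0 \<le> E (fst z) (snd z)" using eps_pos by (auto simp: E_def gibbs_def intro!: divide_right_mono)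
      with False show ?thesis by (simp add: mult_nonpos_nonneg)
    qed
    then show ?thesis by (simp add: algebra_simps)
    qed
    then have "0 \<le> (LINT z|(\<alpha> \<Otimes>\<^sub>M \<beta>). - ?H z)" by (intro Bochner_Integration.integral_nonneg) (simp only: neg_0_le_iff_le)
    then show ?thesis by (simp only: integral_minus neg_0_le_iff_le)
  qed
  finally have sum: "(LINT x|\<alpha>. U x) + (LINT y|\<beta>. V y) \<le> 0" .
  have UV: "0 \<le> (LINT x|\<alpha>. U x)" "0 \<le> (LINT y|\<beta>. V y)" using U(1) V(1) by simp_all
  have "AE x in \<alpha>. U x = 0"
    using integral_nonneg_eq_0_iff_AE[OF Uint] U(1) sum UV by simp
  then have ae1: "AE x in \<alpha>. f x = f1 x" by eventually_elim (use U(2) in blast)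
  have "AE y in \<beta>. V y = 0"
    using integral_nonneg_eq_0_iff_AE[OF Vint] V(1) sum UV by simp
  then have ae2: "AE y in \<beta>. g y = g1 y" by eventually_elim (use V(2) in blast)
  \<comment> \<open>The conclusion is crosswise: agreement of \<open>f\<close> and \<open>f1\<close>
    identifies their responses \<open>g\<close> and \<open>g1\<close>, and conversely.\<close>
  show ?thesis
    using best_response_cong_AE[OF \<alpha> c(1,3) ae1 br(1,3)] best_response_cong_AE[OF \<beta> c(2,4) ae2 br(2,4)] by simp
qed

end

section \<open>Duality\<close>

lemma measurable_pos_measures:
  "\<mu> \<in> pos_measures \<Longrightarrow> borel_measurable \<mu> = borel_measurable borel"
  by (rule measurable_cong_sets) (auto dest: pos_measuresD)

lemma lebesgue_decomposition_density:
  assumes \<nu>: "\<nu> \<in> pos_measures" and r: "r \<in> borel_measurable borel" "\<And>x. 0 \<le> r x"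
    and \<mu>: "density \<nu> (\<lambda>x. ennreal (r x)) = \<mu>"
  shows "lebesgue_decomposition \<mu> \<nu> r (null_measure borel)"
proof -
  have "null_measure borel \<in> pos_measures"
    by (auto simp: pos_measures_def intro!: finite_measureI)
  then show ?thesis
    unfolding lebesgue_decomposition_def using r \<mu> by (auto intro!: bexI[of _ "{}"])
qed

text \<open>The singular part lives on a \<nu>-null set, which is also \<mu>-null since \<mu> has a
  density; so it has no mass, and the two densities represent the same measure.\<close>

lemma lebesgue_decomposition_density_unique:
  assumes \<nu>: "\<nu> \<in> pos_measures" and r: "r \<in> borel_measurable borel" "\<And>x. 0 \<le> r x"
    and \<mu>: "density \<nu> (\<lambda>x. ennreal (r x)) = \<mu>"
    and dec: "lebesgue_decomposition \<mu> \<nu> r' \<sigma>"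
  shows "AE x in \<nu>. r' x = r x" and "emeasure \<sigma> UNIV = 0"
proof -
  note n = pos_measuresD[OF \<nu>]
  interpret n: finite_measure \<nu> by (rule n(1))
  from dec have r': "r' \<in> borel_measurable borel" "\<And>x. 0 \<le> r' x" and \<sigma>: "\<sigma> \<in> pos_measures"
    and sum: "\<And>A. A \<in> sets borel \<Longrightarrow> emeasure \<mu> A = emeasure (density \<nu> (\<lambda>x. ennreal (r' x))) A + emeasure \<sigma> A"
    by (auto simp: lebesgue_decomposition_def)
  obtain N where N: "N \<in> sets borel" "emeasure \<nu> N = 0" "emeasure \<sigma> (UNIV - N) = 0"
    using dec by (auto simp: lebesgue_decomposition_def)
  have m: "(\<lambda>x. ennreal (r x)) \<in> borel_measurable \<nu>" "(\<lambda>x. ennreal (r' x)) \<in> borel_measurable \<nu>"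
    using r(1) r'(1) by (auto simp: measurable_pos_measures[OF \<nu>])
  have "N \<in> null_sets \<nu>" using N n by auto
  then have "AE x in \<nu>. x \<in> N \<longrightarrow> ennreal (r x) = 0"
    by (rule AE_I'[of N]) auto
  then have "N \<in> null_sets \<mu>"
    unfolding \<mu>[symmetric] using m n N by (simp add: null_sets_density_iff)
  with sum[OF N(1)] have "emeasure \<sigma> N = 0" by auto
  moreover have "emeasure \<sigma> UNIV = emeasure \<sigma> N + emeasure \<sigma> (UNIV - N)"
    using N(1) pos_measuresD[OF \<sigma>] by (subst plus_emeasure) auto
  ultimately show z: "emeasure \<sigma> UNIV = 0" using N by simp
  have "density \<nu> (\<lambda>x. ennreal (r' x)) = density \<nu> (\<lambda>x. ennreal (r x))"
  proof (rule measure_eqI)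
    fix A assume "A \<in> sets (density \<nu> (\<lambda>x. ennreal (r' x)))"
    then have A: "A \<in> sets borel" using n by simp
    have "emeasure \<sigma> A \<le> emeasure \<sigma> UNIV" using A pos_measuresD[OF \<sigma>] by (intro emeasure_mono) auto
    with z sum[OF A] \<mu> show "emeasure (density \<nu> (\<lambda>x. ennreal (r' x))) A = emeasure (density \<nu> (\<lambda>x. ennreal (r x))) A"
      by simp
  qed simp
  then have "AE x in \<nu>. ennreal (r' x) = ennreal (r x)" using m by (intro n.density_unique)
  then show "AE x in \<nu>. r' x = r x" by eventually_elim (use r(2) r'(2) in simp)
qed

text \<open>Resolves the definite description in the absolutely continuous case. Plans with finite
  \<open>KL\<close> have such marginals, so the recession term vanishes wherever a divergence is
  evaluated.\<close>

lemma phi_divergence_density: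
  assumes \<nu>: "\<nu> \<in> pos_measures" and r: "r \<in> borel_measurable borel" "\<And>x. 0 \<le> r x"
    and \<mu>: "density \<nu> (\<lambda>x. ennreal (r x)) = \<mu>"
  shows "phi_divergence \<phi> \<mu> \<nu> = (\<integral>\<^sup>+ x. \<phi> (r x) \<partial>\<nu>)"
  unfolding phi_divergence_def
proof (rule the_equality)
  show "\<exists>r' \<sigma>. lebesgue_decomposition \<mu> \<nu> r' \<sigma> \<and>
      (\<integral>\<^sup>+ x. \<phi> (r x) \<partial>\<nu>) = (\<integral>\<^sup>+ x. \<phi> (r' x) \<partial>\<nu>) + recession \<phi> * emeasure \<sigma> UNIV"
    using lebesgue_decomposition_density[OF assms] by (intro exI[of _ r] exI[of _ "null_measure borel"]) simp
next
  fix d assume "\<exists>r' \<sigma>. lebesgue_decomposition \<mu> \<nu> r' \<sigma> \<and>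
      d = (\<integral>\<^sup>+ x. \<phi> (r' x) \<partial>\<nu>) + recession \<phi> * emeasure \<sigma> UNIV"
  then obtain r' \<sigma> where dec: "lebesgue_decomposition \<mu> \<nu> r' \<sigma>"
    and d: "d = (\<integral>\<^sup>+ x. \<phi> (r' x) \<partial>\<nu>) + recession \<phi> * emeasure \<sigma> UNIV" by blast
  note u = lebesgue_decomposition_density_unique[OF assms dec]
  have "(\<integral>\<^sup>+ x. \<phi> (r' x) \<partial>\<nu>) = (\<integral>\<^sup>+ x. \<phi> (r x) \<partial>\<nu>)"
    by (rule nn_integral_cong_AE) (use u(1) in eventually_elim, simp)
  with u(2) d show "d = (\<integral>\<^sup>+ x. \<phi> (r x) \<partial>\<nu>)" by simp
qed

text \<open>\<open>ennreal\<close> truncates negative values to 0, which can only enlarge the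
  integral.\<close>

lemma integral_le_nn_integral:
  assumes "integrable M k"
  shows "ereal (LINT x|M. k x) \<le> enn2ereal (\<integral>\<^sup>+ x. ennreal (k x) \<partial>M)"
proof -
  have i: "integrable M (\<lambda>x. max 0 (k x))" using assms by auto
  have "(\<integral>\<^sup>+ x. ennreal (k x) \<partial>M) = (\<integral>\<^sup>+ x. ennreal (max 0 (k x)) \<partial>M)"
    by (intro nn_integral_cong) (simp add: max_def ennreal_neg)
  also have "\<dots> = ennreal (LINT x|M. max 0 (k x))" by (rule nn_integral_eq_integral[OF i]) simp
  finally have "enn2ereal (\<integral>\<^sup>+ x. ennreal (k x) \<partial>M) = ereal (LINT x|M. max 0 (k x))"
    by (simp add: enn2ereal_ennreal)
  moreover have "(LINT x|M. k x) \<le> (LINT x|M. max 0 (k x))" using assms i by (intro integral_mono) auto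
  ultimately show ?thesis by simp
qed

lemma real_density_exists:
  assumes \<mu>: "\<mu> \<in> pos_measures" and \<nu>: "\<nu> \<in> pos_measures" and ac: "absolutely_continuous \<nu> \<mu>"
  obtains D :: "_ \<Rightarrow> real" where "D \<in> borel_measurable \<nu>" "AE x in \<mu>. RN_deriv \<nu> \<mu> x = ennreal (D x)"
    "AE x in \<mu>. 0 < D x" "\<And>x. 0 \<le> D x" "density \<nu> (\<lambda>x. ennreal (D x)) = \<mu>"
proof -
  interpret finite_measure \<nu> by (rule pos_measuresD(1)[OF \<nu>])
  have sets: "sets \<mu> = sets \<nu>" using pos_measuresD(2)[OF \<mu>] pos_measuresD(2)[OF \<nu>] by simp
  obtain D where D: "D \<in> borel_measurable \<nu>" "AE x in \<nu>. RN_deriv \<nu> \<mu> x = ennreal (D x)"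
    "AE x in \<mu>. 0 < D x" "\<And>x. 0 \<le> D x"
    using real_RN_deriv[OF pos_measuresD(1)[OF \<mu>] ac sets] by blast
  have "density \<nu> (RN_deriv \<nu> \<mu>) = density \<nu> (\<lambda>x. ennreal (D x))"
    using D(1,2) by (intro density_cong) auto
  then have "density \<nu> (\<lambda>x. ennreal (D x)) = \<mu>" using density_RN_deriv[OF ac sets] by simp
  then show thesis by (rule that[OF D(1) absolutely_continuous_AE[OF sets ac D(2)] D(3,4)])
qed

text \<open>The Fenchel inequality of relative entropy with test function \<open>w\<close>.
  Pointwise it is \<open>ln u \<le> u - 1\<close> at the quotient \<open>u\<close> of
  \<open>exp (w z)\<close> and the density of \<pi>.\<close>

lemma KL_ge:
  fixes w :: "'b::topological_space \<Rightarrow> real"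
  assumes comp: "compact (UNIV :: 'b set)" and P: "P \<in> pos_measures" and \<pi>: "\<pi> \<in> pos_measures"
    and w: "continuous_on UNIV w"
  shows "ereal ((LINT z|\<pi>. w z) - (LINT z|P. exp (w z) - 1)) \<le> KL \<pi> P"
proof (cases "absolutely_continuous P \<pi> \<and> integrable \<pi> (\<lambda>x. ln (enn2real (RN_deriv P \<pi> x)))")
  case True
  then have ac: "absolutely_continuous P \<pi>" and int: "integrable \<pi> (\<lambda>x. ln (enn2real (RN_deriv P \<pi> x)))" by auto
  interpret P: finite_measure P by (rule pos_measuresD(1)[OF P])
  interpret \<pi>: finite_measure \<pi> by (rule pos_measuresD(1)[OF \<pi>])
  obtain D where D: "D \<in> borel_measurable P" "AE x in \<pi>. RN_deriv P \<pi> x = ennreal (D x)"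
    "AE x in \<pi>. 0 < D x" "\<And>x. 0 \<le> D x" and dens: "\<pi> = density P (\<lambda>x. ennreal (D x))"
    using real_density_exists[OF \<pi> P ac] by metis
  have we: "integrable \<pi> w" "integrable P (\<lambda>z. exp (w z))"
    using w by (auto intro!: integrable_continuous[OF comp] \<pi> P continuous_intros)
  \<comment> \<open>Division by zero yields 0, so passing from \<pi> to \<open>P\<close> loses
    \<open>exp (w z)\<close> where the density vanishes. The loss has the favourable sign.\<close>
  define k where "k z = (if D z = 0 then 0 else exp (w z))" for z
  have km: "k \<in> borel_measurable P" unfolding k_def using D(1) we(2) by (intro measurable_If) auto
  have ki: "integrable P k"
    by (rule Bochner_Integration.integrable_bound[OF we(2) km]) (auto simp: k_def)
  have Dk: "D z *\<^sub>R (exp (w z) / D z) = k z" for z by (simp add: k_def)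
  have em: "(\<lambda>z. exp (w z) / D z) \<in> borel_measurable P" using D(1) we(2) by auto
  have ei: "integrable \<pi> (\<lambda>z. exp (w z) / D z)"
    unfolding dens by (subst integrable_density[OF em D(1)]) (simp add: D(4), simp only: Dk ki)
  have ev: "(LINT z|\<pi>. exp (w z) / D z) = (LINT z|P. k z)"
    unfolding dens by (subst integral_density[OF em D(1)]) (simp add: D(4), simp only: Dk)
  have "(LINT z|\<pi>. w z + 1 - exp (w z) / D z) \<le> (LINT z|\<pi>. ln (enn2real (RN_deriv P \<pi> z)))"
  proof (rule integral_mono_AE)
    show "integrable \<pi> (\<lambda>z. w z + 1 - exp (w z) / D z)" using we ei by auto
    show "AE z in \<pi>. w z + 1 - exp (w z) / D z \<le> ln (enn2real (RN_deriv P \<pi> z))"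
      using D(2,3)
    proof eventually_elim
      case (elim z)
      have "ln (exp (w z) / D z) \<le> exp (w z) / D z - 1" using elim by (intro ln_le_minus_one) auto
      with elim show ?case by (simp add: ln_div)
    qed
  qed (rule int)
  moreover have "(LINT z|\<pi>. w z + 1 - exp (w z) / D z) = (LINT z|\<pi>. w z) + measure \<pi> (space \<pi>) - (LINT z|P. k z)"
    using we ei by (simp add: ev)
  moreover have "(LINT z|P. k z) \<le> (LINT z|P. exp (w z))"
    by (rule integral_mono[OF ki we(2)]) (simp add: k_def)
  moreover have "(LINT z|P. exp (w z) - 1) = (LINT z|P. exp (w z)) - measure P (space P)"
    using we by simp
  ultimately show ?thesis using True by (simp add: KL_def)
next
  case False
  then show ?thesis unfolding KL_def by auto
qed

context entropy_fun
begin

lemma phi_divergence_ge: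
  assumes comp: "compact (UNIV :: 'b::topological_space set)"
    and \<mu>: "\<mu> \<in> pos_measures" and \<nu>: "\<nu> \<in> pos_measures" and ac: "absolutely_continuous \<nu> \<mu>"
    and h: "continuous_on UNIV h" "continuous_on UNIV (\<lambda>x. cval (- h x))" and dom: "\<And>x :: 'b. - h x \<in> cdom"
  shows "ereal (- (LINT x|\<mu>. h x) - (LINT x|\<nu>. cval (- h x))) \<le> enn2ereal (phi_divergence \<phi> \<mu> \<nu>)"
proof -
  obtain D where D: "D \<in> borel_measurable \<nu>" "\<And>x. 0 \<le> D x"
    and dens: "density \<nu> (\<lambda>x. ennreal (D x)) = \<mu>"
    using real_density_exists[OF \<mu> \<nu> ac] by metis
  have Db: "D \<in> borel_measurable borel" using D(1) by (simp add: measurable_pos_measures[OF \<nu>])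
  have div: "phi_divergence \<phi> \<mu> \<nu> = (\<integral>\<^sup>+ x. \<phi> (D x) \<partial>\<nu>)"
    by (rule phi_divergence_density[OF \<nu> Db D(2) dens])
  have hi: "integrable \<mu> h" by (rule integrable_continuous[OF comp \<mu> h(1)])
  have hm: "h \<in> borel_measurable \<nu>"
    using borel_measurable_integrable[OF hi] by (simp add: measurable_pos_measures \<mu> \<nu>)
  have Dh: "integrable \<nu> (\<lambda>x. D x * h x)" "(LINT x|\<nu>. D x * h x) = (LINT x|\<mu>. h x)"
    using hi unfolding dens[symmetric] using D hm by (auto simp: integrable_density integral_density)
  have ci: "integrable \<nu> (\<lambda>x. cval (- h x))" by (rule integrable_continuous[OF comp \<nu> h(2)])
  have ki: "integrable \<nu> (\<lambda>x. D x * (- h x) - cval (- h x))" using Dh(1) ci by simp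
  have "- (LINT x|\<mu>. h x) - (LINT x|\<nu>. cval (- h x)) = (LINT x|\<nu>. D x * (- h x) - cval (- h x))"
    using Dh ci by simp
  also have "ereal \<dots> \<le> enn2ereal (\<integral>\<^sup>+ x. ennreal (D x * (- h x) - cval (- h x)) \<partial>\<nu>)"
    by (rule integral_le_nn_integral[OF ki])
  also have "\<dots> \<le> enn2ereal (\<integral>\<^sup>+ x. \<phi> (D x) \<partial>\<nu>)"
    by (intro iffD1[OF less_eq_ennreal.rep_eq] nn_integral_mono fenchel_young_ennreal D dom)
  finally show ?thesis by (simp add: div)
qed

text \<open>Equality case: at subgradient densities each \<open>\<phi> (r x)\<close> is a
  nonnegative real, so the truncation by \<open>ennreal\<close> is lossless.\<close>

lemma phi_divergence_eq:
  assumes \<nu>: "\<nu> \<in> pos_measures" and r: "r \<in> borel_measurable borel" "\<And>x. 0 \<le> r x"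
    and \<mu>: "density \<nu> (\<lambda>x. ennreal (r x)) = \<mu>"
    and sub: "\<And>x. r x \<in> subd (- h x)"
    and int: "integrable \<nu> (\<lambda>x. r x * h x)" "integrable \<nu> (\<lambda>x. cval (- h x))"
  shows "enn2ereal (phi_divergence \<phi> \<mu> \<nu>) = ereal (- (LINT x|\<nu>. r x * h x) - (LINT x|\<nu>. cval (- h x)))"
proof -
  have "phi_divergence \<phi> \<mu> \<nu> = (\<integral>\<^sup>+ x. ennreal (r x * (- h x) - cval (- h x)) \<partial>\<nu>)"
    using fenchel_equality(2)[OF sub r(2)] by (simp add: phi_divergence_density[OF \<nu> r \<mu>])
  also have "\<dots> = ennreal (LINT x|\<nu>. r x * (- h x) - cval (- h x))"
    using int fenchel_equality(1)[OF sub r(2)] by (intro nn_integral_eq_integral) auto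
  finally have "enn2ereal (phi_divergence \<phi> \<mu> \<nu>) = ereal (LINT x|\<nu>. r x * (- h x) - cval (- h x))"
    using fenchel_equality(1)[OF sub r(2)] by (simp add: enn2ereal_ennreal)
  then show ?thesis using int by simp
qed

end

section \<open>Plans, marginals and the dual objective\<close>

lemma emeasure_distr_density:
  assumes "K \<in> borel_measurable P" "T \<in> measurable P N" "A \<in> sets N"
  shows "emeasure (distr (density P K) N T) A = (\<integral>\<^sup>+ z. K z * indicator A (T z) \<partial>P)"
proof -
  have "emeasure (distr (density P K) N T) A = (\<integral>\<^sup>+ z. K z * indicator (T -` A \<inter> space P) z \<partial>P)"
    using assms by (simp add: emeasure_distr emeasure_density)
  also have "\<dots> = (\<integral>\<^sup>+ z. K z * indicator A (T z) \<partial>P)"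
    by (intro nn_integral_cong) (simp add: indicator_def)
  finally show ?thesis .
qed

lemma marginal_in_pos_measures:
  fixes \<pi> :: "('a::metric_space \<times> 'a) measure"
  assumes "\<pi> \<in> pos_measures"
  shows "distr \<pi> borel fst \<in> pos_measures" "distr \<pi> borel snd \<in> pos_measures"
    "fst \<in> borel_measurable \<pi>" "snd \<in> borel_measurable \<pi>"
proof -
  interpret finite_measure \<pi> by (rule pos_measuresD(1)[OF assms])
  show m: "fst \<in> borel_measurable \<pi>" "snd \<in> borel_measurable \<pi>"
    unfolding measurable_pos_measures[OF assms]
    by (auto intro!: borel_measurable_continuous_onI continuous_intros)
  show "distr \<pi> borel fst \<in> pos_measures" "distr \<pi> borel snd \<in> pos_measures"
    using m by (auto simp: pos_measures_def intro!: finite_measure_distr)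
qed

text \<open>Null sets of \<alpha> and \<beta> extend to null cylinders of the product. This brings
  the divergences of the marginals into density form.\<close>

lemma marginals_absolutely_continuous:
  fixes \<alpha> \<beta> :: "'a::metric_space measure"
  assumes \<alpha>: "\<alpha> \<in> pos_measures" and \<beta>: "\<beta> \<in> pos_measures" and \<pi>: "\<pi> \<in> pos_measures"
    and ac: "absolutely_continuous (\<alpha> \<Otimes>\<^sub>M \<beta>) \<pi>"
  shows "absolutely_continuous \<alpha> (distr \<pi> borel fst)" "absolutely_continuous \<beta> (distr \<pi> borel snd)"
proof -
  note a = pos_measuresD[OF \<alpha>] and b = pos_measuresD[OF \<beta>] and p = pos_measuresD[OF \<pi>]
  interpret a: finite_measure \<alpha> by (rule a(1))
  interpret b: finite_measure \<beta> by (rule b(1))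
  note m = marginal_in_pos_measures[OF \<pi>]
  show "absolutely_continuous \<alpha> (distr \<pi> borel fst)"
    unfolding absolutely_continuous_def
  proof
    fix A assume A: "A \<in> null_sets \<alpha>"
    then have "A \<times> UNIV \<in> null_sets (\<alpha> \<Otimes>\<^sub>M \<beta>)"
      using b by (auto simp: null_sets_def b.emeasure_pair_measure_Times)
    then have "A \<times> UNIV \<in> null_sets \<pi>" using ac by (auto simp: absolutely_continuous_def)
    moreover have "fst -` A \<inter> space \<pi> = A \<times> UNIV" using p by auto
    ultimately show "A \<in> null_sets (distr \<pi> borel fst)"
      using A a m by (auto simp: null_sets_def emeasure_distr)
  qed
  show "absolutely_continuous \<beta> (distr \<pi> borel snd)"
    unfolding absolutely_continuous_def
  proof
    fix A assume A: "A \<in> null_sets \<beta>"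
    then have "UNIV \<times> A \<in> null_sets (\<alpha> \<Otimes>\<^sub>M \<beta>)"
      using a by (auto simp: null_sets_def b.emeasure_pair_measure_Times)
    then have "UNIV \<times> A \<in> null_sets \<pi>" using ac by (auto simp: absolutely_continuous_def)
    moreover have "snd -` A \<inter> space \<pi> = UNIV \<times> A" using p by auto
    ultimately show "A \<in> null_sets (distr \<pi> borel snd)"
      using A b m by (auto simp: null_sets_def emeasure_distr)
  qed
qed

context entropic_ot
begin

text \<open>It agrees with the dual objective where \<open>- f\<close> and \<open>- g\<close> take
  values in \<open>cdom\<close>; elsewhere \<open>cval\<close> would replace infinite penalties by
  0.\<close>

definition dual :: "'a measure \<Rightarrow> 'a measure \<Rightarrow> ('a \<Rightarrow> real) \<Rightarrow> ('a \<Rightarrow> real) \<Rightarrow> real" where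
  "dual \<alpha> \<beta> f g = - (LINT x|\<alpha>. cval (- f x)) - (LINT y|\<beta>. cval (- g y))
     - \<epsilon> * (LINT x|\<alpha>. LINT y|\<beta>. gibbs f g x y - 1)"

text \<open>Continuity of the composite with \<open>cval\<close> makes the conjugate terms
  integrable against every finite measure, hence against all perturbed ones.\<close>

definition dual_feasible :: "('a \<Rightarrow> real) \<Rightarrow> bool" where
  "dual_feasible f \<longleftrightarrow> continuous_on UNIV f \<and> continuous_on UNIV (\<lambda>x. cval (- f x)) \<and> (\<forall>x. - f x \<in> cdom)"

lemma continuous_gibbs_minus_1:
  "continuous_on UNIV f \<Longrightarrow> continuous_on UNIV g \<Longrightarrow> continuous_on UNIV (\<lambda>(x, y). gibbs f g x y - 1)"
  using continuous_on_diff[OF continuous_gibbs continuous_on_const, of f g 1] by (simp add: case_prod_beta')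

text \<open>Plans with infinite \<open>KL\<close> have infinite objective. For the others three
  Fenchel inequalities add up, and the integrals of \<open>f\<close>, \<open>g\<close> and
  \<open>C\<close> against the plan cancel.\<close>

lemma weak_duality:
  assumes \<alpha>: "\<alpha> \<in> pos_measures" and \<beta>: "\<beta> \<in> pos_measures"
    and f: "dual_feasible f" and g: "dual_feasible g"
  shows "ereal (dual \<alpha> \<beta> f g) \<le> OT \<epsilon> \<phi> C \<alpha> \<beta>"
  unfolding OT_def
proof (rule INF_greatest)
  fix \<pi> :: "('a \<times> 'a) measure" assume \<pi>: "\<pi> \<in> pos_measures"
  let ?P = "\<alpha> \<Otimes>\<^sub>M \<beta>"
  let ?c = "LINT z|\<pi>. C (fst z) (snd z)"
  let ?d1 = "enn2ereal (phi_divergence \<phi> (distr \<pi> borel fst) \<alpha>)"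
  let ?d2 = "enn2ereal (phi_divergence \<phi> (distr \<pi> borel snd) \<beta>)"
  have d0: "0 \<le> ?d1" "0 \<le> ?d2" by auto
  have P: "?P \<in> pos_measures" by (rule pair_measure_in_pos_measures[OF compact_X \<alpha> \<beta>])
  have fc: "continuous_on UNIV f" "continuous_on UNIV (\<lambda>x. cval (- f x))" "\<And>x. - f x \<in> cdom"
    and gc: "continuous_on UNIV g" "continuous_on UNIV (\<lambda>x. cval (- g x))" "\<And>x. - g x \<in> cdom"
    using f g by (auto simp: dual_feasible_def)
  show "ereal (dual \<alpha> \<beta> f g) \<le> ereal ?c + ?d1 + ?d2 + ereal \<epsilon> * KL \<pi> ?P"
  proof (cases "KL \<pi> ?P = \<infinity>")
    case True
    then have "ereal ?c + ?d1 + ?d2 + ereal \<epsilon> * KL \<pi> ?P = \<infinity>" using eps_pos d0 by simp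
    then show ?thesis by (simp only: ereal_less_eq(1))
  next
    case False
    then have ac: "absolutely_continuous ?P \<pi>" by (auto simp: KL_def split: if_splits)
    note mp = marginal_in_pos_measures[OF \<pi>] and ma = marginals_absolutely_continuous[OF \<alpha> \<beta> \<pi> ac]
    have int: "integrable \<pi> (\<lambda>z. f (fst z))" "integrable \<pi> (\<lambda>z. g (snd z))" "integrable \<pi> (\<lambda>z. C (fst z) (snd z))"
      using C_continuous
      by (auto intro!: integrable_continuous[OF compact_UNIV_prod[OF compact_X] \<pi>]
          continuous_on_comp_fst continuous_on_comp_snd fc gc simp: case_prod_beta')
    have fm: "f \<in> borel_measurable borel" "g \<in> borel_measurable borel"
      using fc gc by (auto intro: borel_measurable_continuous_onI)
    have 1: "ereal (- (LINT z|\<pi>. f (fst z)) - (LINT x|\<alpha>. cval (- f x))) \<le> ?d1"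
      using phi_divergence_ge[OF compact_X mp(1) \<alpha> ma(1) fc] mp(3) fm by (simp add: integral_distr)
    have 2: "ereal (- (LINT z|\<pi>. g (snd z)) - (LINT x|\<beta>. cval (- g x))) \<le> ?d2"
      using phi_divergence_ge[OF compact_X mp(2) \<beta> ma(2) gc] mp(4) fm by (simp add: integral_distr)
    \<comment> \<open>The exponent of the Gibbs density: with this test function the \<pi>-integral
      in \<open>KL_ge\<close> cancels the cost and the marginal terms.\<close>
    define w where "w z = (f (fst z) + g (snd z) - C (fst z) (snd z)) / \<epsilon>" for z
    have wc: "continuous_on UNIV w"
      unfolding w_def using C_continuous eps_pos continuous_on_comp_fst[OF fc(1)] continuous_on_comp_snd[OF gc(1)]
      by (intro continuous_intros) (auto simp: case_prod_beta')
    define k where "k = (LINT z|\<pi>. w z)" 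
    define E where "E = (LINT x|\<alpha>. LINT y|\<beta>. gibbs f g x y - 1)"
    have E: "(LINT z|?P. exp (w z) - 1) = E"
      using integral_pair_continuous[OF compact_X \<alpha> \<beta> continuous_gibbs_minus_1[OF fc(1) gc(1)]]
      by (simp add: E_def gibbs_def w_def)
    have "ereal (k - E) \<le> KL \<pi> ?P"
      using KL_ge[OF compact_UNIV_prod[OF compact_X] P \<pi> wc] by (simp add: E k_def)
    then have "ereal \<epsilon> * ereal (k - E) \<le> ereal \<epsilon> * KL \<pi> ?P"
      using eps_pos by (intro ereal_mult_left_mono) auto
    then have 3: "ereal (\<epsilon> * (k - E)) \<le> ereal \<epsilon> * KL \<pi> ?P" by simp
    have "\<epsilon> * k = (LINT z|\<pi>. \<epsilon> * w z)" by (simp add: k_def)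
    also have "\<dots> = (LINT z|\<pi>. f (fst z) + g (snd z) - C (fst z) (snd z))" using eps_pos by (simp add: w_def)
    also have "\<dots> = (LINT z|\<pi>. f (fst z)) + (LINT z|\<pi>. g (snd z)) - ?c" using int by simp
    finally have k: "\<epsilon> * k = (LINT z|\<pi>. f (fst z)) + (LINT z|\<pi>. g (snd z)) - ?c" .
    have "dual \<alpha> \<beta> f g = ?c + (- (LINT z|\<pi>. f (fst z)) - (LINT x|\<alpha>. cval (- f x)))
        + (- (LINT z|\<pi>. g (snd z)) - (LINT x|\<beta>. cval (- g x))) + \<epsilon> * (k - E)"
      by (simp add: dual_def E_def[symmetric] right_diff_distrib k)
    then have "ereal (dual \<alpha> \<beta> f g) = ereal ?c + ereal (- (LINT z|\<pi>. f (fst z)) - (LINT x|\<alpha>. cval (- f x)))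
        + ereal (- (LINT z|\<pi>. g (snd z)) - (LINT x|\<beta>. cval (- g x))) + ereal (\<epsilon> * (k - E))"
      by simp
    also have "\<dots> \<le> ereal ?c + ?d1 + ?d2 + ereal \<epsilon> * KL \<pi> ?P"
      by (intro add_mono order_refl 1 2 3)
    finally show ?thesis .
  qed
qed

lemma gibbs_bounded:
  assumes "continuous_on UNIV f" "continuous_on UNIV g"
  obtains S where "\<And>x y. gibbs f g x y \<le> S"
proof -
  have "bounded ((\<lambda>(x, y). gibbs f g x y) ` UNIV)"
    using compact_continuous_image[OF continuous_gibbs[OF assms] compact_UNIV_prod[OF compact_X]]
    by (rule compact_imp_bounded)
  then obtain S where "\<And>x y. \<bar>gibbs f g x y\<bar> \<le> S" by (auto simp: bounded_iff)
  then show thesis using that abs_le_D1 by blast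
qed

text \<open>At every value of a response the marginal density is a subgradient, and these densities
  are uniformly bounded; \<open>cval_lipschitz\<close> then transfers continuity from
  \<open>g\<close> to the composite.\<close>

lemma best_response_feasible:
  assumes \<alpha>: "\<alpha> \<in> nonzero_pos_measures" and f: "continuous_on UNIV f" and br: "best_response \<alpha> f g"
  shows "dual_feasible g"
proof -
  have \<alpha>p: "\<alpha> \<in> pos_measures" using \<alpha> by (simp add: nonzero_pos_measures_pos)
  have gc: "continuous_on UNIV g" by (rule best_response_continuous[OF assms])
  obtain S where S: "\<And>x y. gibbs f g x y \<le> S" using gibbs_bounded[OF f gc] by blast
  have "\<bar>LINT x|\<alpha>. gibbs f g x y\<bar> \<le> S * measure \<alpha> UNIV" for y
    using S gibbs_pos[of f g]
    by (intro abs_integral_le_const[OF \<alpha>p integrable_gibbs[OF \<alpha>p f]]) (simp add: abs_of_pos)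
  from cval_lipschitz[OF br[unfolded best_response_def, rule_format] br[unfolded best_response_def, rule_format] this this]
  have lip: "\<bar>cval (- g y) - cval (- g y')\<bar> \<le> S * measure \<alpha> UNIV * \<bar>- g y - - g y'\<bar>" for y y' .
  have "continuous_on UNIV (\<lambda>y. cval (- g y))"
    unfolding continuous_on_def
  proof
    fix y
    have "(g \<longlongrightarrow> g y) (at y)" using gc by (auto simp: continuous_on_def)
    then have "((\<lambda>y'. S * measure \<alpha> UNIV * \<bar>- g y' - - g y\<bar>) \<longlongrightarrow> S * measure \<alpha> UNIV * \<bar>- g y - - g y\<bar>) (at y)"
      by (intro tendsto_intros)
    then have "((\<lambda>y'. S * measure \<alpha> UNIV * \<bar>- g y' - - g y\<bar>) \<longlongrightarrow> 0) (at y)" by simp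
    from Lim_null_comparison[OF _ this, of "\<lambda>y'. cval (- g y') - cval (- g y)"] lip
    show "((\<lambda>y. cval (- g y)) \<longlongrightarrow> cval (- g y)) (at y)"
      by (simp add: LIM_zero_iff always_eventually)
  qed
  then show ?thesis using gc br by (auto simp: dual_feasible_def best_response_def dest: subd_cdom)
qed

lemma strong_duality:
  assumes \<alpha>: "\<alpha> \<in> nonzero_pos_measures" and \<beta>: "\<beta> \<in> nonzero_pos_measures"
    and c: "continuous_on UNIV f" "continuous_on UNIV g"
    and br: "best_response \<alpha> f g" "best_response \<beta> g f"
  shows "OT \<epsilon> \<phi> C \<alpha> \<beta> = ereal (dual \<alpha> \<beta> f g)"
proof (rule antisym)
  have \<alpha>p: "\<alpha> \<in> pos_measures" and \<beta>p: "\<beta> \<in> pos_measures"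
    using \<alpha> \<beta> by (auto simp: nonzero_pos_measures_pos)
  have feas: "dual_feasible f" "dual_feasible g"
    by (rule best_response_feasible[OF \<beta> c(2) br(2)], rule best_response_feasible[OF \<alpha> c(1) br(1)])
  then show "ereal (dual \<alpha> \<beta> f g) \<le> OT \<epsilon> \<phi> C \<alpha> \<beta>" by (intro weak_duality \<alpha>p \<beta>p)
  let ?P = "\<alpha> \<Otimes>\<^sub>M \<beta>"
  note a = pos_measuresD[OF \<alpha>p] and b = pos_measuresD[OF \<beta>p]
  interpret a: finite_measure \<alpha> by (rule a(1))
  interpret b: finite_measure \<beta> by (rule b(1))
  interpret P: pair_sigma_finite \<alpha> \<beta> ..
  have Pp: "?P \<in> pos_measures" by (rule pair_measure_in_pos_measures[OF compact_X \<alpha>p \<beta>p])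
  note p = pos_measuresD[OF Pp]
  interpret PP: finite_measure ?P by (rule p(1))
  define K where "K z = gibbs f g (fst z) (snd z)" for z
  define w where "w z = (f (fst z) + g (snd z) - C (fst z) (snd z)) / \<epsilon>" for z
  have K: "K z = exp (w z)" "0 \<le> K z" for z by (simp_all add: K_def w_def gibbs_def)
  have Cc: "continuous_on UNIV (\<lambda>z. C (fst z) (snd z))" using C_continuous by (simp add: case_prod_beta')
  have wc: "continuous_on UNIV w"
    unfolding w_def using Cc eps_pos continuous_on_comp_fst[OF c(1)] continuous_on_comp_snd[OF c(2)]
    by (intro continuous_intros) auto
  have Kc: "continuous_on UNIV K" using continuous_gibbs[OF c] by (simp add: K_def[abs_def] case_prod_beta')
  have Pint: "integrable ?P h" if "continuous_on UNIV h" for h :: "'a \<times> 'a \<Rightarrow> real"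
    by (rule integrable_continuous[OF compact_UNIV_prod[OF compact_X] Pp that])
  have Km: "K \<in> borel_measurable ?P" using Pint[OF Kc] by auto
  define \<pi> where "\<pi> = density ?P (\<lambda>z. ennreal (K z))"
  have mass: "emeasure \<pi> UNIV = ennreal (LINT z|?P. K z)"
    using Km nn_integral_eq_integral[OF Pint[OF Kc]] K(2) p by (simp add: \<pi>_def emeasure_density)
  have \<pi>: "\<pi> \<in> pos_measures"
    using mass p by (auto simp: pos_measures_def \<pi>_def intro!: finite_measureI)
  note q = pos_measuresD[OF \<pi>]
  have \<pi>int: "(LINT z|\<pi>. h z) = (LINT z|?P. K z * h z)" if "continuous_on UNIV h" for h :: "'a \<times> 'a \<Rightarrow> real"
    using Pint[OF that] Km K(2) unfolding \<pi>_def by (subst integral_density) auto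
  \<comment> \<open>The densities of the marginals of \<pi>. By the response conditions they are
    subgradients, the equality case for both divergences.\<close>
  define s1 where "s1 x = (LINT y|\<beta>. gibbs f g x y)" for x
  define s2 where "s2 y = (LINT x|\<alpha>. gibbs f g x y)" for y
  have s1: "s1 x \<in> subd (- f x)" "0 \<le> s1 x" for x
    using br(2) gibbs_pos[of f g, THEN less_imp_le] by (auto simp: best_response_swap s1_def)
  have s2: "s2 y \<in> subd (- g y)" "0 \<le> s2 y" for y
    using br(1) gibbs_pos[of f g, THEN less_imp_le] by (auto simp: best_response_def s2_def)
  have gc2: "continuous_on UNIV (\<lambda>(y, x). gibbs f g x y)"
    using continuous_gibbs[OF c(2,1)] by (simp add: gibbs_swap[of f g])
  have s1m: "s1 \<in> borel_measurable borel"
    using integrable_partial_integral[OF compact_X \<alpha>p \<beta>p continuous_gibbs[OF c], THEN borel_measurable_integrable]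
    by (simp add: s1_def[abs_def] measurable_pos_measures[OF \<alpha>p])
  have s2m: "s2 \<in> borel_measurable borel"
    using integrable_partial_integral[OF compact_X \<beta>p \<alpha>p gc2, THEN borel_measurable_integrable]
    by (simp add: s2_def[abs_def] measurable_pos_measures[OF \<beta>p])
  note mp = marginal_in_pos_measures[OF \<pi>]
  have m1: "density \<alpha> (\<lambda>x. ennreal (s1 x)) = distr \<pi> borel fst"
  proof (rule measure_eqI)
    fix A assume "A \<in> sets (density \<alpha> (\<lambda>x. ennreal (s1 x)))"
    then have A: "A \<in> sets borel" "A \<in> sets \<alpha>" using a by auto
    have T: "fst \<in> borel_measurable ?P" using mp(3) by (simp add: \<pi>_def)
    have "emeasure (distr \<pi> borel fst) A = (\<integral>\<^sup>+ z. ennreal (K z) * indicator A (fst z) \<partial>?P)"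
      unfolding \<pi>_def using Km T A(1) by (intro emeasure_distr_density) auto
    also have "\<dots> = (\<integral>\<^sup>+ x. \<integral>\<^sup>+ y. ennreal (K (x, y)) * indicator A x \<partial>\<beta> \<partial>\<alpha>)"
      using Km T A(1) by (subst b.nn_integral_fst[symmetric]) auto
    also have "\<dots> = (\<integral>\<^sup>+ x. ennreal (s1 x) * indicator A x \<partial>\<alpha>)"
    proof (rule nn_integral_cong)
      fix x
      have i: "integrable \<beta> (\<lambda>y. gibbs f g x y)" using integrable_gibbs[OF \<beta>p c(2)] by (simp add: gibbs_swap[of f g])
      have "(\<integral>\<^sup>+ y. ennreal (gibbs f g x y) \<partial>\<beta>) = ennreal (s1 x)"
        unfolding s1_def using gibbs_pos[of f g, THEN less_imp_le] by (intro nn_integral_eq_integral[OF i]) auto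
      then show "(\<integral>\<^sup>+ y. ennreal (K (x, y)) * indicator A x \<partial>\<beta>) = ennreal (s1 x) * indicator A x"
        using i by (simp add: K_def nn_integral_multc)
    qed
    also have "\<dots> = emeasure (density \<alpha> (\<lambda>x. ennreal (s1 x))) A"
      using A s1m by (subst emeasure_density) (auto simp: measurable_pos_measures[OF \<alpha>p])
    finally show "emeasure (density \<alpha> (\<lambda>x. ennreal (s1 x))) A = emeasure (distr \<pi> borel fst) A" by simp
  qed (simp add: a)
  have m2: "density \<beta> (\<lambda>y. ennreal (s2 y)) = distr \<pi> borel snd"
  proof (rule measure_eqI)
    fix A assume "A \<in> sets (density \<beta> (\<lambda>y. ennreal (s2 y)))"
    then have A: "A \<in> sets borel" "A \<in> sets \<beta>" using b by auto
    have T: "snd \<in> borel_measurable ?P" using mp(4) by (simp add: \<pi>_def)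
    have "emeasure (distr \<pi> borel snd) A = (\<integral>\<^sup>+ z. ennreal (K z) * indicator A (snd z) \<partial>?P)"
      unfolding \<pi>_def using Km T A(1) by (intro emeasure_distr_density) auto
    also have "\<dots> = (\<integral>\<^sup>+ y. \<integral>\<^sup>+ x. ennreal (K (x, y)) * indicator A y \<partial>\<alpha> \<partial>\<beta>)"
      using Km T A(1) by (subst P.nn_integral_snd[symmetric]) auto
    also have "\<dots> = (\<integral>\<^sup>+ y. ennreal (s2 y) * indicator A y \<partial>\<beta>)"
    proof (rule nn_integral_cong)
      fix y
      have i: "integrable \<alpha> (\<lambda>x. gibbs f g x y)" by (rule integrable_gibbs[OF \<alpha>p c(1)])
      have "(\<integral>\<^sup>+ x. ennreal (gibbs f g x y) \<partial>\<alpha>) = ennreal (s2 y)"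
        unfolding s2_def using gibbs_pos[of f g, THEN less_imp_le] by (intro nn_integral_eq_integral[OF i]) auto
      then show "(\<integral>\<^sup>+ x. ennreal (K (x, y)) * indicator A y \<partial>\<alpha>) = ennreal (s2 y) * indicator A y"
        using i by (simp add: K_def nn_integral_multc)
    qed
    also have "\<dots> = emeasure (density \<beta> (\<lambda>y. ennreal (s2 y))) A"
      using A s2m by (subst emeasure_density) (auto simp: measurable_pos_measures[OF \<beta>p])
    finally show "emeasure (density \<beta> (\<lambda>y. ennreal (s2 y))) A = emeasure (distr \<pi> borel snd) A" by simp
  qed (simp add: b)
  have Kf: "continuous_on UNIV (\<lambda>(x, y). f x * gibbs f g x y)" "continuous_on UNIV (\<lambda>(x, y). g y * gibbs f g x y)"
    using Kc continuous_on_comp_fst[OF c(1)] continuous_on_comp_snd[OF c(2)]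
    by (auto simp: K_def[abs_def] case_prod_beta' intro!: continuous_intros)
  have "continuous_on UNIV (\<lambda>z :: 'a \<times> 'a. g (fst z) * gibbs g f (fst z) (snd z))"
    using continuous_gibbs[OF c(2,1)] continuous_on_comp_fst[OF c(2)]
    by (auto simp: case_prod_beta' intro!: continuous_intros)
  then have Kg: "continuous_on UNIV (\<lambda>(y, x). g y * gibbs f g x y)"
    by (simp add: case_prod_beta' gibbs_swap[of f g])
  have i1: "integrable \<alpha> (\<lambda>x. s1 x * f x)"
    and v1: "(LINT x|\<alpha>. s1 x * f x) = (LINT z|?P. K z * f (fst z))"
    using integrable_partial_integral[OF compact_X \<alpha>p \<beta>p Kf(1)] integral_pair_continuous[OF compact_X \<alpha>p \<beta>p Kf(1)]
    by (simp_all add: s1_def[abs_def] K_def mult.commute)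
  have i2: "integrable \<beta> (\<lambda>y. s2 y * g y)"
    and v2: "(LINT y|\<beta>. s2 y * g y) = (LINT z|?P. K z * g (snd z))"
    using integrable_partial_integral[OF compact_X \<beta>p \<alpha>p Kg] integral_pair_continuous[OF compact_X \<alpha>p \<beta>p Kf(2)]
      integral_swap[OF compact_X \<alpha>p \<beta>p Kf(2)]
    by (simp_all add: s2_def[abs_def] K_def mult.commute)
  have cv: "integrable \<alpha> (\<lambda>x. cval (- f x))" "integrable \<beta> (\<lambda>x. cval (- g x))"
    using feas by (auto simp: dual_feasible_def intro: integrable_continuous[OF compact_X] \<alpha>p \<beta>p)
  have d1: "enn2ereal (phi_divergence \<phi> (distr \<pi> borel fst) \<alpha>)
      = ereal (- (LINT z|?P. K z * f (fst z)) - (LINT x|\<alpha>. cval (- f x)))"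
    using phi_divergence_eq[OF \<alpha>p s1m s1(2) m1 s1(1) i1 cv(1)] by (simp add: v1)
  have d2: "enn2ereal (phi_divergence \<phi> (distr \<pi> borel snd) \<beta>)
      = ereal (- (LINT z|?P. K z * g (snd z)) - (LINT x|\<beta>. cval (- g x)))"
    using phi_divergence_eq[OF \<beta>p s2m s2(2) m2 s2(1) i2 cv(2)] by (simp add: v2)
  have ac: "absolutely_continuous ?P \<pi>"
    unfolding \<pi>_def using Km by (intro absolutely_continuousI_density) auto
  \<comment> \<open>\<open>RN_deriv\<close> is determined almost everywhere only. \<open>K\<close>
    is a version of it, so \<open>w\<close> may replace its logarithm under the
    \<pi>-integral.\<close>
  have "AE z in ?P. ennreal (K z) = RN_deriv ?P \<pi> z"
    unfolding \<pi>_def using Km by (intro sigma_finite_measure.RN_deriv_unique[OF finite_measure.axioms(1)[OF p(1)]]) auto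
  then have "AE z in \<pi>. ennreal (K z) = RN_deriv ?P \<pi> z"
    using absolutely_continuous_AE[OF _ ac] by (simp add: \<pi>_def)
  then have ae: "AE z in \<pi>. w z = ln (enn2real (RN_deriv ?P \<pi> z))"
    by eventually_elim (metis K ln_exp enn2real_ennreal)
  have wi: "integrable \<pi> w" by (rule integrable_continuous[OF compact_UNIV_prod[OF compact_X] \<pi> wc])
  have RNm: "(\<lambda>z. ln (enn2real (RN_deriv ?P \<pi> z))) \<in> borel_measurable \<pi>"
    by (simp add: \<pi>_def)
  have li: "integrable \<pi> (\<lambda>z. ln (enn2real (RN_deriv ?P \<pi> z)))"
    by (rule integrable_cong_AE_imp[OF wi RNm]) (use ae in eventually_elim, simp)
  have lv: "(LINT z|\<pi>. ln (enn2real (RN_deriv ?P \<pi> z))) = (LINT z|?P. K z * w z)"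
    using integral_cong_AE[OF _ RNm ae] wi \<pi>int[OF wc] by (simp add: borel_measurable_integrable)
  have "measure \<pi> UNIV = (LINT z|?P. K z)"
    unfolding measure_def mass by (intro enn2real_ennreal Bochner_Integration.integral_nonneg K)
  then have KL: "KL \<pi> ?P = ereal ((LINT z|?P. K z * w z) - (LINT z|?P. K z) + measure ?P UNIV)"
    using ac li by (simp add: KL_def lv q p)
  have E: "(LINT x|\<alpha>. LINT y|\<beta>. gibbs f g x y - 1) = (LINT z|?P. K z) - measure ?P UNIV"
    using integral_pair_continuous[OF compact_X \<alpha>p \<beta>p continuous_gibbs_minus_1[OF c]] Pint[OF Kc]
    by (simp add: K_def[symmetric] p)
  have ints: "integrable ?P (\<lambda>z. K z * f (fst z))" "integrable ?P (\<lambda>z. K z * g (snd z))"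
    "integrable ?P (\<lambda>z. K z * C (fst z) (snd z))"
    by (intro Pint continuous_intros Kc continuous_on_comp_fst[OF c(1)] continuous_on_comp_snd[OF c(2)] Cc)+
  \<comment> \<open>The entropy of \<pi> contains minus its transport cost, and the two cancel in
    the primal objective.\<close>
  have "\<epsilon> * (LINT z|?P. K z * w z) = (LINT z|?P. K z * f (fst z) + K z * g (snd z) - K z * C (fst z) (snd z))"
    unfolding integral_mult_right_zero[symmetric]
    by (intro Bochner_Integration.integral_cong refl) (use eps_pos in \<open>simp add: w_def field_simps\<close>)
  also have "\<dots> = (LINT z|?P. K z * f (fst z)) + (LINT z|?P. K z * g (snd z)) - (LINT z|?P. K z * C (fst z) (snd z))"
    using ints by simp
  finally have ew: "\<epsilon> * (LINT z|?P. K z * w z) = (LINT z|?P. K z * f (fst z)) + (LINT z|?P. K z * g (snd z)) - (LINT z|?P. K z * C (fst z) (snd z))" .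
  have "OT \<epsilon> \<phi> C \<alpha> \<beta> \<le> ereal (LINT z|\<pi>. C (fst z) (snd z))
        + enn2ereal (phi_divergence \<phi> (distr \<pi> borel fst) \<alpha>)
        + enn2ereal (phi_divergence \<phi> (distr \<pi> borel snd) \<beta>)
        + ereal \<epsilon> * KL \<pi> ?P"
    unfolding OT_def by (rule INF_lower[OF \<pi>])
  also have "\<dots> = ereal (dual \<alpha> \<beta> f g)"
    unfolding d1 d2 KL \<pi>int[OF Cc] by (simp add: dual_def E right_diff_distrib distrib_left ew)
  finally show "OT \<epsilon> \<phi> C \<alpha> \<beta> \<le> ereal (dual \<alpha> \<beta> f g)" .
qed

end

section \<open>Perturbation by signed measures\<close>

text \<open>The relation is kept as an equality of sums with a nonnegative factor, so the induction
  over measurable functions stays in \<open>ennreal\<close> without subtraction.\<close>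

lemma nn_integral_eq_of_emeasure_eq:
  assumes sets: "sets M1 = sets borel" "sets M2 = sets borel" "sets M3 = sets borel" "sets M4 = sets borel"
    and eq: "\<And>A. A \<in> sets borel \<Longrightarrow> emeasure M1 A + a * emeasure M2 A = emeasure M3 A + a * emeasure M4 A"
    and u: "u \<in> borel_measurable borel"
  shows "integral\<^sup>N M1 u + a * integral\<^sup>N M2 u = integral\<^sup>N M3 u + a * integral\<^sup>N M4 u"
proof -
  note ms = measurable_cong_sets[OF sets(1) refl] measurable_cong_sets[OF sets(2) refl]
    measurable_cong_sets[OF sets(3) refl] measurable_cong_sets[OF sets(4) refl]
  show ?thesis
    using u
  proof (induction rule: borel_measurable_induct)
    case (cong f g)
    then have "f = g" by (auto simp: fun_eq_iff)
    with cong show ?case by simp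
  next
    case (set A)
    then show ?case using eq sets by simp
  next
    case (mult u c)
    have "c * (integral\<^sup>N M1 u + a * integral\<^sup>N M2 u) = c * (integral\<^sup>N M3 u + a * integral\<^sup>N M4 u)"
      using mult by simp
    then show ?case using mult(2) by (simp add: nn_integral_cmult ms distrib_left mult.left_commute)
  next
    case (add u v)
    have "(integral\<^sup>N M1 u + a * integral\<^sup>N M2 u) + (integral\<^sup>N M1 v + a * integral\<^sup>N M2 v) =
       (integral\<^sup>N M3 u + a * integral\<^sup>N M4 u) + (integral\<^sup>N M3 v + a * integral\<^sup>N M4 v)"
      using add by simp
    then show ?case using add by (simp add: nn_integral_add ms distrib_left ac_simps)
  next
    case (seq U)
    have inc: "incseq (\<lambda>i. integral\<^sup>N M (U i))" "incseq (\<lambda>i. a * integral\<^sup>N M (U i))" for M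
      using seq(3) by (auto simp: incseq_def le_fun_def intro!: nn_integral_mono mult_left_mono)
    have "(SUP i. U i) = (\<lambda>x. SUP i. U i x)" by (rule ext) (rule SUP_apply)
    then have S: "integral\<^sup>N M (SUP i. U i) = (SUP i. integral\<^sup>N M (U i))" if "\<And>i. U i \<in> borel_measurable M" for M
      using nn_integral_monotone_convergence_SUP[OF seq(3) that] by simp
    have "(SUP i. integral\<^sup>N M (U i)) + a * (SUP i. integral\<^sup>N N (U i)) =
        (SUP i. integral\<^sup>N M (U i) + a * integral\<^sup>N N (U i))" for M N
      unfolding SUP_mult_left_ennreal by (rule ennreal_SUP_add[OF inc, symmetric])
    moreover have "U i \<in> borel_measurable M1" "U i \<in> borel_measurable M2"
      "U i \<in> borel_measurable M3" "U i \<in> borel_measurable M4" for i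
      using seq(1) by (simp_all add: ms)
    ultimately show ?case by (simp only: S seq.IH)
  qed
qed

lemma integral_eq_of_measure_eq:
  fixes h :: "'a::topological_space \<Rightarrow> real"
  assumes M: "M1 \<in> pos_measures" "M2 \<in> pos_measures" "M3 \<in> pos_measures" "M4 \<in> pos_measures"
    and a: "0 \<le> a"
    and eq: "\<And>A. A \<in> sets borel \<Longrightarrow> measure M1 A + a * measure M2 A = measure M3 A + a * measure M4 A"
    and int: "integrable M1 h" "integrable M2 h" "integrable M3 h" "integrable M4 h"
  shows "(LINT x|M1. h x) + a * (LINT x|M2. h x) = (LINT x|M3. h x) + a * (LINT x|M4. h x)"
proof -
  have em: "emeasure M1 A + ennreal a * emeasure M2 A = emeasure M3 A + ennreal a * emeasure M4 A"
    if "A \<in> sets borel" for A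
    using eq[OF that] a M[THEN pos_measuresD(1), THEN finite_measure.emeasure_eq_measure]
    by (simp add: ennreal_mult[symmetric] ennreal_plus[symmetric] del: ennreal_plus)
  have hm: "h \<in> borel_measurable borel"
    using int(1) measurable_pos_measures[OF M(1)] by (auto dest: borel_measurable_integrable)
  have *: "enn2real (\<integral>\<^sup>+x. ennreal (k x) \<partial>M1) + a * enn2real (\<integral>\<^sup>+x. ennreal (k x) \<partial>M2)
      = enn2real (\<integral>\<^sup>+x. ennreal (k x) \<partial>M3) + a * enn2real (\<integral>\<^sup>+x. ennreal (k x) \<partial>M4)"
    if k: "k \<in> borel_measurable borel" "integrable M1 k" "integrable M2 k" "integrable M3 k" "integrable M4 k"
    for k :: "'a \<Rightarrow> real"
  proof -
    have fin: "(\<integral>\<^sup>+x. ennreal (k x) \<partial>M) < top" if "integrable M k" for M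
    proof -
      have "(\<integral>\<^sup>+x. ennreal (k x) \<partial>M) \<le> (\<integral>\<^sup>+x. ennreal (norm (k x)) \<partial>M)"
        by (intro nn_integral_mono ennreal_leI) simp
      also have "\<dots> < top" using that by (simp add: integrable_iff_bounded)
      finally show ?thesis .
    qed
    have "(\<integral>\<^sup>+x. ennreal (k x) \<partial>M1) + ennreal a * (\<integral>\<^sup>+x. ennreal (k x) \<partial>M2)
      = (\<integral>\<^sup>+x. ennreal (k x) \<partial>M3) + ennreal a * (\<integral>\<^sup>+x. ennreal (k x) \<partial>M4)"
      using k(1) M[THEN pos_measuresD(2)] em by (intro nn_integral_eq_of_emeasure_eq) auto
    from arg_cong[OF this, of enn2real] show ?thesis
      using fin[OF k(2)] fin[OF k(3)] fin[OF k(4)] fin[OF k(5)] a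
      by (simp add: enn2real_plus enn2real_mult ennreal_mult_less_top)
  qed
  from *[OF hm int] *[of "\<lambda>x. - h x"] hm int show ?thesis
    by (simp add: real_lebesgue_integral_def right_diff_distrib)
qed

text \<open>\<open>measure_of\<close> falls back to a null measure unless positivity and countable
  additivity hold; \<open>perturb\<close> and \<open>upper_variation\<close> both get their intended
  values through this check.\<close>

lemma measure_of_signed_measure:
  fixes \<kappa> :: "'a::topological_space set \<Rightarrow> real"
  assumes \<kappa>: "signed_measure \<kappa>" and nonneg: "\<And>A. A \<in> sets borel \<Longrightarrow> 0 \<le> \<kappa> A"
    and F: "\<And>A. A \<in> sets borel \<Longrightarrow> F A = ennreal (\<kappa> A)"
  shows "measure_of UNIV (sets borel) F \<in> pos_measures"
    and "\<And>A. A \<in> sets borel \<Longrightarrow> measure (measure_of UNIV (sets borel) F) A = \<kappa> A"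
proof -
  let ?M = "measure_of UNIV (sets borel) F"
  have sets: "sets ?M = sets (borel :: 'a measure)"
    using sets.sigma_sets_eq[of "borel :: 'a measure"] by (simp add: sets_measure_of)
  have space: "space ?M = UNIV" using sets_eq_imp_space_eq[OF sets] by simp
  have "positive (sets ?M) F" using \<kappa> F[of "{}"] by (simp add: positive_def signed_measure_def)
  moreover have "countably_additive (sets ?M) F"
  proof (rule countably_additiveI)
    fix A :: "nat \<Rightarrow> 'a set" assume A: "range A \<subseteq> sets ?M" "disjoint_family A" "(\<Union>i. A i) \<in> sets ?M"
    have Ai: "A i \<in> sets borel" for i using A(1) sets by auto
    have "(\<lambda>i. \<kappa> (A i)) sums \<kappa> (\<Union>i. A i)"
      using \<kappa> A(1,2) by (simp add: signed_measure_def sets)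
    then have "(\<Sum>i. ennreal (\<kappa> (A i))) = ennreal (\<kappa> (\<Union>i. A i))"
      using nonneg[OF Ai] by (intro suminf_ennreal_eq)
    then show "(\<Sum>i. F (A i)) = F (\<Union>i. A i)" using F Ai A(3) by (simp add: sets)
  qed
  ultimately have em: "emeasure ?M A = ennreal (\<kappa> A)" if "A \<in> sets borel" for A
    using emeasure_measure_of[OF refl, of "sets borel" UNIV F A] that F sets by simp
  then show "measure ?M A = \<kappa> A" if "A \<in> sets borel" for A
    using that nonneg by (simp add: measure_def)
  show "?M \<in> pos_measures"
    using sets space em[of UNIV] by (auto simp: pos_measures_def intro!: finite_measureI)
qed

lemma signed_measure_perturb:
  assumes \<alpha>: "\<alpha> \<in> pos_measures" and \<sigma>: "signed_measure \<sigma>"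
  shows "signed_measure (\<lambda>A. measure \<alpha> A + t * \<sigma> A)"
  unfolding signed_measure_def
proof (intro conjI allI impI)
  interpret finite_measure \<alpha> by (rule pos_measuresD(1)[OF \<alpha>])
  show "measure \<alpha> {} + t * \<sigma> {} = 0" using \<sigma> by (simp add: signed_measure_def)
  fix A :: "nat \<Rightarrow> 'a set" assume A: "range A \<subseteq> sets borel" "disjoint_family A"
  then show "(\<lambda>n. measure \<alpha> (A n) + t * \<sigma> (A n)) sums (measure \<alpha> (\<Union>n. A n) + t * \<sigma> (\<Union>n. A n))"
    using \<sigma> pos_measuresD(2)[OF \<alpha>]
    by (intro sums_add sums_mult finite_measure_UNION) (auto simp: signed_measure_def)
qed

lemma perturb_measure:
  assumes \<alpha>: "\<alpha> \<in> pos_measures" and \<sigma>: "signed_measure \<sigma>" and t: "t \<in> perturb_times \<alpha> \<sigma>"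
  shows "perturb \<alpha> t \<sigma> \<in> pos_measures"
    and "\<And>A. A \<in> sets borel \<Longrightarrow> measure (perturb \<alpha> t \<sigma>) A = measure \<alpha> A + t * \<sigma> A"
  using measure_of_signed_measure[OF signed_measure_perturb[OF \<alpha> \<sigma>, of t], of "\<lambda>A. ennreal (measure \<alpha> A + t * \<sigma> A)"] t
  by (auto simp: perturb_def perturb_times_def)

section \<open>Jordan decomposition\<close>

lemma signed_measure_restrict:
  assumes \<sigma>: "signed_measure \<sigma>" and P: "P \<in> sets borel"
  shows "signed_measure (\<lambda>A. \<sigma> (A \<inter> P))"
  unfolding signed_measure_def
proof (intro conjI allI impI)
  show "\<sigma> ({} \<inter> P) = 0" using \<sigma> by (simp add: signed_measure_def)
  fix A :: "nat \<Rightarrow> 'a set" assume A: "range A \<subseteq> sets borel" "disjoint_family A"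
  have "(\<lambda>n. \<sigma> (A n \<inter> P)) sums \<sigma> (\<Union>n. A n \<inter> P)"
  proof -
    have "range (\<lambda>n. A n \<inter> P) \<subseteq> sets borel" using A(1) P by auto
    moreover have "disjoint_family (\<lambda>n. A n \<inter> P)" using A(2) unfolding disjoint_family_on_def by blast
    ultimately show ?thesis using \<sigma> unfolding signed_measure_def by blast
  qed
  then show "(\<lambda>n. \<sigma> (A n \<inter> P)) sums \<sigma> ((\<Union>n. A n) \<inter> P)" by simp
qed

lemma signed_measure_Un:
  assumes \<sigma>: "signed_measure \<sigma>" and A: "A \<in> sets borel" "B \<in> sets borel" "A \<inter> B = {}"
  shows "\<sigma> (A \<union> B) = \<sigma> A + \<sigma> B"
proof -
  have "range (binaryset A B) \<subseteq> sets borel" using A by (auto simp: range_binaryset_eq)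
  moreover have "disjoint_family (binaryset A B)" using A(3)
    unfolding disjoint_family_on_def binaryset_def by (simp add: Int_commute)
  ultimately have "(\<lambda>n. \<sigma> (binaryset A B n)) sums \<sigma> (\<Union>n. binaryset A B n)"
    using \<sigma> by (simp add: signed_measure_def)
  moreover have "(\<lambda>n. \<sigma> (binaryset A B n)) sums (\<sigma> A + \<sigma> B)"
    using \<sigma> by (intro binaryset_sums) (simp add: signed_measure_def)
  ultimately show ?thesis by (simp add: UN_binaryset_eq sums_unique2)
qed

lemma signed_measure_uminus: "signed_measure \<sigma> \<Longrightarrow> signed_measure (\<lambda>A. - \<sigma> A)"
  by (simp add: signed_measure_def sums_minus)

text \<open>The supremum is attained at \<open>A \<inter> P\<close>: passing from \<open>B\<close>
  to \<open>B \<inter> P\<close> drops a nonpositive part, and enlarging to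
  \<open>A \<inter> P\<close> adds a nonnegative one.\<close>

lemma upper_variation_hahn:
  fixes \<sigma> :: "'a::topological_space set \<Rightarrow> real"
  assumes \<sigma>: "signed_measure \<sigma>" and P: "P \<in> sets borel"
    and pos: "\<And>A. A \<in> sets borel \<Longrightarrow> A \<subseteq> P \<Longrightarrow> 0 \<le> \<sigma> A"
    and neg: "\<And>A. A \<in> sets borel \<Longrightarrow> A \<inter> P = {} \<Longrightarrow> \<sigma> A \<le> 0"
  shows "upper_variation \<sigma> \<in> pos_measures"
    and "\<And>A. A \<in> sets borel \<Longrightarrow> measure (upper_variation \<sigma>) A = \<sigma> (A \<inter> P)"
proof -
  have eq: "(SUP B\<in>{B \<in> sets borel. B \<subseteq> A}. ennreal (\<sigma> B)) = ennreal (\<sigma> (A \<inter> P))"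
    if A: "A \<in> sets borel" for A
  proof (rule antisym)
    show "(SUP B\<in>{B \<in> sets borel. B \<subseteq> A}. ennreal (\<sigma> B)) \<le> ennreal (\<sigma> (A \<inter> P))"
    proof (rule SUP_least)
      fix B assume "B \<in> {B \<in> sets borel. B \<subseteq> A}"
      then have B: "B \<in> sets borel" "B \<subseteq> A" by auto
      have "\<sigma> ((B \<inter> P) \<union> (B - P)) = \<sigma> (B \<inter> P) + \<sigma> (B - P)"
        using B P by (intro signed_measure_Un[OF \<sigma>]) auto
      moreover have "(B \<inter> P) \<union> (B - P) = B" by auto
      moreover have "\<sigma> (B - P) \<le> 0" using B P by (intro neg) auto
      moreover have "\<sigma> ((B \<inter> P) \<union> ((A - B) \<inter> P)) = \<sigma> (B \<inter> P) + \<sigma> ((A - B) \<inter> P)"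
        using A B P by (intro signed_measure_Un[OF \<sigma>]) auto
      moreover have "(B \<inter> P) \<union> ((A - B) \<inter> P) = A \<inter> P" using B by auto
      moreover have "0 \<le> \<sigma> ((A - B) \<inter> P)" using A B P by (intro pos) auto
      ultimately show "ennreal (\<sigma> B) \<le> ennreal (\<sigma> (A \<inter> P))" by (intro ennreal_leI) simp
    qed
    show "ennreal (\<sigma> (A \<inter> P)) \<le> (SUP B\<in>{B \<in> sets borel. B \<subseteq> A}. ennreal (\<sigma> B))"
      using A P by (intro SUP_upper) auto
  qed
  have nn: "0 \<le> \<sigma> (A \<inter> P)" if "A \<in> sets borel" for A using that P by (intro pos) auto
  note m = measure_of_signed_measure[OF signed_measure_restrict[OF \<sigma> P] nn eq]
  show "upper_variation \<sigma> \<in> pos_measures"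
    unfolding upper_variation_def by (rule m(1))
  show "measure (upper_variation \<sigma>) A = \<sigma> (A \<inter> P)" if "A \<in> sets borel" for A
    unfolding upper_variation_def by (rule m(2)[OF _ _ that])
qed

text \<open>
  A signed measure \<open>\<sigma>\<close> that perturbs \<open>\<alpha>\<close> for some \<open>t \<noteq> 0\<close> is a multiple of the difference
  \<open>(\<alpha> + t \<sigma>) - \<alpha>\<close> of finite measures, so the Hahn decomposition for two measures applies.
\<close>

lemma jordan_decomposition:
  assumes \<alpha>: "\<alpha> \<in> pos_measures" and \<sigma>: "signed_measure \<sigma>"
    and t: "t \<in> perturb_times \<alpha> \<sigma>" "t \<noteq> 0"
  shows "upper_variation \<sigma> \<in> pos_measures" and "upper_variation (\<lambda>A. - \<sigma> A) \<in> pos_measures"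
    and "\<And>A. A \<in> sets borel \<Longrightarrow>
      \<sigma> A = measure (upper_variation \<sigma>) A - measure (upper_variation (\<lambda>A. - \<sigma> A)) A"
proof -
  note pt = perturb_measure[OF \<alpha> \<sigma> t(1)]
  note a = pos_measuresD[OF \<alpha>] and b = pos_measuresD[OF pt(1)]
  obtain Y where Y: "Y \<in> sets borel"
    "\<And>A. A \<in> sets borel \<Longrightarrow> A \<subseteq> Y \<Longrightarrow> emeasure \<alpha> A \<le> emeasure (perturb \<alpha> t \<sigma>) A"
    "\<And>A. A \<in> sets borel \<Longrightarrow> A \<inter> Y = {} \<Longrightarrow> emeasure (perturb \<alpha> t \<sigma>) A \<le> emeasure \<alpha> A"
    using finite_unsigned_Hahn_decomposition[OF b(1) a(1)] a(2) b(2) by auto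
  have Y': "0 \<le> t * \<sigma> A" if "A \<in> sets borel" "A \<subseteq> Y" for A
  proof -
    have "measure \<alpha> A \<le> measure (perturb \<alpha> t \<sigma>) A"
      using Y(2)[OF that]
      by (simp add: finite_measure.emeasure_eq_measure[OF a(1)] finite_measure.emeasure_eq_measure[OF b(1)])
    with pt(2)[OF that(1)] show ?thesis by simp
  qed
  have Y'': "t * \<sigma> A \<le> 0" if "A \<in> sets borel" "A \<inter> Y = {}" for A
  proof -
    have "measure (perturb \<alpha> t \<sigma>) A \<le> measure \<alpha> A"
      using Y(3)[OF that]
      by (simp add: finite_measure.emeasure_eq_measure[OF a(1)] finite_measure.emeasure_eq_measure[OF b(1)])
    with pt(2)[OF that(1)] show ?thesis by simp
  qed
  have "\<exists>P\<in>sets borel. (\<forall>A\<in>sets borel. A \<subseteq> P \<longrightarrow> 0 \<le> \<sigma> A) \<and> (\<forall>A\<in>sets borel. A \<inter> P = {} \<longrightarrow> \<sigma> A \<le> 0)"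
  proof (cases "0 < t")
    case True
    then show ?thesis
      using Y(1) Y' Y'' by (intro bexI[of _ Y]) (simp_all add: zero_le_mult_iff mult_le_0_iff)
  next
    case False
    \<comment> \<open>Dividing by a negative \<open>t\<close> reverses the signs, so the complement
      of \<open>Y\<close> becomes the positive set.\<close>
    with t(2) have "t < 0" by simp
    then show ?thesis
      using Y(1) Y' Y'' by (intro bexI[of _ "- Y"]) (simp_all add: zero_le_mult_iff mult_le_0_iff disjoint_eq_subset_Compl)
  qed
  then obtain P where "P \<in> sets borel" "\<forall>A\<in>sets borel. A \<subseteq> P \<longrightarrow> 0 \<le> \<sigma> A"
    "\<forall>A\<in>sets borel. A \<inter> P = {} \<longrightarrow> \<sigma> A \<le> 0" by (elim bexE conjE)
  then have P: "P \<in> sets borel" "\<And>A. A \<in> sets borel \<Longrightarrow> A \<subseteq> P \<Longrightarrow> 0 \<le> \<sigma> A"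
    "\<And>A. A \<in> sets borel \<Longrightarrow> A \<inter> P = {} \<Longrightarrow> \<sigma> A \<le> 0" by simp_all
  have u1: "upper_variation \<sigma> \<in> pos_measures"
    "\<And>A. A \<in> sets borel \<Longrightarrow> measure (upper_variation \<sigma>) A = \<sigma> (A \<inter> P)"
    by (rule upper_variation_hahn[OF \<sigma> P(1)]; simp add: P)+
  have P': "- P \<in> sets borel" "\<And>A. A \<in> sets borel \<Longrightarrow> A \<subseteq> - P \<Longrightarrow> 0 \<le> - \<sigma> A"
    "\<And>A. A \<in> sets borel \<Longrightarrow> A \<inter> - P = {} \<Longrightarrow> - \<sigma> A \<le> 0"
    using P by (simp_all add: disjoint_eq_subset_Compl)
  have u2: "upper_variation (\<lambda>A. - \<sigma> A) \<in> pos_measures"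
    "\<And>A. A \<in> sets borel \<Longrightarrow> measure (upper_variation (\<lambda>A. - \<sigma> A)) A = - \<sigma> (A \<inter> - P)"
    by (rule upper_variation_hahn[OF signed_measure_uminus[OF \<sigma>] P'(1)]; use P' in simp)+
  show "upper_variation \<sigma> \<in> pos_measures" by (rule u1(1))
  show "upper_variation (\<lambda>A. - \<sigma> A) \<in> pos_measures" by (rule u2(1))
  fix A :: "'a set" assume A: "A \<in> sets borel"
  have "\<sigma> ((A \<inter> P) \<union> (A \<inter> - P)) = \<sigma> (A \<inter> P) + \<sigma> (A \<inter> - P)"
    using A P by (intro signed_measure_Un[OF \<sigma>]) auto
  moreover have "(A \<inter> P) \<union> (A \<inter> - P) = A" by auto
  ultimately show "\<sigma> A = measure (upper_variation \<sigma>) A - measure (upper_variation (\<lambda>A. - \<sigma> A)) A"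
    using u1(2)[OF A] u2(2)[OF A] by simp
qed

text \<open>A nonzero admissible time ensures that both variations are finite measures. Without one
  the filter of the expansion is trivial, and that case is settled separately.\<close>

locale perturbation =
  fixes \<alpha> :: "'a::topological_space measure" and \<sigma> :: "'a set \<Rightarrow> real"
  assumes \<alpha>: "\<alpha> \<in> pos_measures" and \<sigma>: "signed_measure \<sigma>"
    and nontrivial: "\<exists>t\<in>perturb_times \<alpha> \<sigma>. t \<noteq> 0"
begin

lemma jordan:
  shows "upper_variation \<sigma> \<in> pos_measures" and "upper_variation (\<lambda>A. - \<sigma> A) \<in> pos_measures"
    and "\<And>A. A \<in> sets borel \<Longrightarrow>
      \<sigma> A = measure (upper_variation \<sigma>) A - measure (upper_variation (\<lambda>A. - \<sigma> A)) A"
  using nontrivial jordan_decomposition[OF \<alpha> \<sigma>] by blast+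

definition total_variation :: real where
  "total_variation = measure (upper_variation \<sigma>) UNIV + measure (upper_variation (\<lambda>A. - \<sigma> A)) UNIV"

text \<open>The sign of \<open>t\<close> decides which Jordan part is moved to the other side, so
  that \<open>integral_eq_of_measure_eq\<close> is used with a nonnegative factor, \<open>t\<close>
  or \<open>- t\<close>.\<close>

lemma integral_perturb:
  fixes h :: "'a \<Rightarrow> real"
  assumes t: "t \<in> perturb_times \<alpha> \<sigma>" and int: "\<And>\<mu>. \<mu> \<in> pos_measures \<Longrightarrow> integrable \<mu> h"
  shows "(LINT x|perturb \<alpha> t \<sigma>. h x) = (LINT x|\<alpha>. h x) + t * signed_integral \<sigma> h"
proof -
  note pt = perturb_measure[OF \<alpha> \<sigma> t]
  show ?thesis
  proof (cases "0 \<le> t")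
    case True
    have "(LINT x|perturb \<alpha> t \<sigma>. h x) + t * (LINT x|upper_variation (\<lambda>A. - \<sigma> A). h x)
        = (LINT x|\<alpha>. h x) + t * (LINT x|upper_variation \<sigma>. h x)"
    proof (rule integral_eq_of_measure_eq)
      fix A :: "'a set" assume A: "A \<in> sets borel"
      show "measure (perturb \<alpha> t \<sigma>) A + t * measure (upper_variation (\<lambda>A. - \<sigma> A)) A
        = measure \<alpha> A + t * measure (upper_variation \<sigma>) A"
        using pt(2)[OF A] jordan(3)[OF A] by (simp add: right_diff_distrib)
    qed (use True pt jordan \<alpha> int in auto)
    then show ?thesis by (simp add: signed_integral_def right_diff_distrib)
  next
    case False
    have "(LINT x|perturb \<alpha> t \<sigma>. h x) + (- t) * (LINT x|upper_variation \<sigma>. h x)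
        = (LINT x|\<alpha>. h x) + (- t) * (LINT x|upper_variation (\<lambda>A. - \<sigma> A). h x)"
    proof (rule integral_eq_of_measure_eq)
      fix A :: "'a set" assume A: "A \<in> sets borel"
      show "measure (perturb \<alpha> t \<sigma>) A + (- t) * measure (upper_variation \<sigma>) A
        = measure \<alpha> A + (- t) * measure (upper_variation (\<lambda>A. - \<sigma> A)) A"
        using pt(2)[OF A] jordan(3)[OF A] by (simp add: right_diff_distrib)
    qed (use False pt jordan \<alpha> int in auto)
    then show ?thesis by (simp add: signed_integral_def right_diff_distrib)
  qed
qed

lemma signed_integral_diff:
  assumes "\<And>\<mu>. \<mu> \<in> pos_measures \<Longrightarrow> integrable \<mu> h" "\<And>\<mu>. \<mu> \<in> pos_measures \<Longrightarrow> integrable \<mu> k"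
  shows "signed_integral \<sigma> (\<lambda>x. h x - k x) = signed_integral \<sigma> h - signed_integral \<sigma> k"
  using assms jordan(1,2) by (simp add: signed_integral_def)

lemma signed_integral_mult: "signed_integral \<sigma> (\<lambda>x. c * h x) = c * signed_integral \<sigma> h"
  by (simp add: signed_integral_def right_diff_distrib)

lemma signed_integral_uminus: "signed_integral \<sigma> (\<lambda>x. - h x) = - signed_integral \<sigma> h"
  by (simp add: signed_integral_def)

lemma abs_signed_integral_le:
  assumes "\<And>\<mu>. \<mu> \<in> pos_measures \<Longrightarrow> integrable \<mu> h" and B: "\<And>x. \<bar>h x\<bar> \<le> B"
  shows "\<bar>signed_integral \<sigma> h\<bar> \<le> B * total_variation"
proof -
  have "\<bar>LINT x|upper_variation \<sigma>. h x\<bar> \<le> B * measure (upper_variation \<sigma>) UNIV"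
    "\<bar>LINT x|upper_variation (\<lambda>A. - \<sigma> A). h x\<bar> \<le> B * measure (upper_variation (\<lambda>A. - \<sigma> A)) UNIV"
    using assms jordan(1,2) by (auto intro!: abs_integral_le_const)
  then show ?thesis unfolding signed_integral_def total_variation_def by (simp add: distrib_left)
qed

lemma signed_integral_tendsto:
  assumes int: "\<And>n \<mu>. \<mu> \<in> pos_measures \<Longrightarrow> integrable \<mu> (h n)" "\<And>\<mu>. \<mu> \<in> pos_measures \<Longrightarrow> integrable \<mu> l"
    and B: "\<And>n x. \<bar>h n x\<bar> \<le> B" and lim: "\<And>x. (\<lambda>n. h n x) \<longlonglongrightarrow> l x"
  shows "(\<lambda>n. signed_integral \<sigma> (h n)) \<longlonglongrightarrow> signed_integral \<sigma> l"
proof -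
  have "(\<lambda>n. LINT x|\<mu>. h n x) \<longlonglongrightarrow> (LINT x|\<mu>. l x)" if \<mu>: "\<mu> \<in> pos_measures" for \<mu>
  proof (rule integral_dominated_convergence[where w = "\<lambda>_. B"])
    interpret finite_measure \<mu> by (rule pos_measuresD(1)[OF \<mu>])
    show "integrable \<mu> (\<lambda>_. B)" by simp
  qed (use int[OF \<mu>] B lim in auto)
  from this[OF jordan(1)] this[OF jordan(2)] show ?thesis
    unfolding signed_integral_def by (rule tendsto_diff)
qed

lemma weakly_converges_perturb:
  assumes comp: "compact (UNIV :: 'a set)" and t: "\<And>n. t n \<in> perturb_times \<alpha> \<sigma>" "t \<longlonglongrightarrow> 0"
  shows "weakly_converges (\<lambda>n. perturb \<alpha> (t n) \<sigma>) \<alpha>"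
  unfolding weakly_converges_def
proof (intro allI impI)
  fix h :: "'a \<Rightarrow> real" assume h: "continuous_on UNIV h"
  have "(LINT x|perturb \<alpha> (t n) \<sigma>. h x) = (LINT x|\<alpha>. h x) + t n * signed_integral \<sigma> h" for n
    by (rule integral_perturb[OF t(1)]) (rule integrable_continuous[OF comp _ h])
  moreover have "(\<lambda>n. (LINT x|\<alpha>. h x) + t n * signed_integral \<sigma> h) \<longlonglongrightarrow> (LINT x|\<alpha>. h x) + 0 * signed_integral \<sigma> h"
    by (intro tendsto_intros t)
  ultimately show "(\<lambda>n. LINT x|perturb \<alpha> (t n) \<sigma>. h x) \<longlonglongrightarrow> (LINT x|\<alpha>. h x)" by simp
qed

end

section \<open>Differentiability\<close>

context entropic_ot
begin

section \<open>The dual objective at perturbed measures\<close>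

text \<open>The derivative of \<open>dual\<close> in the first measure at fixed potentials. By
  symmetry of the cost the one in the second measure is \<open>grad \<alpha> g f\<close>.\<close>

definition grad :: "'a measure \<Rightarrow> ('a \<Rightarrow> real) \<Rightarrow> ('a \<Rightarrow> real) \<Rightarrow> 'a \<Rightarrow> real" where
  "grad \<beta> f g x = - cval (- f x) - \<epsilon> * (LINT y|\<beta>. gibbs f g x y - 1)"

lemma integrable_cval:
  "dual_feasible f \<Longrightarrow> \<mu> \<in> pos_measures \<Longrightarrow> integrable \<mu> (\<lambda>x. cval (- f x))"
  by (auto simp: dual_feasible_def intro: integrable_continuous[OF compact_X])

lemma integrable_grad:
  assumes \<beta>: "\<beta> \<in> pos_measures" and f: "dual_feasible f" and g: "continuous_on UNIV g" and \<mu>: "\<mu> \<in> pos_measures"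
  shows "integrable \<mu> (grad \<beta> f g)"
proof -
  have "continuous_on UNIV f" using f by (simp add: dual_feasible_def)
  from integrable_partial_integral[OF compact_X \<mu> \<beta> continuous_gibbs_minus_1[OF this g]] integrable_cval[OF f \<mu>]
  show ?thesis unfolding grad_def[abs_def] by auto
qed

text \<open>At fixed potentials the conjugate terms are affine in the measures and the Gibbs term is
  bilinear. The remainder is therefore exactly the double integral of
  \<open>gibbs f g x y - 1\<close> against \<sigma> and \<tau>, times
  \<open>- \<epsilon> * t\<^sup>2\<close>.\<close>

lemma dual_perturb:
  assumes pa: "perturbation \<alpha> \<sigma>" and pb: "perturbation \<beta> \<tau>"
    and t: "t \<in> perturb_times \<alpha> \<sigma>" "t \<in> perturb_times \<beta> \<tau>"
    and f: "dual_feasible f" and g: "dual_feasible g" and S: "\<And>x y. \<bar>gibbs f g x y - 1\<bar> \<le> S"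
  shows "\<bar>dual (perturb \<alpha> t \<sigma>) (perturb \<beta> t \<tau>) f g - dual \<alpha> \<beta> f g
      - t * (signed_integral \<sigma> (grad \<beta> f g) + signed_integral \<tau> (grad \<alpha> g f))\<bar>
    \<le> \<epsilon> * (S * perturbation.total_variation \<tau> * perturbation.total_variation \<sigma>) * t\<^sup>2"
proof -
  interpret A: perturbation \<alpha> \<sigma> by (rule pa)
  interpret B: perturbation \<beta> \<tau> by (rule pb)
  have fc: "continuous_on UNIV f" and gc: "continuous_on UNIV g"
    using f g by (auto simp: dual_feasible_def)
  define k where "k x y = gibbs f g x y - 1" for x y
  define K\<beta> where "K\<beta> x = (LINT y|\<beta>. k x y)" for x
  define K\<alpha> where "K\<alpha> y = (LINT x|\<alpha>. k x y)" for y
  \<comment> \<open>Integrated against \<sigma> this is the mixed coefficient of the quadratic term;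
    integrated against \<alpha> it gives, after exchanging integrals, the Gibbs part of the
    \<tau>-derivative.\<close>
  define \<kappa> where "\<kappa> x = signed_integral \<tau> (k x)" for x
  have kc: "continuous_on UNIV (\<lambda>(x, y). k x y)"
    unfolding k_def by (rule continuous_gibbs_minus_1[OF fc gc])
  have kc': "continuous_on UNIV (\<lambda>(y, x). k x y)"
    unfolding k_def gibbs_swap[of f g] by (rule continuous_gibbs_minus_1[OF gc fc])
  have k1: "continuous_on UNIV (k x)" for x
    unfolding k_def gibbs_swap[of f g] by (intro continuous_intros continuous_gibbs_left gc)
  have ik: "integrable \<mu> (k x)" if "\<mu> \<in> pos_measures" for \<mu> x
    by (rule integrable_continuous[OF compact_X that k1])
  have i\<beta>: "integrable \<mu> K\<beta>" if "\<mu> \<in> pos_measures" for \<mu>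
    unfolding K\<beta>_def by (rule integrable_partial_integral[OF compact_X that B.\<alpha> kc])
  have i\<alpha>: "integrable \<mu> K\<alpha>" if "\<mu> \<in> pos_measures" for \<mu>
    unfolding K\<alpha>_def by (rule integrable_partial_integral[OF compact_X that A.\<alpha> kc'])
  have i\<kappa>: "integrable \<mu> \<kappa>" if "\<mu> \<in> pos_measures" for \<mu>
    unfolding \<kappa>_def signed_integral_def
    by (intro Bochner_Integration.integrable_diff integrable_partial_integral[OF compact_X that _ kc] B.jordan)
  note pA = perturb_measure[OF A.\<alpha> A.\<sigma> t(1)]
  have "(LINT y|perturb \<beta> t \<tau>. k x y) = K\<beta> x + t * \<kappa> x" for x
    unfolding K\<beta>_def \<kappa>_def by (rule B.integral_perturb[OF t(2) ik])
  then have "(LINT x|perturb \<alpha> t \<sigma>. LINT y|perturb \<beta> t \<tau>. k x y)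
      = (LINT x|perturb \<alpha> t \<sigma>. K\<beta> x) + t * (LINT x|perturb \<alpha> t \<sigma>. \<kappa> x)"
    using i\<beta>[OF pA(1)] i\<kappa>[OF pA(1)] by simp
  also have "\<dots> = (LINT x|\<alpha>. K\<beta> x) + t * signed_integral \<sigma> K\<beta> + t * ((LINT x|\<alpha>. \<kappa> x) + t * signed_integral \<sigma> \<kappa>)"
    by (simp add: A.integral_perturb[OF t(1) i\<beta>] A.integral_perturb[OF t(1) i\<kappa>])
  also have "(LINT x|\<alpha>. \<kappa> x) = signed_integral \<tau> K\<alpha>"
  proof -
    have "(LINT x|\<alpha>. \<kappa> x) = (LINT x|\<alpha>. LINT y|upper_variation \<tau>. k x y)
        - (LINT x|\<alpha>. LINT y|upper_variation (\<lambda>A. - \<tau> A). k x y)"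
      unfolding \<kappa>_def signed_integral_def
      by (intro Bochner_Integration.integral_diff integrable_partial_integral[OF compact_X A.\<alpha> _ kc] B.jordan)
    then show ?thesis
      by (simp add: signed_integral_def K\<alpha>_def integral_swap[OF compact_X A.\<alpha> B.jordan(1) kc]
          integral_swap[OF compact_X A.\<alpha> B.jordan(2) kc])
  qed
  finally have I: "(LINT x|perturb \<alpha> t \<sigma>. LINT y|perturb \<beta> t \<tau>. k x y)
      = (LINT x|\<alpha>. K\<beta> x) + t * signed_integral \<sigma> K\<beta> + t * (signed_integral \<tau> K\<alpha> + t * signed_integral \<sigma> \<kappa>)" .
  have g1: "signed_integral \<sigma> (grad \<beta> f g) = - signed_integral \<sigma> (\<lambda>x. cval (- f x)) - \<epsilon> * signed_integral \<sigma> K\<beta>"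
  proof -
    have "grad \<beta> f g = (\<lambda>x. - cval (- f x) - \<epsilon> * K\<beta> x)" by (simp add: grad_def K\<beta>_def k_def fun_eq_iff)
    then show ?thesis
      using integrable_cval[OF f] i\<beta>
      by (simp add: A.signed_integral_diff A.signed_integral_mult A.signed_integral_uminus)
  qed
  have g2: "signed_integral \<tau> (grad \<alpha> g f) = - signed_integral \<tau> (\<lambda>x. cval (- g x)) - \<epsilon> * signed_integral \<tau> K\<alpha>"
  proof -
    have "grad \<alpha> g f = (\<lambda>x. - cval (- g x) - \<epsilon> * K\<alpha> x)"
      by (simp add: grad_def K\<alpha>_def k_def fun_eq_iff gibbs_swap[of g f])
    then show ?thesis
      using integrable_cval[OF g] i\<alpha>
      by (simp add: B.signed_integral_diff B.signed_integral_mult B.signed_integral_uminus)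
  qed
  have "\<bar>\<kappa> x\<bar> \<le> S * B.total_variation" for x
    unfolding \<kappa>_def by (intro B.abs_signed_integral_le ik) (simp_all add: k_def S)
  then have \<kappa>: "\<bar>signed_integral \<sigma> \<kappa>\<bar> \<le> S * B.total_variation * A.total_variation"
    by (intro A.abs_signed_integral_le i\<kappa>)
  have cv: "(LINT x|perturb \<alpha> t \<sigma>. cval (- f x)) = (LINT x|\<alpha>. cval (- f x)) + t * signed_integral \<sigma> (\<lambda>x. cval (- f x))"
    "(LINT x|perturb \<beta> t \<tau>. cval (- g x)) = (LINT x|\<beta>. cval (- g x)) + t * signed_integral \<tau> (\<lambda>x. cval (- g x))"
    by (intro A.integral_perturb[OF t(1)] B.integral_perturb[OF t(2)] integrable_cval f g; assumption)+
  have "dual (perturb \<alpha> t \<sigma>) (perturb \<beta> t \<tau>) f g - dual \<alpha> \<beta> f g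
      - t * (signed_integral \<sigma> (grad \<beta> f g) + signed_integral \<tau> (grad \<alpha> g f)) = - (\<epsilon> * signed_integral \<sigma> \<kappa> * t\<^sup>2)"
    unfolding dual_def g1 g2 k_def[symmetric] I cv K\<beta>_def[symmetric]
    by (simp add: algebra_simps power2_eq_square)
  also have "\<bar>\<dots>\<bar> = \<epsilon> * \<bar>signed_integral \<sigma> \<kappa>\<bar> * t\<^sup>2" using eps_pos by (simp add: abs_mult)
  also have "\<dots> \<le> \<epsilon> * (S * B.total_variation * A.total_variation) * t\<^sup>2"
    using \<kappa> eps_pos by (intro mult_right_mono mult_left_mono) auto
  finally show ?thesis .
qed

section \<open>Convergence and continuity of gradients\<close>

lemma gibbs_tendsto:
  assumes "(\<lambda>n. fn n x) \<longlonglongrightarrow> f x" "(\<lambda>n. gn n y) \<longlonglongrightarrow> g y"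
  shows "(\<lambda>n. gibbs (fn n) (gn n) x y) \<longlonglongrightarrow> gibbs f g x y"
  unfolding gibbs_def using eps_pos by (intro tendsto_intros assms) auto

text \<open>Potentials and point may move together: moving potentials occur for perturbed problems,
  a moving point in the continuity of the gradient.\<close>

lemma integral_gibbs_tendsto:
  assumes \<beta>: "\<beta> \<in> pos_measures" and c: "\<And>n. continuous_on UNIV (gn n)" "continuous_on UNIV g"
    and lim: "\<And>y. (\<lambda>n. gibbs (fn n) (gn n) (X n) y) \<longlonglongrightarrow> gibbs f g x y"
    and G: "\<And>n y. gibbs (fn n) (gn n) (X n) y \<le> G"
  shows "(\<lambda>n. LINT y|\<beta>. gibbs (fn n) (gn n) (X n) y - 1) \<longlonglongrightarrow> (LINT y|\<beta>. gibbs f g x y - 1)"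
proof (rule integral_dominated_convergence[where w = "\<lambda>_. G + 1"])
  interpret finite_measure \<beta> by (rule pos_measuresD(1)[OF \<beta>])
  show "integrable \<beta> (\<lambda>_. G + 1)" by simp
  have m: "(\<lambda>y. gibbs f g x y - 1) \<in> borel_measurable \<beta>" if "continuous_on UNIV g" for f g x
    using integrable_gibbs[OF \<beta> that, of f x] by (simp add: gibbs_swap[of f g])
  show "(\<lambda>y. gibbs f g x y - 1) \<in> borel_measurable \<beta>"
    "\<And>n. (\<lambda>y. gibbs (fn n) (gn n) (X n) y - 1) \<in> borel_measurable \<beta>" by (intro m c)+
  show "AE y in \<beta>. (\<lambda>n. gibbs (fn n) (gn n) (X n) y - 1) \<longlonglongrightarrow> gibbs f g x y - 1"
    by (intro AE_I2 tendsto_intros lim)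
  show "AE y in \<beta>. norm (gibbs (fn n) (gn n) (X n) y - 1) \<le> G + 1" for n
  proof (rule AE_I2)
    fix y
    show "norm (gibbs (fn n) (gn n) (X n) y - 1) \<le> G + 1"
      using G[of n y] gibbs_pos[of "fn n" "gn n" "X n" y] by (simp add: abs_le_iff)
  qed
qed

text \<open>Subgradients with a common bound give convergence of the conjugate term even at boundary
  points of its domain.\<close>

lemma grad_tendsto:
  assumes \<beta>: "\<beta> \<in> pos_measures"
    and c: "\<And>n. continuous_on UNIV (gn n)" "continuous_on UNIV g"
    and lim: "\<And>x. (\<lambda>n. fn n x) \<longlonglongrightarrow> f x" "\<And>x. (\<lambda>n. gn n x) \<longlonglongrightarrow> g x"
    and G: "\<And>n x y. gibbs (fn n) (gn n) x y \<le> G"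
    and sub: "\<And>n x. sn n x \<in> subd (- fn n x)" "\<And>x. s x \<in> subd (- f x)"
    and S: "\<And>n x. \<bar>sn n x\<bar> \<le> S" "\<And>x. \<bar>s x\<bar> \<le> S"
  shows "(\<lambda>n. grad \<beta> (fn n) (gn n) x) \<longlonglongrightarrow> grad \<beta> f g x"
proof -
  have "(\<lambda>n. cval (- fn n x) - cval (- f x)) \<longlonglongrightarrow> 0"
  proof (rule Lim_null_comparison)
    show "eventually (\<lambda>n. norm (cval (- fn n x) - cval (- f x)) \<le> S * \<bar>- fn n x - - f x\<bar>) sequentially"
      using cval_lipschitz[OF sub(1)[of _ x] sub(2)[of x] S(1)[of _ x] S(2)[of x]] by (intro always_eventually allI) (simp only: real_norm_def)
    have "(\<lambda>n. S * \<bar>- fn n x - - f x\<bar>) \<longlonglongrightarrow> S * \<bar>- f x - - f x\<bar>" by (intro tendsto_intros lim)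
    then show "(\<lambda>n. S * \<bar>- fn n x - - f x\<bar>) \<longlonglongrightarrow> 0" by simp
  qed
  then have 1: "(\<lambda>n. cval (- fn n x)) \<longlonglongrightarrow> cval (- f x)" by (simp add: LIM_zero_iff)
  have 2: "(\<lambda>n. LINT y|\<beta>. gibbs (fn n) (gn n) x y - 1) \<longlonglongrightarrow> (LINT y|\<beta>. gibbs f g x y - 1)"
    by (rule integral_gibbs_tendsto[OF \<beta> c gibbs_tendsto[of fn, OF lim] G])
  show ?thesis unfolding grad_def by (intro tendsto_intros 1 2)
qed

text \<open>The constant is uniform in the potentials, so it dominates the gradients of all
  perturbed problems under integrals against the Jordan parts.\<close>

lemma abs_grad_le:
  assumes \<beta>: "\<beta> \<in> pos_measures" and c: "continuous_on UNIV g"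
    and B: "\<bar>f x\<bar> \<le> B" and G: "\<And>y. gibbs f g x y \<le> G" and s: "s \<in> subd (- f x)" "\<bar>s\<bar> \<le> S"
  shows "\<bar>grad \<beta> f g x\<bar> \<le> B + S * B + \<epsilon> * ((G + 1) * measure \<beta> UNIV)"
proof -
  interpret finite_measure \<beta> by (rule pos_measuresD(1)[OF \<beta>])
  have "\<bar>s * (- f x)\<bar> \<le> S * B" unfolding abs_mult using s(2) B by (intro mult_mono) auto
  moreover have "0 \<le> S * B" using s(2) B by (intro mult_nonneg_nonneg) auto
  ultimately have "\<bar>cval (- f x)\<bar> \<le> B + S * B"
    using cval_bounds[OF s(1)] B by (auto simp: abs_le_iff)
  moreover have "\<bar>LINT y|\<beta>. gibbs f g x y - 1\<bar> \<le> (G + 1) * measure \<beta> UNIV"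
  proof (rule abs_integral_le_const[OF \<beta>])
    show "integrable \<beta> (\<lambda>y. gibbs f g x y - 1)"
      using integrable_gibbs[OF \<beta> c, of f x] by (simp add: gibbs_swap[of f g])
    show "\<bar>gibbs f g x y - 1\<bar> \<le> G + 1" for y
      using G[of y] gibbs_pos[of f g x y] by (simp add: abs_le_iff)
  qed
  then have "\<bar>\<epsilon> * (LINT y|\<beta>. gibbs f g x y - 1)\<bar> \<le> \<epsilon> * ((G + 1) * measure \<beta> UNIV)"
    using eps_pos by (simp add: abs_mult)
  ultimately show ?thesis unfolding grad_def by linarith
qed

lemma continuous_grad:
  assumes \<beta>: "\<beta> \<in> pos_measures" and f: "dual_feasible f" and g: "continuous_on UNIV g"
  shows "continuous_on UNIV (grad \<beta> f g)"
proof -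
  have fc: "continuous_on UNIV f" "continuous_on UNIV (\<lambda>x. cval (- f x))" using f by (auto simp: dual_feasible_def)
  obtain G where G: "\<And>x y. gibbs f g x y \<le> G" using gibbs_bounded[OF fc(1) g] by blast
  have "continuous_on UNIV (\<lambda>x. LINT y|\<beta>. gibbs f g x y - 1)"
    unfolding continuous_on_sequentially o_def
  proof (intro ballI allI impI)
    fix X :: "nat \<Rightarrow> 'a" and x assume "(\<forall>n. X n \<in> UNIV) \<and> X \<longlonglongrightarrow> x"
    then have X: "X \<longlonglongrightarrow> x" by simp
    have "(\<lambda>n. gibbs f g (X n) y) \<longlonglongrightarrow> gibbs f g x y" for y
    proof -
      have "isCont (\<lambda>x. gibbs f g x y) x"
        using continuous_gibbs_left[OF fc(1), of g y] continuous_on_eq_continuous_at[OF open_UNIV] by blast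
      from isCont_tendsto_compose[OF this X] show ?thesis .
    qed
    then show "(\<lambda>n. LINT y|\<beta>. gibbs f g (X n) y - 1) \<longlonglongrightarrow> (LINT y|\<beta>. gibbs f g x y - 1)"
      by (rule integral_gibbs_tendsto[OF \<beta> g g _ G])
  qed
  with fc(2) show ?thesis unfolding grad_def[abs_def] by (intro continuous_intros)
qed

section \<open>First-order expansion of the transport cost\<close>

lemma perturb_mass_bounded:
  assumes \<alpha>: "\<alpha> \<in> pos_measures" and \<sigma>: "signed_measure \<sigma>"
    and m: "m < measure \<alpha> UNIV" "measure \<alpha> UNIV < M"
  shows "\<exists>d>0. \<forall>t\<in>perturb_times \<alpha> \<sigma>. \<bar>t\<bar> < d \<longrightarrow> mass_bounded m M (perturb \<alpha> t \<sigma>)"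
proof -
  have "((\<lambda>t. measure \<alpha> UNIV + t * \<sigma> UNIV) \<longlongrightarrow> measure \<alpha> UNIV + 0 * \<sigma> UNIV) (at 0)"
    by (intro tendsto_intros)
  then have lim: "((\<lambda>t. measure \<alpha> UNIV + t * \<sigma> UNIV) \<longlongrightarrow> measure \<alpha> UNIV) (at 0)" by simp
  have "eventually (\<lambda>t. m < measure \<alpha> UNIV + t * \<sigma> UNIV \<and> measure \<alpha> UNIV + t * \<sigma> UNIV < M) (at 0)"
    using order_tendstoD(1)[OF lim m(1)] order_tendstoD(2)[OF lim m(2)] by eventually_elim simp
  then obtain d where d: "0 < d" "\<And>t. t \<noteq> 0 \<Longrightarrow> \<bar>t\<bar> < d \<Longrightarrow>
      m < measure \<alpha> UNIV + t * \<sigma> UNIV \<and> measure \<alpha> UNIV + t * \<sigma> UNIV < M"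
    unfolding eventually_at by (auto simp: dist_real_def)
  show ?thesis
  proof (intro exI[of _ d] conjI ballI impI d(1))
    fix t assume t: "t \<in> perturb_times \<alpha> \<sigma>" "\<bar>t\<bar> < d"
    have "measure (perturb \<alpha> t \<sigma>) UNIV = measure \<alpha> UNIV + t * \<sigma> UNIV"
      by (rule perturb_measure(2)[OF \<alpha> \<sigma> t(1)]) simp
    with d(2)[of t] t(2) m show "mass_bounded m M (perturb \<alpha> t \<sigma>)"
      using perturb_measure(1)[OF \<alpha> \<sigma> t(1)] by (cases "t = 0") (auto simp: mass_bounded_def)
  qed
qed

text \<open>
  The upper bound involves the potentials of the perturbed problems; by compactness and
  uniqueness they converge to those of the unperturbed one.
\<close>

lemma OT_expansion:
  assumes \<alpha>: "\<alpha> \<in> nonzero_pos_measures" and \<beta>: "\<beta> \<in> nonzero_pos_measures"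
    and pa: "perturbation \<alpha> \<sigma>" and pb: "perturbation \<beta> \<tau>"
    and c: "continuous_on UNIV f" "continuous_on UNIV g"
    and br: "best_response \<alpha> f g" "best_response \<beta> g f" and e: "0 < e"
  shows "\<exists>d>0. \<forall>t\<in>perturb_times \<alpha> \<sigma> \<inter> perturb_times \<beta> \<tau>. \<bar>t\<bar> < d \<longrightarrow>
    (\<exists>v. OT \<epsilon> \<phi> C (perturb \<alpha> t \<sigma>) (perturb \<beta> t \<tau>) = ereal v \<and>
      \<bar>v - dual \<alpha> \<beta> f g - t * (signed_integral \<sigma> (grad \<beta> f g) + signed_integral \<tau> (grad \<alpha> g f))\<bar> \<le> e * \<bar>t\<bar>)"
proof (rule ccontr)
  interpret A: perturbation \<alpha> \<sigma> by (rule pa)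
  interpret B: perturbation \<beta> \<tau> by (rule pb)
  have mpos: "0 < measure \<alpha> UNIV" "0 < measure \<beta> UNIV"
    using \<alpha> \<beta> by (auto simp: nonzero_pos_measures_pos)
  \<comment> \<open>Half the smaller mass and one more than the larger leave room for the perturbed
    masses.\<close>
  define m where "m = min (measure \<alpha> UNIV) (measure \<beta> UNIV) / 2"
  define M where "M = max (measure \<alpha> UNIV) (measure \<beta> UNIV) + 1"
  have m: "0 < m" "m < measure \<alpha> UNIV" "m < measure \<beta> UNIV" "measure \<alpha> UNIV < M" "measure \<beta> UNIV < M"
    using mpos by (auto simp: m_def M_def)
  have mb: "mass_bounded m M \<alpha>" "mass_bounded m M \<beta>"
    using m A.\<alpha> B.\<alpha> by (auto simp: mass_bounded_def)
  obtain d1 where d1: "0 < d1" "\<And>t. t \<in> perturb_times \<alpha> \<sigma> \<Longrightarrow> \<bar>t\<bar> < d1 \<Longrightarrow> mass_bounded m M (perturb \<alpha> t \<sigma>)"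
    using perturb_mass_bounded[OF A.\<alpha> A.\<sigma> m(2,4)] by blast
  obtain d2 where d2: "0 < d2" "\<And>t. t \<in> perturb_times \<beta> \<tau> \<Longrightarrow> \<bar>t\<bar> < d2 \<Longrightarrow> mass_bounded m M (perturb \<beta> t \<tau>)"
    using perturb_mass_bounded[OF B.\<alpha> B.\<sigma> m(3,5)] by blast
  let ?T = "perturb_times \<alpha> \<sigma> \<inter> perturb_times \<beta> \<tau>"
  let ?OT = "\<lambda>t. OT \<epsilon> \<phi> C (perturb \<alpha> t \<sigma>) (perturb \<beta> t \<tau>)"
  define L where "L = signed_integral \<sigma> (grad \<beta> f g) + signed_integral \<tau> (grad \<alpha> g f)"
  define Q where "Q t \<longleftrightarrow> (\<exists>v. ?OT t = ereal v \<and> \<bar>v - dual \<alpha> \<beta> f g - t * L\<bar> \<le> e * \<bar>t\<bar>)" for t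
  assume "\<not> ?thesis"
  \<comment> \<open>A failure produces a sequence of bad times tending to 0, along which potentials
    converge after passing to a subsequence.\<close>
  then have neg: "\<And>d. 0 < d \<Longrightarrow> \<exists>t\<in>?T. \<bar>t\<bar> < d \<and> \<not> Q t" unfolding Q_def L_def by blast
  have "\<exists>t. t \<in> ?T \<and> \<bar>t\<bar> < min (min d1 d2) (1 / real (Suc n)) \<and> \<not> Q t" for n
    using neg[of "min (min d1 d2) (1 / real (Suc n))"] d1(1) d2(1) by auto
  then obtain t where t: "\<And>n. t n \<in> ?T" "\<And>n. \<bar>t n\<bar> < min (min d1 d2) (1 / real (Suc n))" "\<And>n. \<not> Q (t n)"
    by metis
  have t\<alpha>: "t n \<in> perturb_times \<alpha> \<sigma>" and t\<beta>: "t n \<in> perturb_times \<beta> \<tau>" for n using t(1)[of n] by auto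
  have t0: "t \<longlonglongrightarrow> 0"
  proof (rule Lim_null_comparison)
    show "eventually (\<lambda>n. norm (t n) \<le> 1 / real (Suc n)) sequentially"
      using t(2) by (intro always_eventually) (simp add: less_imp_le)
    show "(\<lambda>n. 1 / real (Suc n)) \<longlonglongrightarrow> 0" by (rule LIMSEQ_Suc[OF lim_inverse_n'])
  qed
  define \<alpha>n where "\<alpha>n n = perturb \<alpha> (t n) \<sigma>" for n
  define \<beta>n where "\<beta>n n = perturb \<beta> (t n) \<tau>" for n
  have mbn: "mass_bounded m M (\<alpha>n n)" "mass_bounded m M (\<beta>n n)" for n
    using d1(2)[OF t\<alpha>[of n]] d2(2)[OF t\<beta>[of n]] t(2)[of n] by (auto simp: \<alpha>n_def \<beta>n_def)
  have nz: "\<alpha>n n \<in> nonzero_pos_measures" "\<beta>n n \<in> nonzero_pos_measures" for n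
    using mass_bounded_nonzero[OF m(1)] mbn by auto
  have pn: "\<alpha>n n \<in> pos_measures" "\<beta>n n \<in> pos_measures" for n using mbn[of n] by (auto simp: mass_bounded_def)
  have w: "weakly_converges \<alpha>n \<alpha>" "weakly_converges \<beta>n \<beta>"
    unfolding \<alpha>n_def \<beta>n_def
    by (rule A.weakly_converges_perturb[OF compact_X t\<alpha> t0], rule B.weakly_converges_perturb[OF compact_X t\<beta> t0])
  have "\<exists>f g. continuous_on UNIV f \<and> continuous_on UNIV g \<and> best_response (\<alpha>n n) f g \<and> best_response (\<beta>n n) g f" for n
    by (rule response_pair_exists[OF nz])
  then obtain fn gn where fg: "\<And>n. continuous_on UNIV (fn n)" "\<And>n. continuous_on UNIV (gn n)"
    "\<And>n. best_response (\<alpha>n n) (fn n) (gn n)" "\<And>n. best_response (\<beta>n n) (gn n) (fn n)" by metis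
  have dp: "damped_pair m M 1 \<alpha> \<beta> f g f" and dpn: "damped_pair m M 1 (\<alpha>n n) (\<beta>n n) (fn n) (gn n) (fn n)" for n
    using mb mbn c(1) br fg by (simp_all add: damped_pair_def)
  obtain r f' g' where r: "strict_mono (r :: nat \<Rightarrow> nat)"
    and lim0: "uniform_limit UNIV (\<lambda>n. fn (r n)) f' sequentially" "uniform_limit UNIV (\<lambda>n. gn (r n)) g' sequentially"
    and fg': "continuous_on UNIV f'" "continuous_on UNIV g'" "best_response \<alpha> f' g'" "best_response \<beta> g' f'"
    by (rule response_pairs_compact[OF m(1) dpn \<alpha> \<beta> w tendsto_const])
  have "f' = f \<and> g' = g" by (rule response_pair_unique[OF \<alpha> \<beta> fg'(1,2) c fg'(3,4) br])
  then have lim: "(\<lambda>n. fn (r n) x) \<longlonglongrightarrow> f x" "(\<lambda>n. gn (r n) x) \<longlonglongrightarrow> g x" for x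
    using tendsto_uniform_limitI[OF lim0(1) UNIV_I, of x] tendsto_uniform_limitI[OF lim0(2) UNIV_I, of x]
    by simp_all
  obtain B where B: "0 \<le> B"
    "\<And>l \<alpha> \<beta> f g f' x. damped_pair m M l \<alpha> \<beta> f g f' \<Longrightarrow> \<bar>f' x\<bar> \<le> B \<and> \<bar>g x\<bar> \<le> B"
    using a_priori_bound[OF m(1), of M] by blast
  have bd: "\<bar>f x\<bar> \<le> B" "\<bar>g x\<bar> \<le> B" for x
    using B(2)[OF dp] by auto
  have bdn: "\<bar>fn n x\<bar> \<le> B" "\<bar>gn n x\<bar> \<le> B" for n x
    using B(2)[OF dpn] by auto
  obtain cm where cm: "0 \<le> cm" "\<And>x y. \<bar>C x y\<bar> \<le> cm" using C_bounded by blast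
  define G where "G = exp ((2 * B + cm) / \<epsilon>)"
  have Gb: "gibbs h k x y \<le> G" if "\<And>x. \<bar>h x\<bar> \<le> B" "\<And>x. \<bar>k x\<bar> \<le> B" for h k x y
  proof -
    have "h x + k y - C x y \<le> 2 * B + cm" using that(1)[of x] that(2)[of y] cm(2)[of x y] by (simp add: abs_le_iff)
    then show ?thesis using eps_pos by (simp add: gibbs_def G_def divide_right_mono)
  qed
  have G0: "0 \<le> G" by (simp add: G_def)
  have int_le: "\<bar>LINT x|\<mu>. gibbs h k x y\<bar> \<le> G * M"
    if "mass_bounded m M \<mu>" "continuous_on UNIV h" "\<And>x. \<bar>h x\<bar> \<le> B" "\<And>x. \<bar>k x\<bar> \<le> B" for \<mu> h k y
  proof -
    have \<mu>: "\<mu> \<in> pos_measures" "measure \<mu> UNIV \<le> M" using that(1) by (auto simp: mass_bounded_def)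
    have "\<bar>LINT x|\<mu>. gibbs h k x y\<bar> \<le> G * measure \<mu> UNIV"
      using Gb[OF that(3,4)] gibbs_pos[of h k]
      by (intro abs_integral_le_const[OF \<mu>(1) integrable_gibbs[OF \<mu>(1) that(2)]]) (simp add: abs_of_pos)
    also have "\<dots> \<le> G * M" using \<mu>(2) G0 by (intro mult_left_mono)
    finally show ?thesis .
  qed
  have feas: "dual_feasible f" "dual_feasible g"
    by (rule best_response_feasible[OF \<beta> c(2) br(2)], rule best_response_feasible[OF \<alpha> c(1) br(1)])
  have feasn: "dual_feasible (fn n)" "dual_feasible (gn n)" for n
    by (rule best_response_feasible[OF nz(2) fg(2,4)], rule best_response_feasible[OF nz(1) fg(1,3)])
  define Ln where "Ln n = signed_integral \<sigma> (grad \<beta> (fn n) (gn n)) + signed_integral \<tau> (grad \<alpha> (gn n) (fn n))" for n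
  have sf: "(LINT y|\<beta>n n. gibbs (gn n) (fn n) y x) \<in> subd (- fn n x)"
    "\<bar>LINT y|\<beta>n n. gibbs (gn n) (fn n) y x\<bar> \<le> G * M"
    "(LINT y|\<beta>. gibbs g f y x) \<in> subd (- f x)" "\<bar>LINT y|\<beta>. gibbs g f y x\<bar> \<le> G * M" for n x
    using fg(4) br(2) int_le[OF mbn(2) fg(2) bdn(2) bdn(1)] int_le[OF mb(2) c(2) bd(2) bd(1)]
    by (simp_all add: best_response_def)
  have sg: "(LINT x|\<alpha>n n. gibbs (fn n) (gn n) x y) \<in> subd (- gn n y)"
    "\<bar>LINT x|\<alpha>n n. gibbs (fn n) (gn n) x y\<bar> \<le> G * M"
    "(LINT x|\<alpha>. gibbs f g x y) \<in> subd (- g y)" "\<bar>LINT x|\<alpha>. gibbs f g x y\<bar> \<le> G * M" for n y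
    using fg(3) br(1) int_le[OF mbn(1) fg(1) bdn(1) bdn(2)] int_le[OF mb(1) c(1) bd(1) bd(2)]
    by (simp_all add: best_response_def)
  have "(\<lambda>n. signed_integral \<sigma> (grad \<beta> (fn (r n)) (gn (r n)))) \<longlonglongrightarrow> signed_integral \<sigma> (grad \<beta> f g)"
  proof (rule A.signed_integral_tendsto)
    show "\<bar>grad \<beta> (fn (r n)) (gn (r n)) x\<bar> \<le> B + (G * M) * B + \<epsilon> * ((G + 1) * measure \<beta> UNIV)" for n x
      by (rule abs_grad_le[OF B.\<alpha> fg(2) bdn(1) Gb[OF bdn] sf(1,2)])
    show "(\<lambda>n. grad \<beta> (fn (r n)) (gn (r n)) x) \<longlonglongrightarrow> grad \<beta> f g x" for x
      by (rule grad_tendsto[OF B.\<alpha> fg(2) c(2) lim Gb[OF bdn] sf(1,3,2,4)])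
  qed (auto intro: integrable_grad B.\<alpha> feas feasn fg c)
  moreover have "(\<lambda>n. signed_integral \<tau> (grad \<alpha> (gn (r n)) (fn (r n)))) \<longlonglongrightarrow> signed_integral \<tau> (grad \<alpha> g f)"
  proof (rule B.signed_integral_tendsto)
    show "\<bar>grad \<alpha> (gn (r n)) (fn (r n)) x\<bar> \<le> B + (G * M) * B + \<epsilon> * ((G + 1) * measure \<alpha> UNIV)" for n x
      by (rule abs_grad_le[OF A.\<alpha> fg(1) bdn(2) Gb[OF bdn(2,1)] sg(1,2)])
    show "(\<lambda>n. grad \<alpha> (gn (r n)) (fn (r n)) x) \<longlonglongrightarrow> grad \<alpha> g f x" for x
      by (rule grad_tendsto[OF A.\<alpha> fg(1) c(1) lim(2,1) Gb[OF bdn(2,1)] sg(1,3,2,4)])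
  qed (auto intro: integrable_grad A.\<alpha> feas feasn fg c)
  ultimately have Llim: "(\<lambda>n. Ln (r n)) \<longlonglongrightarrow> L" unfolding Ln_def L_def by (rule tendsto_add)
  \<comment> \<open>The constant of \<open>dual_perturb\<close>, with \<open>G + 1\<close> bounding
    \<open>\<bar>gibbs h k x y - 1\<bar>\<close> for perturbed and unperturbed potentials
    alike.\<close>
  define K where "K = \<epsilon> * ((G + 1) * B.total_variation * A.total_variation)"
  have tv: "0 \<le> A.total_variation" "0 \<le> B.total_variation"
    by (simp_all add: A.total_variation_def B.total_variation_def)
  have K0: "0 \<le> K" using eps_pos G0 tv by (simp add: K_def)
  have G1: "\<bar>gibbs h k x y - 1\<bar> \<le> G + 1" if "\<And>x. \<bar>h x\<bar> \<le> B" "\<And>x. \<bar>k x\<bar> \<le> B" for h k x y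
    using Gb[of h k x y, OF that] gibbs_pos[of h k x y] by (simp add: abs_le_iff)
  \<comment> \<open>Inserting \<open>f\<close>, \<open>g\<close> in the perturbed dual bounds the
    increment below, inserting \<open>fn n\<close>, \<open>gn n\<close> in the unperturbed dual
    bounds it above, and the two linear terms differ by \<open>t n * (Ln n - L)\<close>. At a bad
    time, division by \<open>\<bar>t n\<bar>\<close> keeps the right-hand side above
    \<open>e\<close>, although it tends to 0 along \<open>r\<close>.\<close>
  have key: "e < \<bar>Ln n - L\<bar> + K * \<bar>t n\<bar>" for n
  proof -
    let ?v = "dual (\<alpha>n n) (\<beta>n n) (fn n) (gn n)"
    have v: "?OT (t n) = ereal ?v"
      using strong_duality[OF nz fg(1,2,3,4), of n] by (simp add: \<alpha>n_def \<beta>n_def)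
    have "\<not> (\<bar>?v - dual \<alpha> \<beta> f g - t n * L\<bar> \<le> e * \<bar>t n\<bar>)" using t(3)[of n] v unfolding Q_def by blast
    then have big: "e * \<bar>t n\<bar> < \<bar>?v - dual \<alpha> \<beta> f g - t n * L\<bar>" by simp
    have "ereal (dual (\<alpha>n n) (\<beta>n n) f g) \<le> ereal ?v"
      using weak_duality[OF pn feas, of n n] v by (simp add: \<alpha>n_def \<beta>n_def)
    then have lo: "dual (\<alpha>n n) (\<beta>n n) f g \<le> ?v" by simp
    have "ereal (dual \<alpha> \<beta> (fn n) (gn n)) \<le> ereal (dual \<alpha> \<beta> f g)"
      using weak_duality[OF A.\<alpha> B.\<alpha> feasn, of n n] strong_duality[OF \<alpha> \<beta> c br] by simp
    then have up: "dual \<alpha> \<beta> (fn n) (gn n) \<le> dual \<alpha> \<beta> f g" by simp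
    have "\<bar>dual (\<alpha>n n) (\<beta>n n) f g - dual \<alpha> \<beta> f g - t n * L\<bar> \<le> K * (t n)\<^sup>2"
      unfolding \<alpha>n_def \<beta>n_def L_def K_def by (rule dual_perturb[OF pa pb t\<alpha> t\<beta> feas G1[OF bd]])
    then have 1: "- (K * (t n)\<^sup>2) \<le> ?v - dual \<alpha> \<beta> f g - t n * L" using lo by linarith
    have "\<bar>?v - dual \<alpha> \<beta> (fn n) (gn n) - t n * Ln n\<bar> \<le> K * (t n)\<^sup>2"
      unfolding \<alpha>n_def \<beta>n_def Ln_def K_def by (rule dual_perturb[OF pa pb t\<alpha> t\<beta> feasn G1[OF bdn]])
    then have "?v - dual \<alpha> \<beta> f g - t n * L \<le> t n * (Ln n - L) + K * (t n)\<^sup>2"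
      using up by (simp add: right_diff_distrib)
    moreover have "t n * (Ln n - L) \<le> \<bar>t n\<bar> * \<bar>Ln n - L\<bar>" by (metis abs_ge_self abs_mult)
    moreover have "0 \<le> \<bar>t n\<bar> * \<bar>Ln n - L\<bar>" by simp
    ultimately have "\<bar>?v - dual \<alpha> \<beta> f g - t n * L\<bar> \<le> \<bar>t n\<bar> * \<bar>Ln n - L\<bar> + K * (t n)\<^sup>2"
      using 1 by linarith
    with big have "e * \<bar>t n\<bar> < \<bar>t n\<bar> * \<bar>Ln n - L\<bar> + K * (t n)\<^sup>2" by linarith
    also have "\<dots> = (\<bar>Ln n - L\<bar> + K * \<bar>t n\<bar>) * \<bar>t n\<bar>" by (simp add: algebra_simps power2_eq_square)
    \<comment> \<open>The strict inequality excludes \<open>t n = 0\<close>, so the factor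
      cancels.\<close>
    finally show ?thesis by (simp add: mult_less_cancel_right)
  qed
  have "(\<lambda>n. \<bar>Ln (r n) - L\<bar> + K * \<bar>t (r n)\<bar>) \<longlonglongrightarrow> \<bar>L - L\<bar> + K * \<bar>0\<bar>"
    using LIMSEQ_subseq_LIMSEQ[OF t0 r] by (intro tendsto_intros Llim) (simp add: o_def)
  then have "(\<lambda>n. \<bar>Ln (r n) - L\<bar> + K * \<bar>t (r n)\<bar>) \<longlonglongrightarrow> 0" by simp
  moreover have "e \<le> \<bar>Ln (r n) - L\<bar> + K * \<bar>t (r n)\<bar>" for n using key[of "r n"] by simp
  ultimately have "e \<le> 0" by (intro LIMSEQ_le_const) auto
  with e show False by simp
qed

lemma has_OT_gradient_grad:
  assumes \<alpha>: "\<alpha> \<in> nonzero_pos_measures" and \<beta>: "\<beta> \<in> nonzero_pos_measures"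
    and c: "continuous_on UNIV f" "continuous_on UNIV g"
    and br: "best_response \<alpha> f g" "best_response \<beta> g f"
  shows "has_OT_gradient \<epsilon> \<phi> C \<alpha> \<beta> (grad \<beta> f g) (grad \<alpha> g f)"
  unfolding has_OT_gradient_def
proof (intro conjI allI impI)
  have \<alpha>p: "\<alpha> \<in> pos_measures" and \<beta>p: "\<beta> \<in> pos_measures"
    using \<alpha> \<beta> by (auto simp: nonzero_pos_measures_pos)
  have OT0: "OT \<epsilon> \<phi> C \<alpha> \<beta> = ereal (dual \<alpha> \<beta> f g)" by (rule strong_duality[OF \<alpha> \<beta> c br])
  then show "\<bar>OT \<epsilon> \<phi> C \<alpha> \<beta>\<bar> \<noteq> \<infinity>" by simp
  fix \<sigma> \<tau> :: "'a set \<Rightarrow> real" assume \<sigma>: "signed_measure \<sigma>" and \<tau>: "signed_measure \<tau>"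
  let ?T = "perturb_times \<alpha> \<sigma> \<inter> perturb_times \<beta> \<tau>"
  let ?OT = "\<lambda>t. OT \<epsilon> \<phi> C (perturb \<alpha> t \<sigma>) (perturb \<beta> t \<tau>)"
  let ?a = "signed_integral \<sigma> (grad \<beta> f g)" and ?b = "signed_integral \<tau> (grad \<alpha> g f)"
  show "\<exists>R\<in>o[at 0 within ?T](\<lambda>t. t). \<forall>\<^sub>F t in at 0 within ?T.
      ?OT t = OT \<epsilon> \<phi> C \<alpha> \<beta> + ereal (t * ?a + t * ?b + R t)"
  proof (cases "\<exists>t\<in>?T. t \<noteq> 0")
    case False
    \<comment> \<open>With no admissible time except possibly 0 the punctured filter is trivial, and
      any remainder will do.\<close>
    then have "eventually (\<lambda>t. False) (at 0 within ?T)" by (auto simp: eventually_at_filter intro!: always_eventually)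
    then have "at 0 within ?T = bot" by (simp add: trivial_limit_def)
    then show ?thesis by (intro bexI[of _ "\<lambda>_. 0"]) auto
  next
    case True
    then have pa: "perturbation \<alpha> \<sigma>" and pb: "perturbation \<beta> \<tau>"
      using \<alpha>p \<beta>p \<sigma> \<tau> by (auto simp: perturbation_def)
    \<comment> \<open>Near 0 this is the true remainder: \<open>ev\<close> provides finiteness of
      \<open>?OT t\<close> together with the smallness of \<open>R t\<close>.\<close>
    define R where "R t = real_of_ereal (?OT t) - dual \<alpha> \<beta> f g - t * (?a + ?b)" for t
    have ev: "eventually (\<lambda>t. \<bar>?OT t\<bar> \<noteq> \<infinity> \<and> \<bar>R t\<bar> \<le> e * \<bar>t\<bar>) (at 0 within ?T)" if e: "0 < e" for e
    proof -
      obtain d where d: "0 < d" "\<And>t. t \<in> ?T \<Longrightarrow> \<bar>t\<bar> < d \<Longrightarrow>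
        (\<exists>v. ?OT t = ereal v \<and> \<bar>v - dual \<alpha> \<beta> f g - t * (?a + ?b)\<bar> \<le> e * \<bar>t\<bar>)"
        using OT_expansion[OF \<alpha> \<beta> pa pb c br e] by blast
      show ?thesis
        unfolding eventually_at
      proof (intro exI[of _ d] conjI ballI impI d(1); elim conjE)
        fix t assume "t \<in> ?T" "dist t 0 < d"
        then obtain v where "?OT t = ereal v" "\<bar>v - dual \<alpha> \<beta> f g - t * (?a + ?b)\<bar> \<le> e * \<bar>t\<bar>"
          using d(2)[of t] by (auto simp: dist_real_def)
        then show "\<bar>?OT t\<bar> \<noteq> \<infinity>" "\<bar>R t\<bar> \<le> e * \<bar>t\<bar>" by (auto simp: R_def)
      qed
    qed
    have "R \<in> o[at 0 within ?T](\<lambda>t. t)"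
    proof (rule landau_o.smallI)
      fix e :: real assume "0 < e"
      from ev[OF this] show "eventually (\<lambda>t. norm (R t) \<le> e * norm t) (at 0 within ?T)"
        by eventually_elim simp
    qed
    moreover have "\<forall>\<^sub>F t in at 0 within ?T. ?OT t = OT \<epsilon> \<phi> C \<alpha> \<beta> + ereal (t * ?a + t * ?b + R t)"
      using ev[OF zero_less_one]
    proof eventually_elim
      case (elim t)
      then obtain v where "?OT t = ereal v" by (cases "?OT t") auto
      then show ?case by (simp add: OT0 R_def distrib_left)
    qed
    ultimately show ?thesis by blast
  qed
qed

lemma potentials_iff:
  assumes "\<alpha> \<in> nonzero_pos_measures" "\<beta> \<in> nonzero_pos_measures"
  shows "(f, g) \<in> potentials \<epsilon> \<phi> C \<alpha> \<beta> \<longleftrightarrow>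
    continuous_on UNIV f \<and> continuous_on UNIV g \<and> best_response \<alpha> f g \<and> best_response \<beta> g f"
  using best_response_iff[OF assms(1), of f g] best_response_iff[OF assms(2), of g f]
  by (auto simp: potentials_def)

lemma ereal_grad:
  assumes "dual_feasible f"
  shows "ereal (grad \<beta> f g x) = - conjugate (- f x) - ereal (\<epsilon> * (LINT y|\<beta>. gibbs f g x y - 1))"
  using assms by (simp add: dual_feasible_def conjugate_eq_cval grad_def)

text \<open>Subgradients live in the domain, where a derivative exists by assumption;
  \<open>subd_eq_derivative\<close> identifies it with the given subgradient.\<close>

lemma has_finite_derivative_subd:
  assumes "differentiable_on_domain conjugate" "s \<in> subd q"
  shows "has_finite_derivative conjugate s q"
  using assms subd_eq_derivative[OF _ assms(2)] subd_cdom[OF assms(2)]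
  unfolding differentiable_on_domain_def by metis

end

theorem theorem3:
  fixes C :: "'a::metric_space \<Rightarrow> 'a \<Rightarrow> real"
    and \<phi> :: "real \<Rightarrow> ennreal"
    and \<gamma> \<epsilon> :: real
  assumes compact_X: "compact (UNIV :: 'a set)"
    and C_continuous: "continuous_on UNIV (\<lambda>(x, y). C x y)"
    and C_symmetric: "\<And>x y. C x y = C y x"
    and C_Lipschitz: "\<And>z. \<gamma>-lipschitz_on UNIV (\<lambda>x. C x z)"
    and eps_pos: "0 < \<epsilon>"
    and entropy: "entropy_function \<phi>"
    and A1: "strictly_convex_on_domain (legendre \<phi>)"
    and A2: "\<exists>x s :: nat \<Rightarrow> real.
       (\<forall>n. x n \<in> effective_domain (legendre \<phi>) \<and> s n \<in> subdifferential (legendre \<phi>) (x n)) \<and>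
       (s \<longlonglongrightarrow> 0 \<or> filterlim s at_top sequentially)"
  shows "\<forall>\<alpha>\<in>nonzero_pos_measures. \<forall>\<beta>\<in>nonzero_pos_measures.
     (\<exists>!p. p \<in> potentials \<epsilon> \<phi> C \<alpha> \<beta>) \<and>
     (\<exists>a b. continuous_on UNIV a \<and> continuous_on UNIV b \<and>
        has_OT_gradient \<epsilon> \<phi> C \<alpha> \<beta> a b \<and>
        (\<forall>f g. (f, g) \<in> potentials \<epsilon> \<phi> C \<alpha> \<beta> \<longrightarrow>
           (\<forall>x. ereal (a x) = - legendre \<phi> (- f x)
                  - ereal (\<epsilon> * (LINT y|\<beta>. exp ((f x + g y - C x y) / \<epsilon>) - 1))) \<and>
           (\<forall>y. ereal (b y) = - legendre \<phi> (- g y)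
                  - ereal (\<epsilon> * (LINT x|\<alpha>. exp ((f x + g y - C x y) / \<epsilon>) - 1))) \<and>
           (differentiable_on_domain (legendre \<phi>) \<longrightarrow>
              (\<forall>x. has_finite_derivative (legendre \<phi>)
                     (LINT y|\<beta>. exp ((f x + g y - C x y) / \<epsilon>)) (- f x)) \<and>
              (\<forall>y. has_finite_derivative (legendre \<phi>)
                     (LINT x|\<alpha>. exp ((f x + g y - C x y) / \<epsilon>)) (- g y)))))"
proof (intro ballI, goal_cases)
  interpret entropic_ot \<phi> C \<gamma> \<epsilon>
    by unfold_locales (fact assms)+
  case (1 \<alpha> \<beta>)
  note \<alpha> = 1(1) and \<beta> = 1(2)
  then have p: "\<alpha> \<in> pos_measures" "\<beta> \<in> pos_measures" by (auto simp: nonzero_pos_measures_pos)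
  obtain f g where c: "continuous_on UNIV f" "continuous_on UNIV g"
    and br: "best_response \<alpha> f g" "best_response \<beta> g f"
    using response_pair_exists[OF \<alpha> \<beta>] by blast
  \<comment> \<open>By uniqueness all claims about arbitrary potentials reduce to the pair just
    obtained.\<close>
  have pot: "p \<in> potentials \<epsilon> \<phi> C \<alpha> \<beta> \<longleftrightarrow> p = (f, g)" for p
  proof
    assume p: "p \<in> potentials \<epsilon> \<phi> C \<alpha> \<beta>"
    obtain f' g' where fg': "p = (f', g')" by (cases p)
    from p have "continuous_on UNIV f'" "continuous_on UNIV g'" "best_response \<alpha> f' g'" "best_response \<beta> g' f'"
      by (simp_all add: fg' potentials_iff[OF \<alpha> \<beta>])
    then have "f' = f \<and> g' = g" by (intro response_pair_unique[OF \<alpha> \<beta>] c br)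
    then show "p = (f, g)" by (simp add: fg')
  next
    assume "p = (f, g)"
    then show "p \<in> potentials \<epsilon> \<phi> C \<alpha> \<beta>" using c br by (simp add: potentials_iff[OF \<alpha> \<beta>])
  qed
  have feas: "dual_feasible f" "dual_feasible g"
    by (rule best_response_feasible[OF \<beta> c(2) br(2)], rule best_response_feasible[OF \<alpha> c(1) br(1)])
  have a: "ereal (grad \<beta> f g x) = - conjugate (- f x) - ereal (\<epsilon> * (LINT y|\<beta>. exp ((f x + g y - C x y) / \<epsilon>) - 1))" for x
    using ereal_grad[OF feas(1), of \<beta> g x] by (simp add: gibbs_def)
  have b: "ereal (grad \<alpha> g f y) = - conjugate (- g y) - ereal (\<epsilon> * (LINT x|\<alpha>. exp ((f x + g y - C x y) / \<epsilon>) - 1))" for y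
    using ereal_grad[OF feas(2), of \<alpha> f y] unfolding gibbs_swap[of g f] by (simp add: gibbs_def)
  have s: "(LINT y|\<beta>. exp ((f x + g y - C x y) / \<epsilon>)) \<in> subd (- f x)"
    "(LINT x|\<alpha>. exp ((f x + g y - C x y) / \<epsilon>)) \<in> subd (- g y)" for x y
    using br(2)[unfolded best_response_swap] br(1)[unfolded best_response_def] unfolding gibbs_def by blast+
  show ?case
  proof (intro conjI exI allI impI)
    show "\<exists>!p. p \<in> potentials \<epsilon> \<phi> C \<alpha> \<beta>" by (simp add: pot)
    show "continuous_on UNIV (grad \<beta> f g)" by (rule continuous_grad[OF p(2) feas(1) c(2)])
    show "continuous_on UNIV (grad \<alpha> g f)" by (rule continuous_grad[OF p(1) feas(2) c(1)])
    show "has_OT_gradient \<epsilon> \<phi> C \<alpha> \<beta> (grad \<beta> f g) (grad \<alpha> g f)"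
      by (rule has_OT_gradient_grad[OF \<alpha> \<beta> c br])
    fix f' g' assume "(f', g') \<in> potentials \<epsilon> \<phi> C \<alpha> \<beta>"
    then have eq: "f' = f" "g' = g" by (simp_all add: pot)
    show "ereal (grad \<beta> f g x) = - legendre \<phi> (- f' x)
        - ereal (\<epsilon> * (LINT y|\<beta>. exp ((f' x + g' y - C x y) / \<epsilon>) - 1))" for x
      unfolding eq by (rule a)
    show "ereal (grad \<alpha> g f y) = - legendre \<phi> (- g' y)
        - ereal (\<epsilon> * (LINT x|\<alpha>. exp ((f' x + g' y - C x y) / \<epsilon>) - 1))" for y
      unfolding eq by (rule b)
    assume d: "differentiable_on_domain (legendre \<phi>)"
    show "has_finite_derivative (legendre \<phi>) (LINT y|\<beta>. exp ((f' x + g' y - C x y) / \<epsilon>)) (- f' x)" for x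
      unfolding eq by (rule has_finite_derivative_subd[OF d s(1)])
    show "has_finite_derivative (legendre \<phi>) (LINT x|\<alpha>. exp ((f' x + g' y - C x y) / \<epsilon>)) (- g' y)" for y
      unfolding eq by (rule has_finite_derivative_subd[OF d s(2)])
  qed
qed

end
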